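(* Let $\mathfrak T$ be (a skeleton of) the category of separable metric spaces and continuous maps, and let $\mathsf{Sh}(\mathfrak T)$ be the gros topos over $\mathfrak T$ with $\Sigma(X)=\mathcal O(X)$ as the object of open truth values. Then, in the internal sense of $\mathsf{Sh}(\mathfrak T)$: (1) All complete metrically separable metric spaces in $\mathsf{Sh}(\mathfrak T)$ are metrized. (2) All complete totally bounded metric spaces in $\mathsf{Sh}(\mathfrak T)$ are metrized and compact.
   Context: The metatheory is classical. $\mathfrak T$ is the full subcategory of $\mathbf{Top}$ on a set of representatives of homeomorphism classes of separable metrizable spaces (closed, up to homeomorphism, under open subspaces and countable products). A presheaf $F\colon\mathfrak T^{op}\to\mathbf{Set}$ is a sheaf if for every $X\in\mathfrak T$, every open cover $\{U_i\}$ of $X$ and every family $f_i\in F(U_i)$ agreeing on the intersections there is a unique $f\in F(X)$ restricting to all $f_i$. $\mathsf{Sh}(\mathfrak T)$ is the topos of sheaves. The subobject classifier is $\Omega(X)=$ the set of closed sieves on $X$ (sieves of maps of $\mathfrak T$ into $X$ such that a continuous map belongs to the sieve as soon as its restrictions to an open cover of its domain do), with pullback of sieves. The object of open (and test) truth values is $\Sigma\hookrightarrow\Omega$, $\Sigma(X)=\mathcal O(X)$, $\Sigma(f)=f^{-1}$, embedded by sending an open $U\subseteq X$ to the sieve of all maps with image in $U$. All notions below are interpreted in the internal (intuitionistic) language of $\mathsf{Sh}(\mathfrak T)$. The natural numbers and (Dedekind) real numbers objects are $\mathcal C(-,\mathbb N)$ and $\mathcal C(-,\mathbb R)$. A subset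 $U\subseteq Y$ is open if $(y\in U)\in\Sigma$ for all $y\in Y$. $Y$ is compact if $(\forall y\in Y.\ y\in U)\in\Sigma$ for all open $U\subseteq Y$. A map $f\colon I\to Y$ is overt if $(\exists i\in I.\ f(i)\in U)\in\Sigma$ for all open $U\subseteq Y$. A metric space $(Y,d)$ is metrized if every open subset of $Y$ is an overtly indexed union of balls $\bigcup_{i\in I}B(y_i,r_i)$, $B(y,r)=\{z\mid d(y,z)<r\}$, i.e. with $i\mapsto(y_i,r_i)$, $I\to Y\times\mathbb R$, an overt map. A pseudometric satisfies all metric axioms except that $d(x,y)=0$ need not imply $x=y$. A metric space $\mathbf X=(X,d)$ is complete if for every pseudometric space $\mathbf Y$ and every isometry $f\colon\mathbf X\to\mathbf Y$ whose image meets every ball of positive radius there is a unique isometry $h\colon\mathbf Y\to\mathbf X$ with $h\circ f=\mathrm{id}$. It is metrically separable if there is (given) $s\colon\mathbb N\to\mathbf 1+X$ such that for all $x\in X$, $r>0$ there is $n$ with $s_n\in X$, $d(x,s_n)<r$; totally bounded if there are (given) $s\colon\mathbb N\to\mathbf 1+X$, $a\colon\mathbb N\to\mathbb N$ such that for all $n\in\mathbb N$, $x\in X$ there is $k<a_n$ with $s_k\in X$ and $d(x,s_k)<2^{-n}$. *)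

theory Defs
  imports "HOL-Analysis.Analysis"
begin

section \<open>The site\<close>

text \<open>
  The site is the small category of all separable metrizable topologies whose points are drawn from
  one fixed type of the cardinality of the continuum. It is equivalent to its skeleton, contains a
  homeomorphic copy of every separable metrizable space (lemma \<open>is_T_representative\<close> below)
  and is closed under open subspaces on the nose. Only the cardinality of the type \<open>pt\<close> matters;
  its own product topology plays no role.
\<close>

type_synonym pt = "nat \<Rightarrow> real"
type_synonym space = "pt topology"

definition is_T :: "space \<Rightarrow> bool" where
  "is_T X \<longleftrightarrow> metrizable_space X \<and> separable_space X"

text \<open>Continuous maps are extensional, so that equality of maps is equality in HOL.\<close>

definition cmaps :: "space \<Rightarrow> 'b topology \<Rightarrow> (pt \<Rightarrow> 'b) set" where
  "cmaps X Y = {f \<in> extensional (topspace X). continuous_map X Y f}"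

text \<open>\<open>cmp D f g\<close> is the composite of \<open>g\<close> with domain \<open>D\<close>, followed by \<open>f\<close>.\<close>

definition cmp :: "space \<Rightarrow> (pt \<Rightarrow> 'b) \<Rightarrow> (pt \<Rightarrow> pt) \<Rightarrow> pt \<Rightarrow> 'b" where
  "cmp D f g = compose (topspace D) f g"

text \<open>
  \<open>incl D\<close> is the identity of \<open>D\<close> and also the inclusion of \<open>D\<close> into any space of which
  \<open>D\<close> is a subspace.
\<close>

definition incl :: "space \<Rightarrow> pt \<Rightarrow> pt" where
  "incl D = (\<lambda>t\<in>topspace D. t)"

definition arrs :: "space \<Rightarrow> (space \<times> (pt \<Rightarrow> pt)) set" where
  "arrs A = {(C, f). is_T C \<and> f \<in> cmaps C A}"

definition open_cover :: "space \<Rightarrow> pt set set \<Rightarrow> bool" where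
  "open_cover C \<U> \<longleftrightarrow> (\<forall>U\<in>\<U>. openin C U) \<and> \<Union>\<U> = topspace C"

definition on_cover :: "space \<Rightarrow> (space \<Rightarrow> (pt \<Rightarrow> pt) \<Rightarrow> bool) \<Rightarrow> bool" where
  "on_cover C P \<longleftrightarrow>
     (\<exists>\<U>. open_cover C \<U> \<and> (\<forall>U\<in>\<U>. P (subtopology C U) (incl (subtopology C U))))"

lemma is_T_representative:
  fixes X :: "'b topology"
  assumes mX: "metrizable_space X" and sX: "separable_space X"
  shows "\<exists>Y. is_T Y \<and> X homeomorphic_space Y"
proof -
  obtain M m where "Metric_space M m" and X: "X = Metric_space.mtopology M m"
    using mX unfolding metrizable_space_def by auto
  then interpret Metric_space M m by simp
  obtain S where S: "countable S" "S \<subseteq> M" "X closure_of S = M"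
    using sX unfolding separable_space_def X by auto
  define e where "e x n = m x (from_nat_into S n)" for x n
  have inj: "inj_on e M"
  proof (rule inj_onI, rule ccontr)
    fix x y assume xy: "x \<in> M" "y \<in> M" "e x = e y" "x \<noteq> y"
    then have pos: "m x y / 2 > 0" by simp
    then obtain s where s: "s \<in> S" "m x s < m x y / 2"
      using S(3) xy(1) unfolding X metric_closure_of by (fastforce simp: in_mball)
    obtain n where "s = from_nat_into S n"
      by (metis S(1) s(1) from_nat_into_surj)
    then have "m y s = m x s" using xy(3) unfolding e_def by metis
    moreover have "m x y \<le> m x s + m s y" using triangle xy s S by blast
    ultimately show False using s commute by simp
  qed
  define i where "i = inv_into M e"
  define Y where "Y = pullback_topology (e ` M) i X"
  have ie: "i (e x) = x" if "x \<in> M" for x using inj that by (simp add: i_def)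
  have tX: "topspace X = M" by (simp add: X)
  have tY: "topspace Y = e ` M"
    unfolding Y_def topspace_pullback_topology tX using ie by auto
  have ci: "continuous_map Y X i"
    using continuous_map_pullback[OF continuous_map_id] unfolding Y_def by (simp add: o_def id_def)
  have ce: "continuous_map X Y e"
    unfolding Y_def
  proof (rule continuous_map_pullback')
    show "continuous_map X X (i \<circ> e)"
      by (rule continuous_map_eq[OF continuous_map_id]) (simp add: tX ie)
    show "topspace X \<subseteq> e -` e ` M" by (auto simp: tX)
  qed
  have "homeomorphic_maps X Y e i"
    unfolding homeomorphic_maps_def using ci ce tX tY ie by auto
  then have "X homeomorphic_space Y" unfolding homeomorphic_space_def by blast
  then show ?thesis
    unfolding is_T_def using mX sX homeomorphic_metrizable_space homeomorphic_separable_space by blast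
qed


section \<open>Sheaves over a stage\<close>

text \<open>
  The objects at stage \<open>A\<close> (of the topos sliced over the representable object of \<open>A\<close>) are the
  sheaves on the slice of the site over \<open>A\<close>: \<open>Sec F C f\<close> is the set of sections over an arrow
  \<open>f\<close> from \<open>C\<close> to \<open>A\<close>, and \<open>Res F C f D g\<close> restricts these along \<open>g\<close> from \<open>D\<close> to \<open>C\<close>.
  When \<open>A\<close> is a one-point space this is a sheaf on the site itself.
\<close>

record 'x psh =
  Sec :: "space \<Rightarrow> (pt \<Rightarrow> pt) \<Rightarrow> 'x set"
  Res :: "space \<Rightarrow> (pt \<Rightarrow> pt) \<Rightarrow> space \<Rightarrow> (pt \<Rightarrow> pt) \<Rightarrow> 'x \<Rightarrow> 'x"

definition presheaf_over :: "space \<Rightarrow> 'x psh \<Rightarrow> bool" where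
  "presheaf_over A F \<longleftrightarrow>
     (\<forall>(C, f)\<in>arrs A. \<forall>x\<in>Sec F C f.
        Res F C f C (incl C) x = x \<and>
        (\<forall>(D, g)\<in>arrs C.
           Res F C f D g x \<in> Sec F D (cmp D f g) \<and>
           (\<forall>(E, k)\<in>arrs D.
              Res F D (cmp D f g) E k (Res F C f D g x) = Res F C f E (cmp E g k) x)))"

definition amap_restr :: "space \<Rightarrow> (pt \<Rightarrow> 'b) \<Rightarrow> pt set \<Rightarrow> pt \<Rightarrow> 'b" where
  "amap_restr C f U = cmp (subtopology C U) f (incl (subtopology C U))"

definition sheaf_over :: "space \<Rightarrow> 'x psh \<Rightarrow> bool" where
  "sheaf_over A F \<longleftrightarrow> presheaf_over A F \<and>
     (\<forall>(C, f)\<in>arrs A. \<forall>\<U> s.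
        open_cover C \<U> \<longrightarrow>
        (\<forall>U\<in>\<U>. s U \<in> Sec F (subtopology C U) (amap_restr C f U)) \<longrightarrow>
        (\<forall>U\<in>\<U>. \<forall>V\<in>\<U>. let W = subtopology C (U \<inter> V) in
           Res F (subtopology C U) (amap_restr C f U) W (incl W) (s U) =
           Res F (subtopology C V) (amap_restr C f V) W (incl W) (s V)) \<longrightarrow>
        (\<exists>!x. x \<in> Sec F C f \<and>
           (\<forall>U\<in>\<U>. Res F C f (subtopology C U) (incl (subtopology C U)) x = s U)))"

definition nat_map :: "space \<Rightarrow> 'x psh \<Rightarrow> 'y psh \<Rightarrow> (space \<Rightarrow> (pt \<Rightarrow> pt) \<Rightarrow> 'x \<Rightarrow> 'y) \<Rightarrow> bool" where
  "nat_map A F G \<eta> \<longleftrightarrow>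
     (\<forall>(C, f)\<in>arrs A. \<forall>x\<in>Sec F C f.
        \<eta> C f x \<in> Sec G C f \<and>
        (\<forall>(D, g)\<in>arrs C. \<eta> D (cmp D f g) (Res F C f D g x) = Res G C f D g (\<eta> C f x)))"

text \<open>Change of stage along an arrow \<open>h\<close> into \<open>A\<close>, for sheaves and for maps between them.\<close>

definition pb :: "(pt \<Rightarrow> pt) \<Rightarrow> 'x psh \<Rightarrow> 'x psh" where
  "pb h F = \<lparr>Sec = (\<lambda>C f. Sec F C (cmp C h f)), Res = (\<lambda>C f D g. Res F C (cmp C h f) D g)\<rparr>"

definition pbm :: "(pt \<Rightarrow> pt) \<Rightarrow> (space \<Rightarrow> (pt \<Rightarrow> pt) \<Rightarrow> 'x \<Rightarrow> 'y) \<Rightarrow> space \<Rightarrow> (pt \<Rightarrow> pt) \<Rightarrow> 'x \<Rightarrow> 'y" where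
  "pbm h \<eta> = (\<lambda>C f. \<eta> C (cmp C h f))"

definition prod_psh :: "'x psh \<Rightarrow> 'y psh \<Rightarrow> ('x \<times> 'y) psh" where
  "prod_psh F G =
     \<lparr>Sec = (\<lambda>C f. Sec F C f \<times> Sec G C f),
      Res = (\<lambda>C f D g. map_prod (Res F C f D g) (Res G C f D g))\<rparr>"

text \<open>The sheaf of continuous maps into a fixed space; in particular the numbers objects.\<close>

definition cont_psh :: "'b topology \<Rightarrow> (pt \<Rightarrow> 'b) psh" where
  "cont_psh Y = \<lparr>Sec = (\<lambda>C f. cmaps C Y), Res = (\<lambda>C f D g u. cmp D u g)\<rparr>"

definition Nat_obj :: "(pt \<Rightarrow> nat) psh" where
  "Nat_obj = cont_psh (discrete_topology UNIV)"

definition Real_obj :: "(pt \<Rightarrow> real) psh" where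
  "Real_obj = cont_psh euclideanreal"

text \<open>
  The coproduct of the terminal object and \<open>X\<close> in the category of sheaves. A section over \<open>C\<close> splits
  \<open>C\<close> into two clopen pieces and consists of a section of \<open>X\<close> over the piece \<open>W\<close> (and of the
  only section of the terminal object over the other piece). The section lies in the summand \<open>X\<close> iff
  \<open>W = topspace C\<close>.
\<close>

definition one_plus :: "'x psh \<Rightarrow> (pt set \<times> 'x) psh" where
  "one_plus X =
     \<lparr>Sec = (\<lambda>C f. {(W, x). openin C W \<and> closedin C W \<and>
                          x \<in> Sec X (subtopology C W) (amap_restr C f W)}),
      Res = (\<lambda>C f D g (W, x).
               let W' = {t \<in> topspace D. g t \<in> W} in
               (W', Res X (subtopology C W) (amap_restr C f W)
                          (subtopology D W') (amap_restr D g W') x))\<rparr>"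


section \<open>Truth values and open subsets\<close>

text \<open>Truth values at stage \<open>C\<close> are closed sieves on \<open>C\<close>; the value \<open>true\<close> is the sieve \<open>arrs C\<close>.\<close>

type_synonym sieve = "(space \<times> (pt \<Rightarrow> pt)) set"

definition closed_sieve :: "space \<Rightarrow> sieve \<Rightarrow> bool" where
  "closed_sieve C S \<longleftrightarrow> S \<subseteq> arrs C \<and>
     (\<forall>(D, g)\<in>S. \<forall>(E, k)\<in>arrs D. (E, cmp E g k) \<in> S) \<and>
     (\<forall>(D, g)\<in>arrs C. on_cover D (\<lambda>E k. (E, cmp E g k) \<in> S) \<longrightarrow> (D, g) \<in> S)"

definition Omega :: "sieve psh" where
  "Omega = \<lparr>Sec = (\<lambda>C f. {S. closed_sieve C S}),
            Res = (\<lambda>C f D g S. {(E, k) \<in> arrs D. (E, cmp E g k) \<in> S})\<rparr>"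

definition Sigma_tv :: "space \<Rightarrow> sieve set" where
  "Sigma_tv C = {{(D, g) \<in> arrs C. g ` topspace D \<subseteq> U} | U. openin C U}"

text \<open>
  Kripke--Joyal semantics of the quantifiers: the truth values of \<open>\<forall>y\<in>F. \<phi>(y)\<close> and
  \<open>\<exists>y\<in>F. \<phi>(y)\<close> at stage \<open>C\<close>, for an object \<open>F\<close> at stage \<open>C\<close> and a map \<open>\<phi>\<close> from \<open>F\<close> to \<open>Omega\<close>.
\<close>

definition tv_all :: "space \<Rightarrow> 'x psh \<Rightarrow> (space \<Rightarrow> (pt \<Rightarrow> pt) \<Rightarrow> 'x \<Rightarrow> sieve) \<Rightarrow> sieve" where
  "tv_all C F \<phi> = {(D, g) \<in> arrs C.
     \<forall>(E, k)\<in>arrs D. \<forall>y\<in>Sec F E (cmp E g k). \<phi> E (cmp E g k) y = arrs E}"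

definition tv_ex :: "space \<Rightarrow> 'x psh \<Rightarrow> (space \<Rightarrow> (pt \<Rightarrow> pt) \<Rightarrow> 'x \<Rightarrow> sieve) \<Rightarrow> sieve" where
  "tv_ex C F \<phi> = {(D, g) \<in> arrs C.
     on_cover D (\<lambda>E k. \<exists>y\<in>Sec F E (cmp E g k). \<phi> E (cmp E g k) y = arrs E)}"

definition tv_less :: "space \<Rightarrow> (pt \<Rightarrow> real) \<Rightarrow> (pt \<Rightarrow> real) \<Rightarrow> sieve" where
  "tv_less C u v = {(D, g) \<in> arrs C. \<forall>t\<in>topspace D. u (g t) < v (g t)}"

definition open_subset :: "space \<Rightarrow> 'x psh \<Rightarrow> (space \<Rightarrow> (pt \<Rightarrow> pt) \<Rightarrow> 'x \<Rightarrow> sieve) \<Rightarrow> bool" where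
  "open_subset A Y U \<longleftrightarrow> nat_map A Y Omega U \<and>
     (\<forall>(C, f)\<in>arrs A. \<forall>y\<in>Sec Y C f. U C f y \<in> Sigma_tv C)"

definition compact_obj :: "space \<Rightarrow> 'x psh \<Rightarrow> bool" where
  "compact_obj A Y \<longleftrightarrow>
     (\<forall>(B, h)\<in>arrs A. \<forall>U. open_subset B (pb h Y) U \<longrightarrow> tv_all B (pb h Y) U \<in> Sigma_tv B)"

definition overt_map :: "space \<Rightarrow> 'i psh \<Rightarrow> 'y psh \<Rightarrow> (space \<Rightarrow> (pt \<Rightarrow> pt) \<Rightarrow> 'i \<Rightarrow> 'y) \<Rightarrow> bool" where
  "overt_map A I Y f \<longleftrightarrow> nat_map A I Y f \<and>
     (\<forall>(B, h)\<in>arrs A. \<forall>U. open_subset B (pb h Y) U \<longrightarrow>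
        tv_ex B (pb h I) (\<lambda>C g i. U C g (pbm h f C g i)) \<in> Sigma_tv B)"


section \<open>Metric spaces\<close>

type_synonym 'x dist = "space \<Rightarrow> (pt \<Rightarrow> pt) \<Rightarrow> 'x \<times> 'x \<Rightarrow> pt \<Rightarrow> real"

definition pseudometric_obj :: "space \<Rightarrow> 'x psh \<Rightarrow> 'x dist \<Rightarrow> bool" where
  "pseudometric_obj A X d \<longleftrightarrow> sheaf_over A X \<and> nat_map A (prod_psh X X) Real_obj d \<and>
     (\<forall>(C, f)\<in>arrs A. \<forall>x\<in>Sec X C f. \<forall>y\<in>Sec X C f. \<forall>z\<in>Sec X C f. \<forall>t\<in>topspace C.
        0 \<le> d C f (x, y) t \<and>
        d C f (x, x) t = 0 \<and>
        d C f (x, y) t = d C f (y, x) t \<and>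
        d C f (x, z) t \<le> d C f (x, y) t + d C f (y, z) t)"

definition metric_obj :: "space \<Rightarrow> 'x psh \<Rightarrow> 'x dist \<Rightarrow> bool" where
  "metric_obj A X d \<longleftrightarrow> pseudometric_obj A X d \<and>
     (\<forall>(C, f)\<in>arrs A. \<forall>x\<in>Sec X C f. \<forall>y\<in>Sec X C f.
        (\<forall>t\<in>topspace C. d C f (x, y) t = 0) \<longrightarrow> x = y)"

definition isometry_over ::
  "space \<Rightarrow> 'x psh \<Rightarrow> 'x dist \<Rightarrow> 'y psh \<Rightarrow> 'y dist \<Rightarrow> (space \<Rightarrow> (pt \<Rightarrow> pt) \<Rightarrow> 'x \<Rightarrow> 'y) \<Rightarrow> bool" where
  "isometry_over A X d Y e f \<longleftrightarrow> nat_map A X Y f \<and>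
     (\<forall>(C, g)\<in>arrs A. \<forall>x\<in>Sec X C g. \<forall>y\<in>Sec X C g. \<forall>t\<in>topspace C.
        e C g (f C g x, f C g y) t = d C g (x, y) t)"

definition dense_image ::
  "space \<Rightarrow> 'x psh \<Rightarrow> 'y psh \<Rightarrow> 'y dist \<Rightarrow> (space \<Rightarrow> (pt \<Rightarrow> pt) \<Rightarrow> 'x \<Rightarrow> 'y) \<Rightarrow> bool" where
  "dense_image A X Y e f \<longleftrightarrow>
     (\<forall>(C, g)\<in>arrs A. \<forall>y\<in>Sec Y C g. \<forall>r\<in>Sec Real_obj C g. (\<forall>t\<in>topspace C. 0 < r t) \<longrightarrow>
        on_cover C (\<lambda>D k. \<exists>x\<in>Sec X D (cmp D g k). \<forall>t\<in>topspace D.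
          e D (cmp D g k) (Res Y C g D k y, f D (cmp D g k) x) t < r (k t)))"

text \<open>
  The quantifier over pseudometric spaces ranges over all objects at all later stages. Unique
  existence of \<open>k\<close> is automatically global, since the internal maps between two sheaves form a sheaf.
\<close>

definition complete_obj :: "space \<Rightarrow> 'u psh \<Rightarrow> 'u dist \<Rightarrow> bool" where
  "complete_obj A X d \<longleftrightarrow>
     (\<forall>(B, h)\<in>arrs A. \<forall>(Y :: 'u psh) e f.
        pseudometric_obj B Y e \<and> isometry_over B (pb h X) (pbm h d) Y e f \<and>
        dense_image B (pb h X) Y e f \<longrightarrow>
        (let retr = (\<lambda>k. isometry_over B Y e (pb h X) (pbm h d) k \<and>
                      (\<forall>(C, g)\<in>arrs B. \<forall>x\<in>Sec (pb h X) C g. k C g (f C g x) = x))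
         in \<exists>k. retr k \<and>
              (\<forall>k'. retr k' \<longrightarrow> (\<forall>(C, g)\<in>arrs B. \<forall>y\<in>Sec Y C g. k' C g y = k C g y))))"

text \<open>\<open>in_ball\<close>: the truth value at \<open>C\<close> of \<open>z\<close> lying in the ball with centre and radius \<open>(y, r)\<close>.\<close>

definition in_ball :: "'x dist \<Rightarrow> space \<Rightarrow> (pt \<Rightarrow> pt) \<Rightarrow> 'x \<times> (pt \<Rightarrow> real) \<Rightarrow> 'x \<Rightarrow> sieve" where
  "in_ball d C f = (\<lambda>(y, r) z. tv_less C (d C f (y, z)) r)"

definition overt_union_of_balls ::
  "space \<Rightarrow> 'u psh \<Rightarrow> 'u dist \<Rightarrow> (space \<Rightarrow> (pt \<Rightarrow> pt) \<Rightarrow> 'u \<Rightarrow> sieve) \<Rightarrow> bool" where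
  "overt_union_of_balls A Y d U \<longleftrightarrow>
     (\<exists>(I :: 'u psh) c. sheaf_over A I \<and> overt_map A I (prod_psh Y Real_obj) c \<and>
        (\<forall>(C, f)\<in>arrs A. \<forall>z\<in>Sec Y C f.
           U C f z = tv_ex C (pb f I)
             (\<lambda>D g i. in_ball d D (cmp D f g) (c D (cmp D f g) i) (Res Y C f D g z))))"

definition metrized_obj :: "space \<Rightarrow> 'u psh \<Rightarrow> 'u dist \<Rightarrow> bool" where
  "metrized_obj A Y d \<longleftrightarrow>
     (\<forall>(B, h)\<in>arrs A. \<forall>U. open_subset B (pb h Y) U \<longrightarrow>
        on_cover B (\<lambda>W j. overt_union_of_balls W (pb j (pb h Y)) (pbm j (pbm h d)) (pbm j U)))"

text \<open>
  The witnessing sequences are required to exist internally, i.e. on the members of an open cover of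
  the stage. In particular this holds when they are given at the stage itself. \<open>s n\<close> lies in \<open>X\<close>
  over all of \<open>D\<close> iff it is a pair \<open>(topspace D, y)\<close>; see \<open>one_plus\<close>.
\<close>

definition metrically_separable_obj :: "space \<Rightarrow> 'x psh \<Rightarrow> 'x dist \<Rightarrow> bool" where
  "metrically_separable_obj A X d \<longleftrightarrow> on_cover A (\<lambda>B h. \<exists>s.
     nat_map B Nat_obj (one_plus (pb h X)) s \<and>
     (\<forall>(C, f)\<in>arrs B. \<forall>x\<in>Sec (pb h X) C f. \<forall>r\<in>Sec Real_obj C f. (\<forall>t\<in>topspace C. 0 < r t) \<longrightarrow>
        on_cover C (\<lambda>D g. \<exists>n\<in>Sec Nat_obj D (cmp D f g). \<exists>y\<in>Sec (pb h X) D (cmp D f g).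
          s D (cmp D f g) n = (topspace D, y) \<and>
          (\<forall>t\<in>topspace D. pbm h d D (cmp D f g) (Res (pb h X) C f D g x, y) t < r (g t)))))"

definition totally_bounded_obj :: "space \<Rightarrow> 'x psh \<Rightarrow> 'x dist \<Rightarrow> bool" where
  "totally_bounded_obj A X d \<longleftrightarrow> on_cover A (\<lambda>B h. \<exists>s a.
     nat_map B Nat_obj (one_plus (pb h X)) s \<and> nat_map B Nat_obj Nat_obj a \<and>
     (\<forall>(C, f)\<in>arrs B. \<forall>n\<in>Sec Nat_obj C f. \<forall>x\<in>Sec (pb h X) C f.
        on_cover C (\<lambda>D g. \<exists>k\<in>Sec Nat_obj D (cmp D f g). \<exists>y\<in>Sec (pb h X) D (cmp D f g).
          (\<forall>t\<in>topspace D. k t < a C f n (g t)) \<and>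
          s D (cmp D f g) k = (topspace D, y) \<and>
          (\<forall>t\<in>topspace D. pbm h d D (cmp D f g) (Res (pb h X) C f D g x, y) t < (1/2) ^ n (g t)))))"

text \<open>
  Sets of sections are subsets of a fixed type playing the role of the category of sets. It holds
  an arbitrary type \<open>'a\<close> together with all maps of the site, so that metric completions of
  separable spaces, and index objects, are available in it.
\<close>

type_synonym 'a univ = "'a + (pt \<Rightarrow> pt)"

end

theory Submission
  imports Defs
begin

text \<open>
  A complete metric object with a dense sequence is representable over its stage, by a separable
  metrizable space; the statements about all objects and all maps of the topos then become statements
  about this one space.

  Let \<open>X\<close> be complete over \<open>A\<close>, with a dense sequence \<open>s\<close> whose \<open>n\<close>-th term is defined over the
  clopen part \<open>sdom n\<close> of \<open>A\<close>. A section \<open>x\<close> over \<open>f\<close> from \<open>C\<close> to \<open>A\<close> is determined by its code, the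
  continuous map from \<open>C\<close> to \<open>\<real>\<^sup>\<nat>\<close> with coordinates \<open>t \<mapsto> d (x, s n) t\<close>. Over a point \<open>b\<close> of \<open>A\<close> the
  codes are the functions \<open>c\<close> with \<open>\<bar>c m - d (s n, s m) b\<bar> \<le> c n\<close> for all \<open>n\<close>, \<open>m\<close> and with infimum
  zero (\<open>fib b\<close>): the distance functions of the points of the completion of the sequence. The
  continuous maps with values in these fibres form a sheaf, the supremum distance makes it a
  pseudometric object, and coding is an isometry from \<open>X\<close> onto a dense part of it. Completeness of
  \<open>X\<close> yields an isometric retraction, so every continuous map with values in the fibres is a code
  (\<open>code_surj\<close>). Thus sections of \<open>X\<close> over \<open>f\<close> are the lifts of \<open>f\<close> to the subspace
  \<open>E = {(b, c). c \<in> fib b}\<close> of \<open>A \<times> \<real>\<^sup>\<nat>\<close>, and evaluating an open subset of \<open>X\<close> at the generic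
  section over \<open>E\<close> turns it into an open subset \<open>G\<close> of \<open>E\<close> (\<open>open_subset_code\<close>).

  For the first part, a point \<open>(b, c)\<close> of \<open>G\<close> has some coordinate \<open>c n\<close> that is as small as desired, and
  all points over a neighbourhood of \<open>b\<close> with small \<open>n\<close>-th coordinate are close to it; hence
  \<open>G\<close> contains a ball around the \<open>n\<close>-th term over that neighbourhood (\<open>ex_ball_in\<close>). All these balls
  together are indexed by a coproduct of open subspaces of \<open>A\<close>, and such an index object is overt
  (\<open>tv_ex_fiber_discrete\<close>).

  For the second part, total boundedness makes every fibre a compact subset of \<open>\<real>\<^sup>\<nat>\<close>. If \<open>G\<close> contains
  the whole fibre over \<open>b\<close>, finitely many of the balls above cover this fibre, and since every
  point over a nearby \<open>b'\<close> is close to one of finitely many terms of the sequence, these balls cover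
  the fibres near \<open>b\<close> as well (\<open>open_all_fib\<close>). So the set of points over which \<open>G\<close> contains everything
  is open, and this set represents the truth value of the universal quantifier (\<open>tv_all_eq\<close>).

  The hypotheses give sequences only over the members of an open cover, and the conclusions concern all
  later stages. The last sections therefore pull the sequences back along arrows of the site and
  glue the results.
\<close>

section \<open>Separable metrizable spaces\<close>

lemma second_countable_if_metrizable_separable:
  assumes "metrizable_space X" "separable_space X"
  shows "second_countable X"
proof -
  obtain M m where "Metric_space M m" and X: "X = Metric_space.mtopology M m"
    using assms(1) unfolding metrizable_space_def by auto
  then interpret Metric_space M m by simp
  obtain S where S: "countable S" "S \<subseteq> M" "X closure_of S = M"
    using assms(2) unfolding separable_space_def X by auto
  define \<B> where "\<B> = (\<lambda>(s, k::nat). mball s (1 / Suc k)) ` (S \<times> UNIV)"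
  show ?thesis
    unfolding second_countable_def
  proof (intro exI[of _ \<B>] conjI ballI allI impI)
    show "countable \<B>" using S(1) by (simp add: \<B>_def)
  next
    fix V assume "V \<in> \<B>"
    then show "openin X V" unfolding \<B>_def X by auto
  next
    fix U x assume "openin X U \<and> x \<in> U"
    then obtain r where r: "r > 0" "mball x r \<subseteq> U" and x: "x \<in> M"
      unfolding X openin_mtopology by blast
    obtain k :: nat where k: "1 / Suc k < r / 2"
      using r(1) nat_approx_posE[of "r/2"] by auto
    obtain s where s: "s \<in> S" "m x s < 1 / Suc k"
      using S(3) x unfolding X metric_closure_of
      by (fastforce simp: in_mball dest!: spec[of _ "1 / Suc k"])
    have "mball s (1 / Suc k) \<subseteq> U"
    proof
      fix y assume y: "y \<in> mball s (1 / Suc k)"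
      have "m x y \<le> m x s + m s y" using y s S x by (intro triangle) auto
      also have "\<dots> < r" using y s k by auto
      finally show "y \<in> U" using r(2) y x by auto
    qed
    moreover have "x \<in> mball s (1 / Suc k)" using s S x by (auto simp: commute)
    ultimately show "\<exists>V\<in>\<B>. x \<in> V \<and> V \<subseteq> U"
      using s(1) by (intro bexI[of _ "mball s (1 / Suc k)"]) (auto simp: \<B>_def)
  qed
qed

lemma second_countable_prod_topology:
  assumes "second_countable X" "second_countable Y"
  shows "second_countable (prod_topology X Y)"
proof -
  obtain \<B> where \<B>: "countable \<B>" "\<forall>V\<in>\<B>. openin X V"
    "\<forall>U x. openin X U \<and> x \<in> U \<longrightarrow> (\<exists>V\<in>\<B>. x \<in> V \<and> V \<subseteq> U)"
    using assms(1) unfolding second_countable_def by (elim exE conjE) (rule that)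
  obtain \<C> where \<C>: "countable \<C>" "\<forall>V\<in>\<C>. openin Y V"
    "\<forall>U x. openin Y U \<and> x \<in> U \<longrightarrow> (\<exists>V\<in>\<C>. x \<in> V \<and> V \<subseteq> U)"
    using assms(2) unfolding second_countable_def by (elim exE conjE) (rule that)
  show ?thesis
    unfolding second_countable_def
  proof (intro exI[of _ "(\<lambda>(U, V). U \<times> V) ` (\<B> \<times> \<C>)"] conjI ballI allI impI)
    show "countable ((\<lambda>(U, V). U \<times> V) ` (\<B> \<times> \<C>))" using \<B>(1) \<C>(1) by simp
  next
    fix V assume "V \<in> (\<lambda>(U, V). U \<times> V) ` (\<B> \<times> \<C>)"
    then show "openin (prod_topology X Y) V"
      using \<B>(2) \<C>(2) by (auto simp: openin_prod_Times_iff)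
  next
    fix W z assume W: "openin (prod_topology X Y) W \<and> z \<in> W"
    obtain x y where z: "z = (x, y)" by force
    obtain U V where UV: "openin X U" "openin Y V" "x \<in> U" "y \<in> V" "U \<times> V \<subseteq> W"
      using W unfolding openin_prod_topology_alt z by blast
    obtain U' V' where "U' \<in> \<B>" "x \<in> U'" "U' \<subseteq> U" "V' \<in> \<C>" "y \<in> V'" "V' \<subseteq> V"
      using \<B>(3)[rule_format, OF conjI, OF UV(1,3)] \<C>(3)[rule_format, OF conjI, OF UV(2,4)] by blast
    then show "\<exists>V\<in>(\<lambda>(U, V). U \<times> V) ` (\<B> \<times> \<C>). z \<in> V \<and> V \<subseteq> W"
      using UV(5) z by (intro bexI[of _ "U' \<times> V'"]) auto
  qed
qed

lemma second_countable_euclidean: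
  "second_countable (euclidean :: 'a::second_countable_topology topology)"
proof -
  obtain \<B> :: "'a set set" where \<B>: "countable \<B>" "topological_basis \<B>"
    using ex_countable_basis by blast
  show ?thesis
    unfolding second_countable_def
  proof (intro exI[of _ \<B>] conjI ballI allI impI)
    fix U and x :: 'a assume "openin euclidean U \<and> x \<in> U"
    then show "\<exists>V\<in>\<B>. x \<in> V \<and> V \<subseteq> U"
      using \<B>(2) by (meson open_openin topological_basisE)
  qed (use \<B> topological_basis_open in auto)
qed

lemma is_T_iff: "is_T X \<longleftrightarrow> metrizable_space X \<and> second_countable X"
  unfolding is_T_def
  using second_countable_if_metrizable_separable second_countable_imp_separable_space by blast

lemma is_T_subtopology: "is_T X \<Longrightarrow> is_T (subtopology X S)"
  unfolding is_T_iff using metrizable_space_subtopology second_countable_subtopology by blast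


section \<open>Arrows of the site\<close>

lemma arrs_iff:
  "(C, f) \<in> arrs A \<longleftrightarrow> is_T C \<and> f \<in> extensional (topspace C) \<and> continuous_map C A f"
  by (auto simp: arrs_def cmaps_def)

lemma arrs_is_T: "(C, f) \<in> arrs A \<Longrightarrow> is_T C"
  and arrs_ext: "(C, f) \<in> arrs A \<Longrightarrow> f \<in> extensional (topspace C)"
  and arrs_cont: "(C, f) \<in> arrs A \<Longrightarrow> continuous_map C A f"
  by (simp_all add: arrs_iff)

lemma arrs_in: "(C, f) \<in> arrs A \<Longrightarrow> t \<in> topspace C \<Longrightarrow> f t \<in> topspace A"
  by (meson arrs_iff continuous_map_image_subset_topspace image_subset_iff)

lemma cmp_apply: "t \<in> topspace D \<Longrightarrow> cmp D f g t = f (g t)"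
  by (simp add: cmp_def compose_def)

lemma incl_apply: "t \<in> topspace D \<Longrightarrow> incl D t = t"
  by (simp add: incl_def)

lemma cmp_ext: "cmp D f g \<in> extensional (topspace D)"
  by (simp add: cmp_def)

lemma cmp_cmaps:
  assumes "u \<in> cmaps C Y" "(D, g) \<in> arrs C"
  shows "cmp D u g \<in> cmaps D Y"
proof -
  have "continuous_map D Y (u \<circ> g)"
    using assms by (auto simp: cmaps_def arrs_iff intro: continuous_map_compose)
  then have "continuous_map D Y (cmp D u g)"
    by (rule continuous_map_eq) (simp add: cmp_apply)
  then show ?thesis by (simp add: cmaps_def cmp_ext)
qed

lemma arrs_cmp: "(C, f) \<in> arrs A \<Longrightarrow> (D, g) \<in> arrs C \<Longrightarrow> (D, cmp D f g) \<in> arrs A"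
  using cmp_cmaps[of f C A D g] by (simp add: arrs_def)

text \<open>
  Only the innermost arrow has to be one of the site: composites are restricted to the domain of
  that arrow, so its values must be points where the outer composite is defined.
\<close>

lemma cmp_assoc: "(E, k) \<in> arrs D \<Longrightarrow> cmp E (cmp D f g) k = cmp E f (cmp E g k)"
  by (auto simp: fun_eq_iff cmp_def compose_def restrict_def dest: arrs_in)

lemma arrs_incl: "is_T C \<Longrightarrow> (subtopology C U, incl (subtopology C U)) \<in> arrs C"
  unfolding arrs_iff
proof (intro conjI)
  show "continuous_map (subtopology C U) C (incl (subtopology C U))"
    by (rule continuous_map_eq[OF continuous_map_from_subtopology[OF continuous_map_id]])
       (simp add: incl_def)
qed (auto simp: is_T_subtopology incl_def)

lemma arrs_id: "is_T C \<Longrightarrow> (C, incl C) \<in> arrs C"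
  using arrs_incl[of C "topspace C"] by simp

lemma cmp_incl: "f \<in> extensional (topspace C) \<Longrightarrow> cmp C f (incl C) = f"
  by (auto simp: fun_eq_iff cmp_def compose_def restrict_def incl_def extensional_def)

lemma incl_cmp:
  assumes "(D, g) \<in> arrs C" shows "cmp D (incl C) g = g"
proof (rule extensionalityI[OF cmp_ext arrs_ext[OF assms]])
  fix t assume "t \<in> topspace D"
  then show "cmp D (incl C) g t = g t"
    using arrs_in[OF assms] by (simp add: cmp_apply incl_apply)
qed

lemma arrs_amap_restr: "(C, f) \<in> arrs A \<Longrightarrow> (subtopology C U, amap_restr C f U) \<in> arrs A"
  unfolding amap_restr_def using arrs_cmp arrs_incl arrs_is_T by blast

lemma amap_restr_apply: "t \<in> topspace C \<Longrightarrow> t \<in> U \<Longrightarrow> amap_restr C f U t = f t"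
  by (simp add: amap_restr_def cmp_apply incl_apply)

lemma amap_restr_topspace: "(C, f) \<in> arrs A \<Longrightarrow> amap_restr C f (topspace C) = f"
  by (simp add: amap_restr_def cmp_incl arrs_ext)

text \<open>
  A space and its subspaces draw their points from the same type, so an arrow into a subspace is
  the same function as the corresponding arrow into the whole space.
\<close>

lemma arrs_corestrict:
  "(D, g) \<in> arrs C \<Longrightarrow> g ` topspace D \<subseteq> U \<Longrightarrow> (D, g) \<in> arrs (subtopology C U)"
  by (auto simp: arrs_iff continuous_map_in_subtopology)

text \<open>
  Covers are always built from a neighbourhood of each point; the members of the cover are then all
  open sets with the property in question.
\<close>

lemma on_coverI:
  assumes "is_T C"
    and "\<And>t. t \<in> topspace C \<Longrightarrow> \<exists>U. openin C U \<and> t \<in> U \<and> P (subtopology C U) (incl (subtopology C U))"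
  shows "on_cover C P"
proof -
  let ?\<U> = "{U. openin C U \<and> P (subtopology C U) (incl (subtopology C U))}"
  have "open_cover C ?\<U>"
    unfolding open_cover_def using assms(2) openin_subset by blast
  then show ?thesis unfolding on_cover_def by blast
qed

lemma on_coverE:
  assumes "on_cover C P" "t \<in> topspace C"
  obtains U where "openin C U" "t \<in> U" "P (subtopology C U) (incl (subtopology C U))"
  using assms unfolding on_cover_def open_cover_def by blast

lemma on_cover_mono:
  assumes "on_cover C P" "is_T C"
    and "\<And>D g. (D, g) \<in> arrs C \<Longrightarrow> P D g \<Longrightarrow> Q D g"
  shows "on_cover C Q"
  using assms(1) assms(3)[OF arrs_incl[OF assms(2)]] unfolding on_cover_def by blast

section \<open>Presheaves and change of stage\<close>

lemma presheafD:
  assumes "presheaf_over A F" "(C, f) \<in> arrs A" "x \<in> Sec F C f"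
  shows Res_id: "Res F C f C (incl C) x = x"
    and Res_in: "(D, g) \<in> arrs C \<Longrightarrow> Res F C f D g x \<in> Sec F D (cmp D f g)"
    and Res_Res: "(D, g) \<in> arrs C \<Longrightarrow> (E, k) \<in> arrs D \<Longrightarrow>
      Res F D (cmp D f g) E k (Res F C f D g x) = Res F C f E (cmp E g k) x"
  using assms unfolding presheaf_over_def by blast+

lemma sheaf_glue:
  assumes "sheaf_over A F" "(C, f) \<in> arrs A" "open_cover C \<U>"
    and "\<forall>U\<in>\<U>. s U \<in> Sec F (subtopology C U) (amap_restr C f U)"
    and "\<forall>U\<in>\<U>. \<forall>V\<in>\<U>. let W = subtopology C (U \<inter> V) in
           Res F (subtopology C U) (amap_restr C f U) W (incl W) (s U) =
           Res F (subtopology C V) (amap_restr C f V) W (incl W) (s V)"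
  shows "\<exists>!x. x \<in> Sec F C f \<and>
           (\<forall>U\<in>\<U>. Res F C f (subtopology C U) (incl (subtopology C U)) x = s U)"
  using assms(1)[unfolded sheaf_over_def, THEN conjunct2, THEN bspec, OF assms(2),
        unfolded prod.case, THEN spec, THEN spec, THEN mp, THEN mp, THEN mp, OF assms(3-5)] .

lemma nat_mapD:
  assumes "nat_map A F G \<eta>" "(C, f) \<in> arrs A" "x \<in> Sec F C f"
  shows nat_map_in: "\<eta> C f x \<in> Sec G C f"
    and nat_map_Res: "(D, g) \<in> arrs C \<Longrightarrow> \<eta> D (cmp D f g) (Res F C f D g x) = Res G C f D g (\<eta> C f x)"
  using assms unfolding nat_map_def by blast+

lemma cmp_amap_restr: "(C, f) \<in> arrs B \<Longrightarrow> is_T B \<Longrightarrow> cmp (subtopology C U) h (amap_restr C f U) = amap_restr C (cmp C h f) U"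
  unfolding amap_restr_def using cmp_assoc[OF arrs_incl] arrs_is_T by metis

lemma Sec_pb: "Sec (pb h F) C f = Sec F C (cmp C h f)"
  and Res_pb: "Res (pb h F) C f = Res F C (cmp C h f)"
  by (simp_all add: pb_def)

lemma presheaf_pb:
  assumes h: "(B, h) \<in> arrs A" and F: "presheaf_over A F"
  shows "presheaf_over B (pb h F)"
  unfolding presheaf_over_def Sec_pb Res_pb
proof (clarify, intro conjI ballI, goal_cases)
  case (1 C f x)
  then show ?case using Res_id[OF F arrs_cmp[OF h]] by blast
next
  case (2 C f x z)
  then obtain D g where z: "z = (D, g)" and g: "(D, g) \<in> arrs C" by (cases z) auto
  have "Res F C (cmp C h f) D g x \<in> Sec F D (cmp D h (cmp D f g))"
    using Res_in[OF F arrs_cmp[OF h 2(1)] 2(2) g] by (simp add: cmp_assoc[OF g])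
  moreover have "Res F D (cmp D h (cmp D f g)) E k (Res F C (cmp C h f) D g x) =
     Res F C (cmp C h f) E (cmp E g k) x" if "(E, k) \<in> arrs D" for E k
    using Res_Res[OF F arrs_cmp[OF h 2(1)] 2(2) g that] by (simp add: cmp_assoc[OF g])
  ultimately show ?case unfolding z by auto
qed

lemma sheaf_pb:
  assumes h: "(B, h) \<in> arrs A" and F: "sheaf_over A F"
  shows "sheaf_over B (pb h F)"
  unfolding sheaf_over_def
proof (intro conjI, goal_cases)
  case 1 show ?case using presheaf_pb[OF h] F unfolding sheaf_over_def by blast
next
  case 2 show ?case
  proof (clarify)
    fix C f \<U> and s :: "pt set \<Rightarrow> 'a"
    assume f: "(C, f) \<in> arrs B" and *: "open_cover C \<U>"
      "\<forall>U\<in>\<U>. s U \<in> Sec (pb h F) (subtopology C U) (amap_restr C f U)"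
      "\<forall>U\<in>\<U>. \<forall>V\<in>\<U>. let W = subtopology C (U \<inter> V) in
           Res (pb h F) (subtopology C U) (amap_restr C f U) W (incl W) (s U) =
           Res (pb h F) (subtopology C V) (amap_restr C f V) W (incl W) (s V)"
    have eq: "cmp (subtopology C U) h (amap_restr C f U) = amap_restr C (cmp C h f) U" for U
      using cmp_amap_restr[OF f] arrs_is_T[OF h] by simp
    show "\<exists>!x. x \<in> Sec (pb h F) C f \<and>
           (\<forall>U\<in>\<U>. Res (pb h F) C f (subtopology C U) (incl (subtopology C U)) x = s U)"
      using sheaf_glue[OF F arrs_cmp[OF h f] *(1), of s] *(2,3) unfolding Sec_pb Res_pb eq .
  qed
qed

lemma nat_map_pb:
  assumes h: "(B, h) \<in> arrs A" and n: "nat_map A F G \<eta>"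
  shows "nat_map B (pb h F) (pb h G) (pbm h \<eta>)"
  unfolding nat_map_def Sec_pb Res_pb pbm_def
proof (clarify, intro conjI ballI, goal_cases)
  case (1 C f x)
  then show ?case using nat_map_in[OF n arrs_cmp[OF h]] by blast
next
  case (2 C f x z)
  then obtain D g where z: "z = (D, g)" and g: "(D, g) \<in> arrs C" by (cases z) auto
  show ?case unfolding z
    using nat_map_Res[OF n arrs_cmp[OF h 2(1)] 2(2) g] by (simp add: cmp_assoc[OF g])
qed

lemma metric_objD:
  assumes "metric_obj A X d"
  shows metric_sheaf: "sheaf_over A X"
    and metric_presheaf: "presheaf_over A X"
    and metric_nat_map: "nat_map A (prod_psh X X) Real_obj d"
    and metric_pointwise: "(C, f) \<in> arrs A \<Longrightarrow>
      \<forall>x\<in>Sec X C f. \<forall>y\<in>Sec X C f. \<forall>z\<in>Sec X C f. \<forall>t\<in>topspace C.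
        0 \<le> d C f (x, y) t \<and> d C f (x, x) t = 0 \<and> d C f (x, y) t = d C f (y, x) t \<and>
        d C f (x, z) t \<le> d C f (x, y) t + d C f (y, z) t"
    and metric_separated: "(C, f) \<in> arrs A \<Longrightarrow> \<forall>x\<in>Sec X C f. \<forall>y\<in>Sec X C f.
      (\<forall>t\<in>topspace C. d C f (x, y) t = 0) \<longrightarrow> x = y"
proof -
  note X = assms[unfolded metric_obj_def pseudometric_obj_def]
  show 1: "sheaf_over A X" by (rule X[THEN conjunct1, THEN conjunct1])
  show "presheaf_over A X" by (rule 1[unfolded sheaf_over_def, THEN conjunct1])
  show "nat_map A (prod_psh X X) Real_obj d"
    by (rule X[THEN conjunct1, THEN conjunct2, THEN conjunct1])
  assume f: "(C, f) \<in> arrs A"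
  show "\<forall>x\<in>Sec X C f. \<forall>y\<in>Sec X C f. \<forall>z\<in>Sec X C f. \<forall>t\<in>topspace C.
        0 \<le> d C f (x, y) t \<and> d C f (x, x) t = 0 \<and> d C f (x, y) t = d C f (y, x) t \<and>
        d C f (x, z) t \<le> d C f (x, y) t + d C f (y, z) t"
    by (rule X[THEN conjunct1, THEN conjunct2, THEN conjunct2, THEN bspec, OF f, unfolded prod.case])
  show "\<forall>x\<in>Sec X C f. \<forall>y\<in>Sec X C f. (\<forall>t\<in>topspace C. d C f (x, y) t = 0) \<longrightarrow> x = y"
    by (rule X[THEN conjunct2, THEN bspec, OF f, unfolded prod.case])
qed

lemma metric_pb:
  assumes h: "(B, h) \<in> arrs A" and X: "metric_obj A X d"
  shows "metric_obj B (pb h X) (pbm h d)"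
  unfolding metric_obj_def pseudometric_obj_def
proof (intro conjI, goal_cases)
  case 1
  show ?case using sheaf_pb[OF h metric_sheaf[OF X]] .
next
  case 2
  have "pb h (prod_psh X X) = prod_psh (pb h X) (pb h X)" "pb h Real_obj = Real_obj"
    by (simp_all add: pb_def prod_psh_def Real_obj_def cont_psh_def)
  then show ?case using nat_map_pb[OF h metric_nat_map[OF X]] by simp
next
  case 3
  show ?case unfolding Sec_pb pbm_def using metric_pointwise[OF X arrs_cmp[OF h]] by (intro ballI) auto
next
  case 4
  show ?case unfolding Sec_pb pbm_def using metric_separated[OF X arrs_cmp[OF h]] by (intro ballI) auto
qed

section \<open>The sheaf of continuous maps with values in prescribed fibres\<close>

text \<open>
  Over \<open>f\<close> the sections are the continuous maps \<open>u\<close> into \<open>T\<close> with \<open>u t \<in> F (f t)\<close>, that is, the lifts of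
  \<open>f\<close> to the space of pairs \<open>(b, c)\<close> with \<open>c \<in> F b\<close>. With \<open>T\<close> Euclidean this gives the completion of a
  metric object, with \<open>T\<close> discrete a coproduct of subspaces of the stage. The values of \<open>u\<close> are points
  of the site, so that \<open>u\<close> fits into the right summand of the universe.
\<close>

definition fiber_psh :: "pt topology \<Rightarrow> (pt \<Rightarrow> pt set) \<Rightarrow> 'a univ psh" where
  "fiber_psh T F =
     \<lparr>Sec = (\<lambda>C f. Inr ` {u \<in> cmaps C T. \<forall>t\<in>topspace C. u t \<in> F (f t)}),
      Res = (\<lambda>C f D g y. Inr (cmp D (projr y) g))\<rparr>"

lemma Sec_fiber: "Inr u \<in> Sec (fiber_psh T F) C f \<longleftrightarrow> u \<in> cmaps C T \<and> (\<forall>t\<in>topspace C. u t \<in> F (f t))"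
  by (auto simp: fiber_psh_def)

lemma Sec_fiberE:
  assumes "y \<in> Sec (fiber_psh T F) C f"
  obtains u where "y = Inr u" "u \<in> cmaps C T" "\<And>t. t \<in> topspace C \<Longrightarrow> u t \<in> F (f t)"
  using assms by (auto simp: fiber_psh_def)

lemma Res_fiber: "Res (fiber_psh T F) C f D g (Inr u) = Inr (cmp D u g)"
  by (simp add: fiber_psh_def)

lemma presheaf_fiber: "presheaf_over A (fiber_psh T F :: 'a univ psh)"
  unfolding presheaf_over_def
proof (clarify, intro conjI ballI, goal_cases)
  case (1 C f x)
  then show ?case by (elim Sec_fiberE) (simp add: Res_fiber cmp_incl cmaps_def)
next
  case (2 C f x z)
  then obtain D g u where z: "z = (D, g)" and g: "(D, g) \<in> arrs C" and x: "x = Inr u"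
    and u: "u \<in> cmaps C T" "\<And>t. t \<in> topspace C \<Longrightarrow> u t \<in> F (f t)"
    by (cases z) (auto elim!: Sec_fiberE)
  show ?case unfolding z x
    using u g by (auto simp: Res_fiber Sec_fiber cmp_cmaps cmp_assoc cmp_apply arrs_in)
qed

lemma sheaf_fiber: "sheaf_over A (fiber_psh T F :: 'a univ psh)"
  unfolding sheaf_over_def
proof (intro conjI presheaf_fiber, clarify)
  fix C f \<U> and s :: "pt set \<Rightarrow> 'a univ"
  assume f: "(C, f) \<in> arrs A" and \<U>: "open_cover C \<U>"
    and s: "\<forall>U\<in>\<U>. s U \<in> Sec (fiber_psh T F) (subtopology C U) (amap_restr C f U)"
    and eq: "\<forall>U\<in>\<U>. \<forall>V\<in>\<U>. let W = subtopology C (U \<inter> V) in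
           Res (fiber_psh T F) (subtopology C U) (amap_restr C f U) W (incl W) (s U) =
           Res (fiber_psh T F) (subtopology C V) (amap_restr C f V) W (incl W) (s V)"
  have sub: "U \<subseteq> topspace C" "openin C U" if "U \<in> \<U>" for U
    using \<U> that by (auto simp: open_cover_def)
  obtain u where u: "\<And>U. U \<in> \<U> \<Longrightarrow> s U = Inr (u U)" "\<And>U. U \<in> \<U> \<Longrightarrow> u U \<in> cmaps (subtopology C U) T"
    "\<And>U t. U \<in> \<U> \<Longrightarrow> t \<in> U \<Longrightarrow> u U t \<in> F (f t)"
  proof
    fix U assume U: "U \<in> \<U>"
    obtain v where v: "s U = Inr v" "v \<in> cmaps (subtopology C U) T"
        "\<And>t. t \<in> topspace (subtopology C U) \<Longrightarrow> v t \<in> F (amap_restr C f U t)"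
      using bspec[OF s U] by (elim Sec_fiberE) blast
    show "s U = Inr (projr (s U))" "projr (s U) \<in> cmaps (subtopology C U) T"
      using v by auto
    fix t assume "t \<in> U"
    then show "projr (s U) t \<in> F (f t)"
      using v(1) v(3)[of t] sub[OF U] by (auto simp: amap_restr_apply subsetD)
  qed
  have agree: "u U t = u V t" if "U \<in> \<U>" "V \<in> \<U>" "t \<in> U" "t \<in> V" for U V t
  proof -
    let ?W = "subtopology C (U \<inter> V)"
    have "cmp ?W (u U) (incl ?W) = cmp ?W (u V) (incl ?W)"
      using eq[THEN bspec, OF that(1), THEN bspec, OF that(2)]
      by (simp add: Let_def u(1) that(1,2) Res_fiber)
    moreover have "t \<in> topspace ?W" using that sub by auto
    ultimately show ?thesis by (metis cmp_apply incl_apply)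
  qed
  have "\<forall>t\<in>topspace C. \<exists>U. U \<in> \<U> \<and> t \<in> U" using \<U> unfolding open_cover_def by blast
  then obtain c where c: "\<And>t. t \<in> topspace C \<Longrightarrow> c t \<in> \<U> \<and> t \<in> c t" by metis
  define \<phi> where "\<phi> = (\<lambda>t\<in>topspace C. u (c t) t)"
  have \<phi>: "\<phi> t = u U t" if "U \<in> \<U>" "t \<in> U" for U t
    using agree[of U "c t" t] c[of t] sub[OF that(1)] that by (auto simp: \<phi>_def)
  have "continuous_map C T \<phi>"
  proof (rule pasting_lemma[of \<U> C "\<lambda>U. U" T u])
    fix t assume "t \<in> topspace C"
    then show "\<exists>j. j \<in> \<U> \<and> t \<in> j \<and> \<phi> t = u j t"
      using c[of t] \<phi> by blast
  next
    fix U V t assume "U \<in> \<U>" "V \<in> \<U>" "t \<in> topspace C \<inter> U \<inter> V"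
    then show "u U t = u V t" by (intro agree) auto
  qed (use u(2) sub(2) in \<open>auto simp: cmaps_def\<close>)
  then have \<phi>c: "\<phi> \<in> cmaps C T" by (simp add: cmaps_def \<phi>_def)
  show "\<exists>!x. x \<in> Sec (fiber_psh T F) C f \<and>
      (\<forall>U\<in>\<U>. Res (fiber_psh T F) C f (subtopology C U) (incl (subtopology C U)) x = s U)"
  proof (rule ex1I[of _ "Inr \<phi>"], intro conjI ballI)
    show "Inr \<phi> \<in> Sec (fiber_psh T F) C f"
      unfolding Sec_fiber
    proof (intro conjI ballI \<phi>c)
      fix t assume "t \<in> topspace C"
      then show "\<phi> t \<in> F (f t)" using c[of t] \<phi>[of "c t" t] u(3)[of "c t" t] by simp
    qed
    fix U assume U: "U \<in> \<U>"
    have "cmp (subtopology C U) \<phi> (incl (subtopology C U)) = u U"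
    proof (rule extensionalityI[OF cmp_ext])
      show "u U \<in> extensional (topspace (subtopology C U))" using u(2)[OF U] by (simp add: cmaps_def)
      fix t assume "t \<in> topspace (subtopology C U)"
      then show "cmp (subtopology C U) \<phi> (incl (subtopology C U)) t = u U t"
        using \<phi>[OF U] by (simp add: cmp_apply incl_apply)
    qed
    then show "Res (fiber_psh T F) C f (subtopology C U) (incl (subtopology C U)) (Inr \<phi>) = s U"
      using u(1)[OF U] by (simp add: Res_fiber)
  next
    fix x assume x: "x \<in> Sec (fiber_psh T F) C f \<and>
      (\<forall>U\<in>\<U>. Res (fiber_psh T F) C f (subtopology C U) (incl (subtopology C U)) x = s U)"
    then obtain v where v: "x = Inr v" "v \<in> cmaps C T" by (elim conjE Sec_fiberE)
    have "v = \<phi>"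
    proof (rule extensionalityI[of _ "topspace C"])
      fix t assume t: "t \<in> topspace C"
      then have tc: "t \<in> topspace (subtopology C (c t))" using c by simp
      have "cmp (subtopology C (c t)) v (incl (subtopology C (c t))) = u (c t)"
        using x[THEN conjunct2, THEN bspec, of "c t"] c[OF t] u(1)[of "c t"] by (simp add: v(1) Res_fiber)
      then have "cmp (subtopology C (c t)) v (incl (subtopology C (c t))) t = \<phi> t"
        using t by (simp add: \<phi>_def)
      then show "v t = \<phi> t" by (simp only: cmp_apply[OF tc] incl_apply[OF tc])
    qed (use v(2) \<phi>c in \<open>auto simp: cmaps_def\<close>)
    then show "x = Inr \<phi>" using v(1) by simp
  qed
qed


section \<open>Completeness at one stage\<close>

text \<open>
  Completeness tested only against pseudometric objects over \<open>A\<close> itself. It constrains \<open>X\<close> at arrows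
  into \<open>A\<close> only, hence can be transferred between the two ways of changing the stage twice, which
  agree at these arrows but not as functions.
\<close>

definition complete_at :: "space \<Rightarrow> 'u psh \<Rightarrow> 'u dist \<Rightarrow> bool" where
  "complete_at A X d \<longleftrightarrow> (\<forall>(Y :: 'u psh) e f.
     pseudometric_obj A Y e \<and> isometry_over A X d Y e f \<and> dense_image A X Y e f \<longrightarrow>
     (\<exists>k. isometry_over A Y e X d k \<and> (\<forall>(C, g)\<in>arrs A. \<forall>x\<in>Sec X C g. k C g (f C g x) = x)))"

lemma complete_at_pb:
  assumes "complete_obj A X d" "(B, h) \<in> arrs A"
  shows "complete_at B (pb h X) (pbm h d)"
  unfolding complete_at_def
proof (intro allI impI)
  fix Y :: "'a psh" and e f
  assume Y: "pseudometric_obj B Y e \<and> isometry_over B (pb h X) (pbm h d) Y e f \<and> dense_image B (pb h X) Y e f"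
  show "\<exists>k. isometry_over B Y e (pb h X) (pbm h d) k \<and>
      (\<forall>(C, g)\<in>arrs B. \<forall>x\<in>Sec (pb h X) C g. k C g (f C g x) = x)"
    using assms(1)[unfolded complete_obj_def, THEN bspec, OF assms(2), unfolded prod.case,
        THEN spec, THEN spec, THEN spec, THEN mp, OF Y, unfolded Let_def]
    by blast
qed

lemma ball_arrs_cong:
  assumes "\<And>C f. (C, f) \<in> arrs A \<Longrightarrow> P C f = Q C f"
  shows "(\<forall>(C, f)\<in>arrs A. P C f) \<longleftrightarrow> (\<forall>(C, f)\<in>arrs A. Q C f)"
  using assms by auto

lemma complete_at_cong:
  assumes S: "\<And>C f. (C, f) \<in> arrs A \<Longrightarrow> Sec X C f = Sec X' C f"
    and R: "\<And>C f. (C, f) \<in> arrs A \<Longrightarrow> Res X C f = Res X' C f"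
    and d: "\<And>C f. (C, f) \<in> arrs A \<Longrightarrow> d C f = d' C f"
    and c: "complete_at A X d"
  shows "complete_at A X' d'"
proof -
  have iso: "isometry_over A X d Y e f = isometry_over A X' d' Y e f" for Y :: "'a psh" and e f
    unfolding isometry_over_def nat_map_def
    by (intro arg_cong2[of _ _ _ _ "(\<and>)"] ball_arrs_cong) (simp_all add: S R d)
  have iso': "isometry_over A Y e X d f = isometry_over A Y e X' d' f" for Y :: "'a psh" and e f
    unfolding isometry_over_def nat_map_def
    by (intro arg_cong2[of _ _ _ _ "(\<and>)"] ball_arrs_cong) (simp_all add: S R d)
  have dense: "dense_image A X Y e f = dense_image A X' Y e f" for Y :: "'a psh" and e f
    unfolding dense_image_def on_cover_def
    by (intro ball_arrs_cong) (simp add: S arrs_cmp arrs_incl arrs_is_T)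
  have retr: "(\<forall>(C, g)\<in>arrs A. \<forall>x\<in>Sec X C g. k C g (f C g x) = x) =
      (\<forall>(C, g)\<in>arrs A. \<forall>x\<in>Sec X' C g. k C g (f C g x) = x)" for k f :: "space \<Rightarrow> (pt \<Rightarrow> pt) \<Rightarrow> 'a \<Rightarrow> 'a"
    by (intro ball_arrs_cong) (simp_all add: S)
  show ?thesis using c unfolding complete_at_def iso iso' dense retr .
qed

lemma complete_at_pb_pb:
  assumes "complete_obj A X d" "(B, h) \<in> arrs A" "(W, j) \<in> arrs B"
  shows "complete_at W (pb j (pb h X)) (pbm j (pbm h d))"
proof (rule complete_at_cong[OF _ _ _ complete_at_pb[OF assms(1) arrs_cmp[OF assms(2,3)]]])
  fix C f assume f: "(C, f) \<in> arrs W"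
  show "Sec (pb (cmp W h j) X) C f = Sec (pb j (pb h X)) C f"
    "Res (pb (cmp W h j) X) C f = Res (pb j (pb h X)) C f"
    "pbm (cmp W h j) d C f = pbm j (pbm h d) C f"
    by (simp_all add: Sec_pb Res_pb pbm_def cmp_assoc[OF f])
qed


section \<open>The distance functions to the points of a dense sequence\<close>

text \<open>
  The form in which distances to a partially defined term are continuous: the term lives on a clopen
  part, and the distance is given a default value elsewhere.
\<close>

lemma clopen_piece_continuous:
  assumes S: "openin C S" "closedin C S"
    and v: "continuous_map (subtopology C S) Y v"
    and u: "\<And>t. t \<in> S \<Longrightarrow> u t = v t" "\<And>t. t \<in> topspace C - S \<Longrightarrow> u t = y" "y \<in> topspace Y"
  shows "continuous_map C Y u"
proof (rule pasting_lemma[of "{True, False}" C "\<lambda>b. if b then S else topspace C - S" Y "\<lambda>b. if b then v else (\<lambda>_. y)"])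
  fix t assume "t \<in> topspace C"
  then show "\<exists>j. j \<in> {True, False} \<and> t \<in> (if j then S else topspace C - S) \<and>
      u t = (if j then v else (\<lambda>_. y)) t"
    using u by (cases "t \<in> S") auto
qed (use S v u(3) in \<open>auto split: if_splits\<close>)

definition const_nat :: "space \<Rightarrow> nat \<Rightarrow> pt \<Rightarrow> nat" where
  "const_nat C n = (\<lambda>t\<in>topspace C. n)"

lemma const_nat_in: "const_nat C n \<in> Sec Nat_obj C f"
  by (simp add: Nat_obj_def cont_psh_def cmaps_def const_nat_def)

lemma cmp_const_nat: "(D, g) \<in> arrs C \<Longrightarrow> cmp D (const_nat C n) g = const_nat D n"
  by (auto simp: fun_eq_iff cmp_def compose_def restrict_def const_nat_def dest: arrs_in)

text \<open>
  At the point \<open>t\<close>, some term of \<open>s\<close> with an index satisfying \<open>P\<close> is defined and closer than \<open>\<epsilon>\<close> to \<open>x\<close>. The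
  term only has to exist after passing to an arrow \<open>g\<close> that hits \<open>t\<close>, for example the inclusion of a
  member of an open cover; in this form the property is stable under change of stage.
\<close>

definition near_term ::
  "'x psh \<Rightarrow> 'x dist \<Rightarrow> (space \<Rightarrow> (pt \<Rightarrow> pt) \<Rightarrow> (pt \<Rightarrow> nat) \<Rightarrow> pt set \<times> 'x) \<Rightarrow>
   space \<Rightarrow> (pt \<Rightarrow> pt) \<Rightarrow> 'x \<Rightarrow> pt \<Rightarrow> real \<Rightarrow> (nat \<Rightarrow> bool) \<Rightarrow> bool" where
  "near_term X d s C f x t \<epsilon> P \<longleftrightarrow> (\<exists>D g t' \<nu> y. (D, g) \<in> arrs C \<and> t' \<in> topspace D \<and> g t' = t \<and>
     \<nu> \<in> Sec Nat_obj D (cmp D f g) \<and> s D (cmp D f g) \<nu> = (topspace D, y) \<and>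
     d D (cmp D f g) (Res X C f D g x, y) t' < \<epsilon> \<and> P (\<nu> t'))"

text \<open>
  The setting in which the object is shown to be representable. Density is required pointwise and for
  constant \<open>\<epsilon>\<close>, which suffices because inequalities between continuous maps are tested at points.
\<close>

locale sep_complete =
  fixes A :: space and X :: "'a univ psh" and d :: "'a univ dist"
    and s :: "space \<Rightarrow> (pt \<Rightarrow> pt) \<Rightarrow> (pt \<Rightarrow> nat) \<Rightarrow> pt set \<times> 'a univ"
  assumes base: "is_T A"
    and metric: "metric_obj A X d"
    and complete: "complete_at A X d"
    and nat_s: "nat_map A Nat_obj (one_plus X) s"
    and dense: "\<And>C f x t \<epsilon>. (C, f) \<in> arrs A \<Longrightarrow> x \<in> Sec X C f \<Longrightarrow> t \<in> topspace C \<Longrightarrow> 0 < \<epsilon> \<Longrightarrow>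
      near_term X d s C f x t \<epsilon> (\<lambda>_. True)"
begin

lemmas presheaf = metric_presheaf[OF metric]

lemma dist_pointwise:
  assumes "(C, f) \<in> arrs A" "x \<in> Sec X C f" "y \<in> Sec X C f" "t \<in> topspace C"
  shows dist_self: "d C f (x, x) t = 0"
    and dist_sym: "d C f (x, y) t = d C f (y, x) t"
    and dist_triangle: "z \<in> Sec X C f \<Longrightarrow> d C f (x, z) t \<le> d C f (x, y) t + d C f (y, z) t"
proof -
  note * = metric_pointwise[OF metric assms(1), THEN bspec, OF assms(2), THEN bspec, OF assms(3)]
  show "d C f (x, x) t = 0" "d C f (x, y) t = d C f (y, x) t"
    using *[THEN bspec, OF assms(3), THEN bspec, OF assms(4)] by simp_all
  show "d C f (x, z) t \<le> d C f (x, y) t + d C f (y, z) t" if "z \<in> Sec X C f"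
    using *[THEN bspec, OF that, THEN bspec, OF assms(4)] by simp
qed

lemma dist_cmaps:
  assumes "(C, f) \<in> arrs A" "x \<in> Sec X C f" "y \<in> Sec X C f"
  shows "d C f (x, y) \<in> cmaps C euclideanreal"
  using nat_map_in[OF metric_nat_map[OF metric] assms(1), of "(x, y)"] assms
  by (simp add: prod_psh_def Real_obj_def cont_psh_def)

lemma dist_Res:
  assumes "(C, f) \<in> arrs A" "x \<in> Sec X C f" "y \<in> Sec X C f" "(D, g) \<in> arrs C" "t \<in> topspace D"
  shows "d D (cmp D f g) (Res X C f D g x, Res X C f D g y) t = d C f (x, y) (g t)"
  using nat_map_Res[OF metric_nat_map[OF metric] assms(1), of "(x, y)" D g] assms
  by (simp add: prod_psh_def Real_obj_def cont_psh_def cmp_apply)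

definition sdom :: "nat \<Rightarrow> pt set" where
  "sdom n = fst (s A (incl A) (const_nat A n))"

text \<open>
  The \<open>n\<close>-th term of the sequence over \<open>f\<close>. It is a section of \<open>X\<close> over \<open>f\<close> only if \<open>f\<close> maps into \<open>sdom n\<close>;
  otherwise it is a section over the preimage of \<open>sdom n\<close>.
\<close>

definition sterm :: "nat \<Rightarrow> space \<Rightarrow> (pt \<Rightarrow> pt) \<Rightarrow> 'a univ" where
  "sterm n C f = snd (s C f (const_nat C n))"

lemma s_Res:
  assumes "(C, f) \<in> arrs A" "\<nu> \<in> Sec Nat_obj C f" "(D, g) \<in> arrs C" "s C f \<nu> = (W, y)"
  shows "s D (cmp D f g) (cmp D \<nu> g) =
    ({t \<in> topspace D. g t \<in> W}, Res X (subtopology C W) (amap_restr C f W)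
       (subtopology D {t \<in> topspace D. g t \<in> W}) (amap_restr D g {t \<in> topspace D. g t \<in> W}) y)"
  using nat_map_Res[OF nat_s assms(1-3)] assms(4)
  by (simp add: Nat_obj_def cont_psh_def one_plus_def Let_def)

lemma s_in:
  assumes "(C, f) \<in> arrs A" "\<nu> \<in> Sec Nat_obj C f" "s C f \<nu> = (W, y)"
  shows "openin C W" "closedin C W" "y \<in> Sec X (subtopology C W) (amap_restr C f W)"
  using nat_map_in[OF nat_s assms(1,2)] assms(3) by (auto simp: one_plus_def)

lemma sdom_clopen: "openin A (sdom n)" "closedin A (sdom n)"
  using s_in[OF arrs_id[OF base] const_nat_in[of A n]] by (simp_all add: sdom_def prod_eq_iff)

lemma fst_s_const_nat:
  assumes "(C, f) \<in> arrs A"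
  shows "fst (s C f (const_nat C n)) = {t \<in> topspace C. f t \<in> sdom n}"
  using s_Res[OF arrs_id[OF base] const_nat_in assms, of n "sdom n" "sterm n A (incl A)"]
  by (simp add: cmp_const_nat[OF assms] incl_cmp[OF assms] sdom_def sterm_def)

text \<open>
  By naturality the domain of the \<open>n\<close>-th term over \<open>f\<close> is the preimage of \<open>sdom n\<close>, here all of \<open>C\<close>.
\<close>

lemma sterm_in:
  assumes f: "(C, f) \<in> arrs A" and n: "f ` topspace C \<subseteq> sdom n"
  shows s_const_nat: "s C f (const_nat C n) = (topspace C, sterm n C f)"
    and "sterm n C f \<in> Sec X C f"
proof -
  show 1: "s C f (const_nat C n) = (topspace C, sterm n C f)"
    using fst_s_const_nat[OF f, of n] n by (auto simp: prod_eq_iff sterm_def)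
  show "sterm n C f \<in> Sec X C f"
    using s_in(3)[OF f const_nat_in 1] by (simp add: amap_restr_topspace[OF f])
qed

lemma vimage_topspace: "(D, g) \<in> arrs C \<Longrightarrow> {t \<in> topspace D. g t \<in> topspace C} = topspace D"
  by (auto dest: arrs_in)

lemma sterm_Res:
  assumes f: "(C, f) \<in> arrs A" and n: "f ` topspace C \<subseteq> sdom n" and g: "(D, g) \<in> arrs C"
  shows "Res X C f D g (sterm n C f) = sterm n D (cmp D f g)"
  using s_Res[OF f const_nat_in g s_const_nat[OF f n]]
  by (simp add: cmp_const_nat[OF g] vimage_topspace[OF g] amap_restr_topspace[OF f] amap_restr_topspace[OF g] sterm_def)

definition sdom_over :: "space \<Rightarrow> (pt \<Rightarrow> pt) \<Rightarrow> nat \<Rightarrow> pt set" where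
  "sdom_over C f n = {t \<in> topspace C. f t \<in> sdom n}"

lemma sdom_over_clopen: "(C, f) \<in> arrs A \<Longrightarrow> openin C (sdom_over C f n)" "(C, f) \<in> arrs A \<Longrightarrow> closedin C (sdom_over C f n)"
  unfolding sdom_over_def
  by (erule openin_continuous_map_preimage[OF arrs_cont sdom_clopen(1)],
      erule closedin_continuous_map_preimage[OF arrs_cont sdom_clopen(2)])

text \<open>
  The distance function of \<open>x\<close> on the terms of the sequence, at each point. The distance to the
  \<open>n\<close>-th term makes sense only over the part of \<open>C\<close> where this term exists; zero is a default value.
\<close>

definition code :: "space \<Rightarrow> (pt \<Rightarrow> pt) \<Rightarrow> 'a univ \<Rightarrow> pt \<Rightarrow> pt" where
  "code C f x = (\<lambda>t\<in>topspace C. \<lambda>n. if f t \<in> sdom n then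
     (let D = subtopology C (sdom_over C f n); k = incl D in
        d D (cmp D f k) (Res X C f D k x, sterm n D (cmp D f k)) t) else 0)"

text \<open>
  Any arrow over whose domain the \<open>n\<close>-th term is defined can be used to compute the \<open>n\<close>-th coordinate,
  because it factors through the part of \<open>C\<close> used in the definition and distances are natural.
\<close>

lemma code_eq:
  assumes f: "(C, f) \<in> arrs A" and x: "x \<in> Sec X C f" and g: "(D, g) \<in> arrs C"
    and n: "cmp D f g ` topspace D \<subseteq> sdom n" and t: "t \<in> topspace D"
  shows "code C f x (g t) n = d D (cmp D f g) (Res X C f D g x, sterm n D (cmp D f g)) t"
proof -
  let ?C = "subtopology C (sdom_over C f n)"
  let ?f = "cmp ?C f (incl ?C)"
  have k: "(?C, incl ?C) \<in> arrs C" using arrs_incl arrs_is_T[OF f] by blast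
  have f': "(?C, ?f) \<in> arrs A" using arrs_cmp[OF f k] .
  have "g ` topspace D \<subseteq> sdom_over C f n"
    using n arrs_in[OF g] by (auto simp: sdom_over_def cmp_apply image_subset_iff)
  then have g': "(D, g) \<in> arrs ?C" using arrs_corestrict[OF g] by blast
  have n': "?f ` topspace ?C \<subseteq> sdom n"
    by (auto simp: cmp_apply incl_apply sdom_over_def)
  have fg: "cmp D ?f g = cmp D f g"
    using incl_cmp[OF g'] by (simp add: cmp_assoc[OF g'])
  have "code C f x (g t) n = d ?C ?f (Res X C f ?C (incl ?C) x, sterm n ?C ?f) (g t)"
    using n t arrs_in[OF g t] by (auto simp: code_def Let_def cmp_apply image_subset_iff)
  also have "\<dots> = d D (cmp D ?f g) (Res X ?C ?f D g (Res X C f ?C (incl ?C) x), Res X ?C ?f D g (sterm n ?C ?f)) t"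
    using dist_Res[OF f' Res_in[OF presheaf f x k] sterm_in(2)[OF f' n'] g' t] by simp
  also have "\<dots> = d D (cmp D f g) (Res X C f D g x, sterm n D (cmp D f g)) t"
    using Res_Res[OF presheaf f x k g'] sterm_Res[OF f' n' g'] fg incl_cmp[OF g'] by simp
  finally show ?thesis .
qed

lemma code_eq_self:
  assumes f: "(C, f) \<in> arrs A" and x: "x \<in> Sec X C f"
    and n: "f ` topspace C \<subseteq> sdom n" and t: "t \<in> topspace C"
  shows "code C f x t n = d C f (x, sterm n C f) t"
  using code_eq[OF f x arrs_id[OF arrs_is_T[OF f]], of n t] n t Res_id[OF presheaf f x]
  by (simp add: cmp_incl[OF arrs_ext[OF f]] incl_apply)

lemma code_undefined: "t \<in> topspace C \<Longrightarrow> f t \<notin> sdom n \<Longrightarrow> code C f x t n = 0"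
  by (simp add: code_def)

text \<open>
  Coding is natural. In each coordinate both sides are computed over the part of \<open>D\<close> where the
  term is defined.
\<close>

lemma code_Res:
  assumes f: "(C, f) \<in> arrs A" and x: "x \<in> Sec X C f" and g: "(D, g) \<in> arrs C"
  shows "code D (cmp D f g) (Res X C f D g x) = cmp D (code C f x) g"
proof (rule extensionalityI[of _ "topspace D"])
  fix t assume t: "t \<in> topspace D"
  show "code D (cmp D f g) (Res X C f D g x) t = cmp D (code C f x) g t"
  proof
    fix n
    note fg = arrs_cmp[OF f g]
    show "code D (cmp D f g) (Res X C f D g x) t n = cmp D (code C f x) g t n"
    proof (cases "f (g t) \<in> sdom n")
      case False
      then show ?thesis
        using code_undefined[of t D "cmp D f g"] code_undefined[of "g t" C f] t arrs_in[OF g t]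
        by (simp add: cmp_apply)
    next
      case True
      let ?D = "subtopology D (sdom_over D (cmp D f g) n)"
      have k: "(?D, incl ?D) \<in> arrs D" using arrs_incl arrs_is_T[OF g] by blast
      have t': "t \<in> topspace ?D" using t True by (simp add: sdom_over_def cmp_apply)
      have eq: "cmp ?D f (cmp ?D g (incl ?D)) = cmp ?D (cmp D f g) (incl ?D)"
        by (simp add: cmp_assoc[OF k])
      have n: "cmp ?D (cmp D f g) (incl ?D) ` topspace ?D \<subseteq> sdom n"
        by (auto simp: cmp_apply incl_apply sdom_over_def)
      have "code D (cmp D f g) (Res X C f D g x) t n =
          d ?D (cmp ?D (cmp D f g) (incl ?D)) (Res X D (cmp D f g) ?D (incl ?D) (Res X C f D g x),
            sterm n ?D (cmp ?D (cmp D f g) (incl ?D))) t"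
        using code_eq[OF fg Res_in[OF presheaf f x g] k n t'] t' by (simp add: incl_apply)
      also have "\<dots> = code C f x (cmp ?D g (incl ?D) t) n"
        using code_eq[OF f x arrs_cmp[OF g k] _ t', of n] n Res_Res[OF presheaf f x g k]
        by (simp add: eq)
      finally show ?thesis using t t' by (simp add: cmp_apply incl_apply)
    qed
  qed
qed (auto simp: code_def cmp_ext)

lemma code_cmaps:
  assumes f: "(C, f) \<in> arrs A" and x: "x \<in> Sec X C f"
  shows "code C f x \<in> cmaps C euclidean"
proof -
  have "continuous_map C euclidean (\<lambda>t. code C f x t n)" for n
  proof -
    let ?C = "subtopology C (sdom_over C f n)"
    have k: "(?C, incl ?C) \<in> arrs C" using arrs_incl arrs_is_T[OF f] by blast
    have n: "cmp ?C f (incl ?C) ` topspace ?C \<subseteq> sdom n"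
      by (auto simp: cmp_apply incl_apply sdom_over_def)
    show ?thesis
    proof (rule clopen_piece_continuous[OF sdom_over_clopen[OF f]])
      show "continuous_map ?C euclideanreal (d ?C (cmp ?C f (incl ?C))
          (Res X C f ?C (incl ?C) x, sterm n ?C (cmp ?C f (incl ?C))))"
        using dist_cmaps[OF arrs_cmp[OF f k] Res_in[OF presheaf f x k] sterm_in(2)[OF arrs_cmp[OF f k] n]]
        by (simp add: cmaps_def)
    next
      fix t assume "t \<in> topspace C - sdom_over C f n"
      then show "code C f x t n = 0" using code_undefined by (auto simp: sdom_over_def)
    qed (auto simp: code_def sdom_over_def Let_def)
  qed
  then have "continuous_map C (product_topology (\<lambda>_. euclidean) UNIV) (code C f x)"
    using continuous_map_componentwise_UNIV by blast
  then show ?thesis by (simp add: cmaps_def euclidean_product_topology code_def)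
qed

end

section \<open>The fibrewise completion\<close>

lemma real_continuousI:
  assumes "\<And>t \<epsilon>. t \<in> topspace C \<Longrightarrow> 0 < \<epsilon> \<Longrightarrow>
    \<exists>U. openin C U \<and> t \<in> U \<and> (\<forall>t'\<in>U. \<bar>u t' - u t\<bar> < (\<epsilon>::real))"
  shows "continuous_map C euclideanreal u"
  unfolding continuous_map_def
proof (intro conjI allI impI)
  fix V :: "real set" assume "openin euclidean V"
  then have V: "open V" by simp
  show "openin C {t \<in> topspace C. u t \<in> V}"
  proof (subst openin_subopen, intro ballI)
    fix t assume t: "t \<in> {t \<in> topspace C. u t \<in> V}"
    then obtain \<epsilon> where \<epsilon>: "\<epsilon> > 0" "\<And>y. dist y (u t) < \<epsilon> \<Longrightarrow> y \<in> V"
      using V[unfolded open_dist, THEN bspec, of "u t"] by auto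
    obtain U where U: "openin C U" "t \<in> U" "\<forall>t'\<in>U. \<bar>u t' - u t\<bar> < \<epsilon>"
      using assms[of t, OF _ \<epsilon>(1)] t by auto
    have "U \<subseteq> {t \<in> topspace C. u t \<in> V}"
      using U(3) \<epsilon>(2) openin_subset[OF U(1)] by (auto simp: dist_real_def)
    then show "\<exists>T. openin C T \<and> t \<in> T \<and> T \<subseteq> {t \<in> topspace C. u t \<in> V}"
      using U(1,2) by (intro exI[of _ U]) simp
  qed
qed auto

lemma coordinate_continuous:
  assumes "u \<in> cmaps C (euclidean :: pt topology)"
  shows "continuous_map C euclideanreal (\<lambda>t. u t n)"
proof -
  have "continuous_map C (product_topology (\<lambda>_. euclideanreal) UNIV) u"
    using assms by (simp add: cmaps_def euclidean_product_topology)
  then show ?thesis by (simp add: continuous_map_componentwise_UNIV)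
qed

lemma open_less:
  assumes "continuous_map C euclideanreal u"
  shows "openin C {t \<in> topspace C. u t < r}"
  using openin_continuous_map_preimage[OF assms, of "{..<r}"] by simp

text \<open>
  The metric on \<open>\<real>\<^sup>\<nat>\<close> weights the coordinates, so uniform closeness is stronger.
\<close>

lemma dist_pt_le:
  fixes c c' :: pt
  assumes "\<And>n. \<bar>c n - c' n\<bar> \<le> r"
  shows "dist c c' \<le> 2 * r"
proof (rule field_le_epsilon)
  fix e :: real assume "e > 0"
  then obtain N where N: "(1/2::real) ^ N < e" using real_arch_pow_inv[of e "1/2"] by auto
  have "dist c c' \<le> 2 * Max {dist (c (from_nat n)) (c' (from_nat n)) |n. n \<le> N} + (1/2)^N"
    by (rule dist_fun_le_dist_first_terms)
  also have "Max {dist (c (from_nat n)) (c' (from_nat n)) |n. n \<le> N} \<le> r"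
    using assms by (subst Max_le_iff) (auto simp: dist_real_def)
  finally show "dist c c' \<le> 2 * r + e" using N by simp
qed

text \<open>
  The distance on each of the fibres \<open>fib b\<close> below, where the supremum is bounded. The formula is the
  same for all \<open>b\<close>.
\<close>

definition sup_dist :: "pt \<Rightarrow> pt \<Rightarrow> real" where
  "sup_dist c c' = (SUP n. \<bar>c n - c' n\<bar>)"

lemma sup_dist_sym: "sup_dist c c' = sup_dist c' c"
  by (simp add: sup_dist_def abs_minus_commute)

lemma sup_dist_refl: "sup_dist c c = 0"
  by (simp add: sup_dist_def)

context sep_complete
begin

text \<open>
  \<open>sdist n b m\<close> is the distance at \<open>b\<close> between the \<open>n\<close>-th and the \<open>m\<close>-th term, and \<open>sdist n b\<close> is the
  point of the fibre over \<open>b\<close> given by the \<open>n\<close>-th term.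
\<close>

definition sdist :: "nat \<Rightarrow> pt \<Rightarrow> pt" where
  "sdist n = code (subtopology A (sdom n)) (incl (subtopology A (sdom n)))
     (sterm n (subtopology A (sdom n)) (incl (subtopology A (sdom n))))"

lemma sterm_sdom:
  shows "(subtopology A (sdom n), incl (subtopology A (sdom n))) \<in> arrs A"
    and "sterm n (subtopology A (sdom n)) (incl (subtopology A (sdom n))) \<in>
      Sec X (subtopology A (sdom n)) (incl (subtopology A (sdom n)))"
    and "incl (subtopology A (sdom n)) ` topspace (subtopology A (sdom n)) \<subseteq> sdom n"
proof -
  show 1: "(subtopology A (sdom n), incl (subtopology A (sdom n))) \<in> arrs A" by (rule arrs_incl[OF base])
  show 2: "incl (subtopology A (sdom n)) ` topspace (subtopology A (sdom n)) \<subseteq> sdom n"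
    by (auto simp: incl_apply)
  show "sterm n (subtopology A (sdom n)) (incl (subtopology A (sdom n))) \<in>
      Sec X (subtopology A (sdom n)) (incl (subtopology A (sdom n)))"
    by (rule sterm_in(2)[OF 1 2])
qed

lemma code_sterm:
  assumes g: "(D, g) \<in> arrs A" and n: "g ` topspace D \<subseteq> sdom n" and t: "t \<in> topspace D"
  shows "code D g (sterm n D g) t = sdist n (g t)"
proof -
  have g': "(D, g) \<in> arrs (subtopology A (sdom n))" using arrs_corestrict[OF g n] .
  show ?thesis
    using code_Res[OF sterm_sdom(1,2) g'] sterm_Res[OF sterm_sdom(1,3) g'] t
    by (simp add: incl_cmp[OF g'] cmp_apply sdist_def)
qed

lemma sdist_eq:
  assumes g: "(D, g) \<in> arrs A" and n: "g ` topspace D \<subseteq> sdom n" and m: "g ` topspace D \<subseteq> sdom m"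
    and t: "t \<in> topspace D"
  shows "sdist n (g t) m = d D g (sterm n D g, sterm m D g) t"
  using code_sterm[OF g n t] code_eq_self[OF g sterm_in(2)[OF g n] m t] by simp

lemma topspace_sdom: "topspace (subtopology A (sdom n)) = sdom n"
  using openin_subset[OF sdom_clopen(1)] by auto

lemma incl_sdom: "b \<in> sdom n \<Longrightarrow> incl (subtopology A (sdom n)) b = b"
  using incl_apply[of b "subtopology A (sdom n)"] unfolding topspace_sdom .

lemma sdist_cmaps: "sdist n \<in> cmaps (subtopology A (sdom n)) euclidean"
  unfolding sdist_def by (rule code_cmaps[OF sterm_sdom(1,2)])

lemma sdist_undefined: "b \<in> sdom n \<Longrightarrow> b \<notin> sdom m \<Longrightarrow> sdist n b m = 0"
  unfolding sdist_def by (rule code_undefined) (use topspace_sdom in \<open>auto simp: incl_apply\<close>)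

text \<open>
  Facts about two terms are derived over a neighbourhood on which both are defined, where they are
  sections of \<open>X\<close> and the triangle inequality applies.
\<close>

lemma common_piece:
  assumes f: "(C, f) \<in> arrs A" and t: "t \<in> topspace C" and "f t \<in> sdom n" "f t \<in> sdom m"
  obtains D g where "(D, g) \<in> arrs C" "t \<in> topspace D" "g t = t"
    "cmp D f g ` topspace D \<subseteq> sdom n" "cmp D f g ` topspace D \<subseteq> sdom m"
proof
  let ?D = "subtopology C (sdom_over C f n \<inter> sdom_over C f m)"
  show "(?D, incl ?D) \<in> arrs C" using arrs_incl[OF arrs_is_T[OF f]] .
  show t': "t \<in> topspace ?D" using assms by (auto simp: sdom_over_def)
  then show "incl ?D t = t" by (rule incl_apply)
  show "cmp ?D f (incl ?D) ` topspace ?D \<subseteq> sdom n" "cmp ?D f (incl ?D) ` topspace ?D \<subseteq> sdom m"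
    by (auto simp: cmp_apply incl_apply sdom_over_def)
qed

lemma code_triangle:
  assumes f: "(C, f) \<in> arrs A" and x: "x \<in> Sec X C f" and t: "t \<in> topspace C"
    and n: "f t \<in> sdom n" and m: "f t \<in> sdom m"
  shows "\<bar>code C f x t m - sdist n (f t) m\<bar> \<le> code C f x t n"
proof -
  obtain D g where g: "(D, g) \<in> arrs C" and t': "t \<in> topspace D" "g t = t"
    and nm: "cmp D f g ` topspace D \<subseteq> sdom n" "cmp D f g ` topspace D \<subseteq> sdom m"
    using common_piece[OF f t n m] by blast
  note fg = arrs_cmp[OF f g]
  note S = Res_in[OF presheaf f x g] sterm_in(2)[OF fg nm(1)] sterm_in(2)[OF fg nm(2)]
  have "code C f x t m = d D (cmp D f g) (Res X C f D g x, sterm m D (cmp D f g)) t"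
    using code_eq[OF f x g nm(2) t'(1)] t'(2) by simp
  moreover have "code C f x t n = d D (cmp D f g) (Res X C f D g x, sterm n D (cmp D f g)) t"
    using code_eq[OF f x g nm(1) t'(1)] t'(2) by simp
  moreover have "sdist n (f t) m = d D (cmp D f g) (sterm n D (cmp D f g), sterm m D (cmp D f g)) t"
    using sdist_eq[OF fg nm t'(1)] t' by (simp add: cmp_apply)
  ultimately show ?thesis
    using dist_triangle[OF fg S(1,2) t'(1) S(3)] dist_triangle[OF fg S(2,1) t'(1) S(3)]
      dist_sym[OF fg S(1,2) t'(1)] by simp
qed

lemma code_dist:
  assumes f: "(C, f) \<in> arrs A" and x: "x \<in> Sec X C f" and y: "y \<in> Sec X C f"
    and t: "t \<in> topspace C" and n: "f t \<in> sdom n"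
  shows "\<bar>d C f (x, y) t - code C f y t n\<bar> \<le> code C f x t n"
proof -
  obtain D g where g: "(D, g) \<in> arrs C" and t': "t \<in> topspace D" "g t = t"
    and nm: "cmp D f g ` topspace D \<subseteq> sdom n"
    by (rule common_piece[OF f t n n])
  note fg = arrs_cmp[OF f g]
  note S = Res_in[OF presheaf f x g] Res_in[OF presheaf f y g] sterm_in(2)[OF fg nm]
  have "code C f x t n = d D (cmp D f g) (Res X C f D g x, sterm n D (cmp D f g)) t"
    using code_eq[OF f x g nm t'(1)] t'(2) by simp
  moreover have "code C f y t n = d D (cmp D f g) (Res X C f D g y, sterm n D (cmp D f g)) t"
    using code_eq[OF f y g nm t'(1)] t'(2) by simp
  moreover have "d C f (x, y) t = d D (cmp D f g) (Res X C f D g x, Res X C f D g y) t"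
    using dist_Res[OF f x y g t'(1)] t' by simp
  ultimately show ?thesis
    using dist_triangle[OF fg S(3,1) t'(1) S(2)] dist_triangle[OF fg S(1,3) t'(1) S(2)]
      dist_sym[OF fg S(2,3) t'(1)] dist_sym[OF fg S(1,3) t'(1)] by simp
qed

lemma constant_piece:
  assumes f: "(C, f) \<in> arrs A" and \<nu>: "\<nu> \<in> Sec Nat_obj C f" and t: "t \<in> topspace C"
  defines "D \<equiv> subtopology C {t' \<in> topspace C. \<nu> t' = \<nu> t}"
  shows "(D, incl D) \<in> arrs C" "t \<in> topspace D" "cmp D \<nu> (incl D) = const_nat D (\<nu> t)"
proof -
  show "(D, incl D) \<in> arrs C" using arrs_incl[OF arrs_is_T[OF f]] unfolding D_def .
  show "t \<in> topspace D" using t by (simp add: D_def)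
  show "cmp D \<nu> (incl D) = const_nat D (\<nu> t)"
    by (rule extensionalityI[OF cmp_ext, of _ D])
       (auto simp: const_nat_def cmp_apply incl_apply, simp add: D_def)
qed

text \<open>
  A section of the numbers object is locally constant; on the part where it takes the value that it
  has at \<open>t\<close>, it is a constant index, for which the domain is known.
\<close>

lemma fst_s:
  assumes f: "(C, f) \<in> arrs A" and \<nu>: "\<nu> \<in> Sec Nat_obj C f"
  shows "fst (s C f \<nu>) = {t \<in> topspace C. f t \<in> sdom (\<nu> t)}"
proof -
  obtain W y where W: "s C f \<nu> = (W, y)" by force
  have "t \<in> W \<longleftrightarrow> f t \<in> sdom (\<nu> t)" if t: "t \<in> topspace C" for t
  proof -
    define D where "D = subtopology C {t' \<in> topspace C. \<nu> t' = \<nu> t}"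
    note D = constant_piece[OF f \<nu> t, folded D_def]
    have "{t' \<in> topspace D. incl D t' \<in> W} = {t' \<in> topspace D. cmp D f (incl D) t' \<in> sdom (\<nu> t)}"
      using s_Res[OF f \<nu> D(1) W] fst_s_const_nat[OF arrs_cmp[OF f D(1)], of "\<nu> t"] D(3) by simp
    then show ?thesis using D(2)
      unfolding set_eq_iff by (elim allE[of _ t]) (simp add: cmp_apply incl_apply)
  qed
  moreover have "W \<subseteq> topspace C" using openin_subset s_in(1)[OF f \<nu> W] by blast
  ultimately show ?thesis using W by auto
qed

lemma s_defined:
  assumes f: "(C, f) \<in> arrs A" and \<nu>: "\<nu> \<in> Sec Nat_obj C f"
    and sdom: "\<And>t. t \<in> topspace C \<Longrightarrow> f t \<in> sdom (\<nu> t)"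
  obtains y where "s C f \<nu> = (topspace C, y)"
proof -
  have "fst (s C f \<nu>) = topspace C" using fst_s[OF f \<nu>] sdom by auto
  then show ?thesis using that[of "snd (s C f \<nu>)"] by (metis prod.collapse)
qed

text \<open>
  Terms with a varying index are computed pointwise from terms with a constant index, by the same
  localization.
\<close>

lemma s_value:
  assumes f: "(C, f) \<in> arrs A" and \<nu>: "\<nu> \<in> Sec Nat_obj C f" and y: "s C f \<nu> = (topspace C, y)"
  shows s_value_in: "y \<in> Sec X C f"
    and s_value_sdom: "t \<in> topspace C \<Longrightarrow> f t \<in> sdom (\<nu> t)"
    and s_value_dist: "t \<in> topspace C \<Longrightarrow> x \<in> Sec X C f \<Longrightarrow> d C f (x, y) t = code C f x t (\<nu> t)"
proof -
  show yX: "y \<in> Sec X C f" using s_in(3)[OF f \<nu> y] by (simp add: amap_restr_topspace[OF f])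
  show sdom: "f t \<in> sdom (\<nu> t)" if "t \<in> topspace C" for t
    using fst_s[OF f \<nu>] y that by auto
  show "d C f (x, y) t = code C f x t (\<nu> t)" if t: "t \<in> topspace C" and x: "x \<in> Sec X C f"
  proof -
    define D where "D = subtopology C {t' \<in> topspace C. \<nu> t' = \<nu> t}"
    note D = constant_piece[OF f \<nu> t, folded D_def]
    have n: "cmp D f (incl D) ` topspace D \<subseteq> sdom (\<nu> t)"
    proof
      fix b assume "b \<in> cmp D f (incl D) ` topspace D"
      then obtain t' where t': "t' \<in> topspace D" "b = f t'" by (auto simp: cmp_apply incl_apply)
      then have "t' \<in> topspace C" "\<nu> t' = \<nu> t" by (auto simp: D_def)
      then show "b \<in> sdom (\<nu> t)" using sdom[of t'] t' by simp
    qed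
    have "sterm (\<nu> t) D (cmp D f (incl D)) = Res X C f D (incl D) y"
      using s_Res[OF f \<nu> D(1) y]
      by (simp add: D(3) sterm_def vimage_topspace[OF D(1)] amap_restr_topspace[OF f] amap_restr_topspace[OF D(1)])
    then show ?thesis
      using code_eq[OF f x D(1) n D(2)] dist_Res[OF f x yX D(1,2)] D(2) by (simp add: incl_apply)
  qed
qed

lemma s_value_code:
  assumes f: "(C, f) \<in> arrs A" and x: "x \<in> Sec X C f" and g: "(D, g) \<in> arrs C" and t: "t \<in> topspace D"
    and \<nu>: "\<nu> \<in> Sec Nat_obj D (cmp D f g)" and y: "s D (cmp D f g) \<nu> = (topspace D, y)"
  shows "f (g t) \<in> sdom (\<nu> t)"
    and "code C f x (g t) (\<nu> t) = d D (cmp D f g) (Res X C f D g x, y) t"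
proof -
  note fg = arrs_cmp[OF f g]
  show "f (g t) \<in> sdom (\<nu> t)" using s_value_sdom[OF fg \<nu> y t] t by (simp add: cmp_apply)
  show "code C f x (g t) (\<nu> t) = d D (cmp D f g) (Res X C f D g x, y) t"
    using s_value_dist[OF fg \<nu> y t Res_in[OF presheaf f x g]] code_Res[OF f x g] t
    by (simp add: cmp_apply)
qed

text \<open>
  Katetov functions on the indices of the terms defined at \<open>b\<close>, with infimum zero: the distance
  functions of the points of the completion of this set of terms. The other coordinates are
  fixed to be zero, the default value in codes.
\<close>

definition fib :: "pt \<Rightarrow> pt set" where
  "fib b = {c. (\<forall>n. b \<notin> sdom n \<longrightarrow> c n = 0) \<and>
     (\<forall>n m. b \<in> sdom n \<longrightarrow> b \<in> sdom m \<longrightarrow> \<bar>c m - sdist n b m\<bar> \<le> c n) \<and>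
     (\<forall>\<epsilon>>0. \<exists>n. b \<in> sdom n \<and> c n < \<epsilon>)}"

lemma fibD:
  assumes "c \<in> fib b"
  shows fib_undefined: "b \<notin> sdom n \<Longrightarrow> c n = 0"
    and fib_triangle: "b \<in> sdom n \<Longrightarrow> b \<in> sdom m \<Longrightarrow> \<bar>c m - sdist n b m\<bar> \<le> c n"
    and fib_dense: "0 < \<epsilon> \<Longrightarrow> \<exists>n. b \<in> sdom n \<and> c n < \<epsilon>"
  using assms by (auto simp: fib_def)

lemma code_fib:
  assumes f: "(C, f) \<in> arrs A" and x: "x \<in> Sec X C f" and t: "t \<in> topspace C"
  shows "code C f x t \<in> fib (f t)"
  unfolding fib_def
proof (intro CollectI conjI allI impI)
  fix n assume "f t \<notin> sdom n"
  then show "code C f x t n = 0" using code_undefined[of t C f n x] t by simp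
next
  fix n m assume "f t \<in> sdom n" "f t \<in> sdom m"
  then show "\<bar>code C f x t m - sdist n (f t) m\<bar> \<le> code C f x t n" by (rule code_triangle[OF f x t])
next
  fix \<epsilon> :: real assume "\<epsilon> > 0"
  then obtain D g t' \<nu> y where g: "(D, g) \<in> arrs C" and t': "t' \<in> topspace D" "g t' = t"
    and \<nu>: "\<nu> \<in> Sec Nat_obj D (cmp D f g)" and y: "s D (cmp D f g) \<nu> = (topspace D, y)"
    and less: "d D (cmp D f g) (Res X C f D g x, y) t' < \<epsilon>"
    using dense[OF f x t] unfolding near_term_def by blast
  then show "\<exists>n. f t \<in> sdom n \<and> code C f x t n < \<epsilon>"
    using s_value_code[OF f x g t'(1) \<nu> y] t'(2) by auto
qed

lemma sdist_fib:
  assumes "b \<in> sdom n"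
  shows "sdist n b \<in> fib b"
  using code_fib[OF sterm_sdom(1,2), of b n] assms unfolding sdist_def[symmetric] topspace_sdom
  by (simp add: incl_sdom)

lemma sdist_self: "b \<in> sdom n \<Longrightarrow> sdist n b n = 0"
  using sdist_eq[OF sterm_sdom(1,3,3), of b n] dist_self[OF sterm_sdom(1,2,2), of b n]
  unfolding topspace_sdom by (simp add: incl_sdom)

lemma fib_diff_le:
  assumes "c \<in> fib b" "c' \<in> fib b" "b \<in> sdom n"
  shows "\<bar>c m - c' m\<bar> \<le> c n + c' n"
proof (cases "b \<in> sdom m")
  case True
  then show ?thesis using fib_triangle[OF assms(1,3), of m] fib_triangle[OF assms(2,3), of m] by simp
next
  case False
  have "0 \<le> c n" "0 \<le> c' n" using fib_triangle[OF _ assms(3,3)] assms(1,2) by fastforce+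
  then show ?thesis using fib_undefined[OF assms(1) False] fib_undefined[OF assms(2) False] by simp
qed

lemma sup_dist_bdd:
  assumes "c \<in> fib b" "c' \<in> fib b"
  shows "bdd_above (range (\<lambda>n. \<bar>c n - c' n\<bar>))"
proof -
  obtain n where "b \<in> sdom n" using fib_dense[OF assms(1), of 1] by auto
  then show ?thesis using fib_diff_le[OF assms] by (intro bdd_aboveI[of _ "c n + c' n"]) auto
qed

lemma sup_dist_ge:
  assumes "c \<in> fib b" "c' \<in> fib b"
  shows "\<bar>c n - c' n\<bar> \<le> sup_dist c c'"
  unfolding sup_dist_def by (rule cSUP_upper[OF _ sup_dist_bdd[OF assms]]) simp

text \<open>
  This inequality carries the analysis of the fibres. When \<open>c n\<close> is small, the point \<open>c\<close> is close to the
  \<open>n\<close>-th term, so the distance from \<open>c\<close> to \<open>c'\<close> is approximately the coordinate \<open>c' n\<close>, which depends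
  continuously on all data.
\<close>

lemma sup_dist_close:
  assumes "c \<in> fib b" "c' \<in> fib b" "b \<in> sdom n"
  shows "\<bar>sup_dist c c' - c' n\<bar> \<le> c n"
proof -
  have "sup_dist c c' \<le> c n + c' n"
    unfolding sup_dist_def using fib_diff_le[OF assms] by (intro cSUP_least) auto
  moreover have "\<bar>c n - c' n\<bar> \<le> sup_dist c c'" using sup_dist_ge assms by blast
  ultimately show ?thesis by simp
qed

lemma sup_dist_triangle:
  assumes "c \<in> fib b" "c' \<in> fib b" "c'' \<in> fib b"
  shows "sup_dist c c'' \<le> sup_dist c c' + sup_dist c' c''"
  unfolding sup_dist_def[of c c'']
proof (rule cSUP_least)
  fix n
  show "\<bar>c n - c'' n\<bar> \<le> sup_dist c c' + sup_dist c' c''"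
    using sup_dist_ge[OF assms(1,2), of n] sup_dist_ge[OF assms(2,3), of n] by simp
qed simp

lemma sup_dist_nonneg: "c \<in> fib b \<Longrightarrow> c' \<in> fib b \<Longrightarrow> 0 \<le> sup_dist c c'"
  using sup_dist_ge[of c b c' undefined] by (meson abs_ge_zero order_trans)

lemma sup_dist_eq_0:
  assumes "c \<in> fib b" "c' \<in> fib b" "sup_dist c c' = 0"
  shows "c = c'"
  using sup_dist_ge[OF assms(1,2)] assms(3) by (auto simp: fun_eq_iff)

lemma sup_dist_code:
  assumes f: "(C, f) \<in> arrs A" and x: "x \<in> Sec X C f" and y: "y \<in> Sec X C f" and t: "t \<in> topspace C"
  shows "sup_dist (code C f x t) (code C f y t) = d C f (x, y) t"
proof -
  have "\<bar>sup_dist (code C f x t) (code C f y t) - d C f (x, y) t\<bar> \<le> 0 + e" if e: "e > 0" for e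
  proof -
    obtain n where n: "f t \<in> sdom n" "code C f x t n < e / 2"
      using fib_dense[OF code_fib[OF f x t], of "e / 2"] e by auto
    then show ?thesis
      using code_dist[OF f x y t n(1)] sup_dist_close[OF code_fib[OF f x t] code_fib[OF f y t] n(1)] by simp
  qed
  then have "\<bar>sup_dist (code C f x t) (code C f y t) - d C f (x, y) t\<bar> \<le> 0" by (rule field_le_epsilon)
  then show ?thesis by simp
qed

text \<open>
  Near \<open>t\<close>, the distance is within \<open>u t' n\<close> of the continuous function \<open>v t' n\<close>, for an index \<open>n\<close> with
  \<open>u t n\<close> small.
\<close>

lemma sup_dist_cmaps:
  assumes f: "(C, f) \<in> arrs A"
    and u: "u \<in> cmaps C euclidean" "\<And>t. t \<in> topspace C \<Longrightarrow> u t \<in> fib (f t)"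
    and v: "v \<in> cmaps C euclidean" "\<And>t. t \<in> topspace C \<Longrightarrow> v t \<in> fib (f t)"
  shows "(\<lambda>t\<in>topspace C. sup_dist (u t) (v t)) \<in> cmaps C euclideanreal"
proof -
  have "continuous_map C euclideanreal (\<lambda>t. sup_dist (u t) (v t))"
  proof (rule real_continuousI)
    fix t and \<epsilon> :: real assume t: "t \<in> topspace C" and "\<epsilon> > 0"
    then obtain n where n: "f t \<in> sdom n" "u t n < \<epsilon> / 4"
      using fib_dense[OF u(2), of t "\<epsilon> / 4"] by auto
    let ?U = "sdom_over C f n \<inter> {t' \<in> topspace C. u t' n < \<epsilon> / 4} \<inter> {t' \<in> topspace C. \<bar>v t' n - v t n\<bar> < \<epsilon> / 4}"
    have "continuous_map C euclideanreal (\<lambda>t'. \<bar>v t' n - v t n\<bar>)"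
      by (intro continuous_map_real_abs continuous_map_diff coordinate_continuous[OF v(1)]) simp
    then have "openin C ?U"
      by (intro openin_Int sdom_over_clopen[OF f] open_less coordinate_continuous[OF u(1)])
    moreover have "t \<in> ?U" using n t \<open>\<epsilon> > 0\<close> by (simp add: sdom_over_def)
    moreover have "\<bar>sup_dist (u t') (v t') - sup_dist (u t) (v t)\<bar> < \<epsilon>" if t': "t' \<in> ?U" for t'
    proof -
      have "\<bar>sup_dist (u t') (v t') - v t' n\<bar> \<le> u t' n"
        using t' by (intro sup_dist_close[OF u(2) v(2)]) (auto simp: sdom_over_def)
      moreover have "\<bar>sup_dist (u t) (v t) - v t n\<bar> \<le> u t n"
        using t n by (intro sup_dist_close[OF u(2) v(2)]) auto
      moreover have "u t' n < \<epsilon> / 4" "\<bar>v t' n - v t n\<bar> < \<epsilon> / 4" using t' by auto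
      ultimately show ?thesis using n(2) by linarith
    qed
    ultimately show "\<exists>U. openin C U \<and> t \<in> U \<and> (\<forall>t'\<in>U. \<bar>sup_dist (u t') (v t') - sup_dist (u t) (v t)\<bar> < \<epsilon>)"
      by blast
  qed
  then have "continuous_map C euclideanreal (\<lambda>t\<in>topspace C. sup_dist (u t) (v t))"
    by (rule continuous_map_eq) simp
  then show ?thesis by (simp add: cmaps_def)
qed

definition completion :: "'a univ psh" where "completion = fiber_psh euclidean fib"

definition completion_dist :: "'a univ dist" where
  "completion_dist C f = (\<lambda>(y, z). \<lambda>t\<in>topspace C. sup_dist (projr y t) (projr z t))"

definition completion_code :: "space \<Rightarrow> (pt \<Rightarrow> pt) \<Rightarrow> 'a univ \<Rightarrow> 'a univ" where
  "completion_code C f x = Inr (code C f x)"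

lemma completion_SecE:
  assumes "y \<in> Sec completion C f"
  obtains u where "y = Inr u" "u \<in> cmaps C euclidean" "\<forall>t\<in>topspace C. u t \<in> fib (f t)"
  using assms by (auto simp: completion_def fiber_psh_def)

lemma Sec_completion: "Inr u \<in> Sec completion C f \<longleftrightarrow> u \<in> cmaps C euclidean \<and> (\<forall>t\<in>topspace C. u t \<in> fib (f t))"
  by (simp add: completion_def Sec_fiber)

lemma Res_completion: "Res completion C f D g (Inr u) = Inr (cmp D u g)"
  by (simp add: completion_def Res_fiber)

lemma completion_pseudometric: "pseudometric_obj A completion completion_dist"
  unfolding pseudometric_obj_def
proof (intro conjI, goal_cases)
  case 1
  show ?case unfolding completion_def by (rule sheaf_fiber)
next
  case 2
  show ?case unfolding nat_map_def
  proof (clarify, intro conjI ballI, goal_cases)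
    case (1 C f y z)
    then have y: "y \<in> Sec completion C f" and z: "z \<in> Sec completion C f" by (auto simp: prod_psh_def)
    obtain u where u: "y = Inr u" "u \<in> cmaps C euclidean" "\<forall>t\<in>topspace C. u t \<in> fib (f t)"
      using y by (rule completion_SecE)
    obtain v where v: "z = Inr v" "v \<in> cmaps C euclidean" "\<forall>t\<in>topspace C. v t \<in> fib (f t)"
      using z by (rule completion_SecE)
    show ?case using sup_dist_cmaps[OF 1(1) u(2) u(3)[THEN bspec] v(2) v(3)[THEN bspec]]
      by (simp add: u(1) v(1) completion_dist_def Real_obj_def cont_psh_def)
  next
    case (2 C f y z w)
    then have y: "y \<in> Sec completion C f" and z: "z \<in> Sec completion C f" by (auto simp: prod_psh_def)
    obtain u where u: "y = Inr u" using y by (rule completion_SecE)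
    obtain v where v: "z = Inr v" using z by (rule completion_SecE)
    obtain D g where w: "w = (D, g)" and g: "(D, g) \<in> arrs C" using 2(3) by (cases w) auto
    show ?case unfolding u v w
      by (auto simp: prod_psh_def Res_completion completion_dist_def Real_obj_def cont_psh_def fun_eq_iff cmp_def compose_def
          restrict_def arrs_in[OF g])
  qed
next
  case 3
  show ?case
  proof (clarify, goal_cases)
    case (1 C f x y z t)
    obtain u where u: "x = Inr u" "u t \<in> fib (f t)" using 1(5) by (auto intro: completion_SecE[OF 1(2)])
    obtain v where v: "y = Inr v" "v t \<in> fib (f t)" using 1(5) by (auto intro: completion_SecE[OF 1(3)])
    obtain w where w: "z = Inr w" "w t \<in> fib (f t)" using 1(5) by (auto intro: completion_SecE[OF 1(4)])
    show ?case using 1(5) sup_dist_nonneg[OF u(2) v(2)] sup_dist_sym[of "u t" "v t"] sup_dist_triangle[OF u(2) v(2) w(2)]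
      by (simp add: completion_dist_def u(1) v(1) w(1) sup_dist_refl)
  qed
qed

lemma completion_isometry: "isometry_over A X d completion completion_dist completion_code"
  unfolding isometry_over_def nat_map_def
proof (intro conjI, clarify, intro conjI ballI, goal_cases)
  case (1 C f x)
  then show ?case using code_cmaps code_fib by (simp add: completion_code_def Sec_completion)
next
  case (2 C f x w)
  then show ?case using code_Res by (cases w) (auto simp: completion_code_def Res_completion)
next
  case 3
  show ?case using sup_dist_code by (auto simp: completion_code_def completion_dist_def)
qed

lemma completion_dense: "dense_image A X completion completion_dist completion_code"
  unfolding dense_image_def
proof (clarify, goal_cases)
  case (1 C f y r)
  note f = 1(1)
  obtain u where u: "y = Inr u" "u \<in> cmaps C euclidean" "\<forall>t\<in>topspace C. u t \<in> fib (f t)"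
    using 1(2) by (rule completion_SecE)
  have r: "continuous_map C euclideanreal r" using 1(3) by (simp add: Real_obj_def cont_psh_def cmaps_def)
  show ?case
  proof (rule on_coverI[OF arrs_is_T[OF f]])
    fix t assume t: "t \<in> topspace C"
    obtain n where n: "f t \<in> sdom n" "u t n < r t"
      using fib_dense[OF u(3)[THEN bspec, OF t], of "r t"] 1(4) t by auto
    define U where "U = sdom_over C f n \<inter> {t' \<in> topspace C. u t' n - r t' < 0}"
    let ?D = "subtopology C U"
    have "openin C U" unfolding U_def
      by (intro openin_Int sdom_over_clopen[OF f] open_less continuous_map_diff coordinate_continuous u r)
    moreover have "t \<in> U" using n t by (simp add: sdom_over_def U_def)
    moreover have "\<exists>x\<in>Sec X ?D (cmp ?D f (incl ?D)). \<forall>t\<in>topspace ?D.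
        completion_dist ?D (cmp ?D f (incl ?D)) (Res completion C f ?D (incl ?D) y,
          completion_code ?D (cmp ?D f (incl ?D)) x) t < r (incl ?D t)"
    proof (intro bexI ballI)
      note fg = arrs_cmp[OF f arrs_incl[OF arrs_is_T[OF f]], of U]
      have n': "cmp ?D f (incl ?D) ` topspace ?D \<subseteq> sdom n"
        by (auto simp: cmp_apply incl_apply sdom_over_def U_def)
      show "sterm n ?D (cmp ?D f (incl ?D)) \<in> Sec X ?D (cmp ?D f (incl ?D))"
        by (rule sterm_in(2)[OF fg n'])
      fix t' assume t': "t' \<in> topspace ?D"
      then have t'': "t' \<in> topspace C" "f t' \<in> sdom n" "u t' n < r t'" by (auto simp: U_def sdom_over_def)
      have "sup_dist (u t') (sdist n (f t')) \<le> u t' n"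
        using sup_dist_close[OF u(3)[THEN bspec, OF t''(1)] sdist_fib[OF t''(2)] t''(2)] sdist_self[OF t''(2)] by simp
      then show "completion_dist ?D (cmp ?D f (incl ?D)) (Res completion C f ?D (incl ?D) y,
          completion_code ?D (cmp ?D f (incl ?D)) (sterm n ?D (cmp ?D f (incl ?D)))) t' < r (incl ?D t')"
        using t' t''(3) code_sterm[OF fg n' t']
        by (simp add: completion_dist_def completion_code_def u(1) Res_completion cmp_apply incl_apply)
    qed
    ultimately show "\<exists>U. openin C U \<and> t \<in> U \<and>
       (\<exists>x\<in>Sec X (subtopology C U) (cmp (subtopology C U) f (incl (subtopology C U))).
         \<forall>t\<in>topspace (subtopology C U). completion_dist (subtopology C U) (cmp (subtopology C U) f (incl (subtopology C U)))
           (Res completion C f (subtopology C U) (incl (subtopology C U)) y,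
            completion_code (subtopology C U) (cmp (subtopology C U) f (incl (subtopology C U))) x) t
           < r (incl (subtopology C U) t))"
      by (intro exI[of _ U] conjI)
  qed
qed

text \<open>
  The retraction \<open>k\<close> given by completeness is an isometry that fixes codes. For \<open>x = k u\<close> the distance
  from the code of \<open>x\<close> to \<open>u\<close> is therefore the distance from \<open>x\<close> to itself.
\<close>

theorem code_surj:
  assumes f: "(C, f) \<in> arrs A" and u: "u \<in> cmaps C euclidean" "\<And>t. t \<in> topspace C \<Longrightarrow> u t \<in> fib (f t)"
  obtains x where "x \<in> Sec X C f" "code C f x = u"
proof -
  obtain k where k: "isometry_over A completion completion_dist X d k"
    and kc: "\<forall>(C, g)\<in>arrs A. \<forall>x\<in>Sec X C g. k C g (completion_code C g x) = x"
    using complete[unfolded complete_at_def, rule_format, OF conjI[OF completion_pseudometric conjI[OF completion_isometry completion_dense]]]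
    by blast
  have uY: "Inr u \<in> Sec completion C f" using u by (simp add: Sec_completion)
  define x where "x = k C f (Inr u)"
  have x: "x \<in> Sec X C f" unfolding x_def
    by (rule nat_map_in[OF k[unfolded isometry_over_def, THEN conjunct1] f uY])
  have cx: "completion_code C f x \<in> Sec completion C f" using code_cmaps[OF f x] code_fib[OF f x] by (simp add: completion_code_def Sec_completion)
  have "code C f x = u"
  proof (rule extensionalityI[of _ "topspace C"])
    fix t assume t: "t \<in> topspace C"
    have "sup_dist (code C f x t) (u t) = completion_dist C f (completion_code C f x, Inr u) t"
      using t by (simp add: completion_dist_def completion_code_def)
    also have "\<dots> = d C f (k C f (completion_code C f x), k C f (Inr u)) t"
      using k[unfolded isometry_over_def, THEN conjunct2, THEN bspec, OF f, unfolded prod.case,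
          THEN bspec, OF cx, THEN bspec, OF uY, THEN bspec, OF t] by simp
    also have "k C f (completion_code C f x) = x" using kc f x by blast
    also have "d C f (x, k C f (Inr u)) t = 0" unfolding x_def[symmetric] by (rule dist_self[OF f x x t])
    finally show "code C f x t = u t" using sup_dist_eq_0[OF code_fib[OF f x t] u(2)[OF t]] by simp
  qed (use u(1) in \<open>auto simp: code_def cmaps_def\<close>)
  then show ?thesis using that x by blast
qed

lemma code_inj:
  assumes f: "(C, f) \<in> arrs A" and x: "x \<in> Sec X C f" and y: "y \<in> Sec X C f"
    and eq: "code C f x = code C f y"
  shows "x = y"
proof -
  have "\<forall>t\<in>topspace C. d C f (x, y) t = 0" using sup_dist_code[OF f x y] eq by (simp add: sup_dist_refl)
  then show ?thesis using metric_separated[OF metric f] x y by blast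
qed

end

section \<open>Open truth values and open subsets\<close>

text \<open>
  For an open truth value this recovers the open set that defines it.
\<close>

definition supp :: "sieve \<Rightarrow> pt set" where
  "supp S = (\<Union>(D, g)\<in>S. g ` topspace D)"

lemma supp_of_open:
  assumes C: "is_T C" and V: "openin C V"
  shows "supp {(D, g) \<in> arrs C. g ` topspace D \<subseteq> V} = V"
proof
  show "supp {(D, g) \<in> arrs C. g ` topspace D \<subseteq> V} \<subseteq> V" by (auto simp: supp_def)
  show "V \<subseteq> supp {(D, g) \<in> arrs C. g ` topspace D \<subseteq> V}"
  proof
    fix t assume t: "t \<in> V"
    let ?D = "subtopology C V"
    have "t \<in> topspace ?D" using t openin_subset[OF V] by auto
    moreover have "(?D, incl ?D) \<in> {(D, g) \<in> arrs C. g ` topspace D \<subseteq> V}"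
      using arrs_incl[OF C] by (auto simp: incl_def)
    ultimately show "t \<in> supp {(D, g) \<in> arrs C. g ` topspace D \<subseteq> V}"
      unfolding supp_def by (intro UN_I[of "(?D, incl ?D)"]) (auto simp: incl_def intro!: image_eqI[of _ _ t])
  qed
qed

lemma Sigma_tv_supp:
  assumes C: "is_T C" and S: "S \<in> Sigma_tv C"
  shows supp_open: "openin C (supp S)"
    and Sigma_tv_eq: "S = {(D, g) \<in> arrs C. g ` topspace D \<subseteq> supp S}"
proof -
  obtain V where V: "openin C V" and SV: "S = {(D, g) \<in> arrs C. g ` topspace D \<subseteq> V}"
    using S unfolding Sigma_tv_def by auto
  have eq: "supp S = V" unfolding SV by (rule supp_of_open[OF C V])
  show "openin C (supp S)" using V eq by simp
  show "S = {(D, g) \<in> arrs C. g ` topspace D \<subseteq> supp S}" unfolding eq by (rule SV)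
qed

lemma supp_full_iff:
  assumes C: "is_T C" and S: "S \<in> Sigma_tv C"
  shows "S = arrs C \<longleftrightarrow> supp S = topspace C"
proof
  have "arrs C = {(D, g) \<in> arrs C. g ` topspace D \<subseteq> topspace C}" by (auto dest: arrs_in)
  then show "S = arrs C \<Longrightarrow> supp S = topspace C" using supp_of_open[OF C openin_topspace] by simp
  show "supp S = topspace C \<Longrightarrow> S = arrs C"
    using Sigma_tv_eq[OF C S] by (auto dest: arrs_in)
qed

lemma open_subset_Sigma:
  "open_subset A F U \<Longrightarrow> (C, f) \<in> arrs A \<Longrightarrow> x \<in> Sec F C f \<Longrightarrow> U C f x \<in> Sigma_tv C"
  unfolding open_subset_def by blast

text \<open>
  Naturality of an open subset in terms of supports: membership of a section in the subset is a condition
  on the points of its stage.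
\<close>

lemma supp_Res:
  assumes U: "open_subset A F U" and f: "(C, f) \<in> arrs A" and x: "x \<in> Sec F C f" and g: "(D, g) \<in> arrs C"
  shows "supp (U D (cmp D f g) (Res F C f D g x)) = {t \<in> topspace D. g t \<in> supp (U C f x)}"
proof -
  note S = open_subset_Sigma[OF U f x]
  have "U D (cmp D f g) (Res F C f D g x) = {(E, k) \<in> arrs D. (E, cmp E g k) \<in> U C f x}"
    using nat_map_Res[OF U[unfolded open_subset_def, THEN conjunct1] f x g] by (simp add: Omega_def)
  also have "\<dots> = {(E, k) \<in> arrs D. (E, cmp E g k) \<in> {(D, g) \<in> arrs C. g ` topspace D \<subseteq> supp (U C f x)}}"
    by (subst Sigma_tv_eq[OF arrs_is_T[OF f] S]) (rule refl)
  also have "\<dots> = {(E, k) \<in> arrs D. k ` topspace E \<subseteq> {t \<in> topspace D. g t \<in> supp (U C f x)}}"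
    using arrs_cmp[OF g] arrs_in by (auto simp: cmp_apply image_subset_iff)
  finally show ?thesis
    using supp_of_open[OF arrs_is_T[OF g]
        openin_continuous_map_preimage[OF arrs_cont[OF g] supp_open[OF arrs_is_T[OF f] S]]] by simp
qed

lemma open_subset_vimage:
  assumes \<eta>: "nat_map A F G \<eta>" and U: "open_subset A G U"
  shows "open_subset A F (\<lambda>C f x. U C f (\<eta> C f x))"
  unfolding open_subset_def
proof (intro conjI)
  show "nat_map A F Omega (\<lambda>C f x. U C f (\<eta> C f x))"
    unfolding nat_map_def
  proof (clarify, intro conjI ballI, goal_cases)
    case (1 C f x)
    show ?case using nat_map_in[OF U[unfolded open_subset_def, THEN conjunct1] 1(1) nat_map_in[OF \<eta> 1]] .
  next
    case (2 C f x w)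
    then obtain D g where w: "w = (D, g)" and g: "(D, g) \<in> arrs C" by (cases w) auto
    show ?case unfolding w prod.case nat_map_Res[OF \<eta> 2(1,2) g]
      by (rule nat_map_Res[OF U[unfolded open_subset_def, THEN conjunct1] 2(1) nat_map_in[OF \<eta> 2(1,2)] g])
  qed
  show "\<forall>(C, f)\<in>arrs A. \<forall>x\<in>Sec F C f. U C f (\<eta> C f x) \<in> Sigma_tv C"
    using open_subset_Sigma[OF U _ nat_map_in[OF \<eta>]] by blast
qed


section \<open>Overt index objects\<close>

definition const_sec :: "space \<Rightarrow> pt \<Rightarrow> 'a univ" where
  "const_sec C j = Inr (\<lambda>t\<in>topspace C. j)"

text \<open>
  Locally constant choices of an index \<open>j\<close> over the open set where \<open>j\<close> is available form a coproduct of
  representable objects of open subspaces. By naturality, \<open>U\<close> holds of the constant choice \<open>j\<close> exactly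
  over an open set \<open>Q j\<close>, and since every choice is locally constant, the existential
  quantifier holds exactly over the union of these sets.
\<close>

lemma tv_ex_fiber_discrete:
  fixes G :: "pt \<Rightarrow> pt set" and U :: "space \<Rightarrow> (pt \<Rightarrow> pt) \<Rightarrow> 'a univ \<Rightarrow> sieve"
  defines "I \<equiv> fiber_psh (discrete_topology UNIV) G"
  assumes G: "\<And>j. openin A {b \<in> topspace A. j \<in> G b}"
    and h: "(B, h) \<in> arrs A" and U: "open_subset B (pb h I) U"
  shows "tv_ex B (pb h I) U \<in> Sigma_tv B"
proof -
  have const_in: "const_sec C j \<in> Sec (pb h I) C f"
    if "(C, f) \<in> arrs B" "\<And>t. t \<in> topspace C \<Longrightarrow> j \<in> G (h (f t))" for C f j
  proof -
    have "continuous_map C (discrete_topology UNIV) (\<lambda>t\<in>topspace C. j)"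
      by (rule continuous_map_eq[of _ _ "\<lambda>_. j"]) auto
    then show ?thesis
      using that by (simp add: const_sec_def Sec_pb I_def Sec_fiber cmaps_def cmp_apply)
  qed
  have const_Res: "Res (pb h I) C f D g (const_sec C j) = const_sec D j" if "(D, g) \<in> arrs C" for C f D g j
    using arrs_in[OF that]
    by (auto simp: const_sec_def Res_pb I_def Res_fiber fun_eq_iff cmp_def compose_def restrict_def)
  define Bj where "Bj j = subtopology B {b \<in> topspace B. j \<in> G (h b)}" for j
  have open_j: "openin B {b \<in> topspace B. j \<in> G (h b)}" for j
  proof -
    have "{b \<in> topspace B. h b \<in> {b \<in> topspace A. j \<in> G b}} = {b \<in> topspace B. j \<in> G (h b)}"
      using arrs_in[OF h] by auto
    then show ?thesis using openin_continuous_map_preimage[OF arrs_cont[OF h] G[of j]] by simp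
  qed
  have Bj: "(Bj j, incl (Bj j)) \<in> arrs B" for j
    unfolding Bj_def by (rule arrs_incl[OF arrs_is_T[OF h]])
  have Bj_in: "j \<in> G (h (incl (Bj j) t))" if "t \<in> topspace (Bj j)" for j t
    using that by (simp add: incl_apply) (simp add: Bj_def)
  define Q where "Q j = supp (U (Bj j) (incl (Bj j)) (const_sec (Bj j) j))" for j
  have Bj_sec: "const_sec (Bj j) j \<in> Sec (pb h I) (Bj j) (incl (Bj j))" for j
    by (rule const_in[OF Bj Bj_in])
  have Q_openin: "openin (Bj j) (Q j)" for j
    unfolding Q_def by (rule supp_open[OF arrs_is_T[OF Bj] open_subset_Sigma[OF U Bj Bj_sec]])
  have Q_open: "openin B (Q j)" for j
    using Q_openin[of j] unfolding Bj_def by (rule openin_trans_full[OF _ open_j])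
  have Q_G: "j \<in> G (h b)" if "b \<in> Q j" for b j
    using openin_subset[OF Q_openin] that by (auto simp: Bj_def)
  have supp_const: "supp (U C f (const_sec C j)) = {t \<in> topspace C. f t \<in> Q j}"
    if f: "(C, f) \<in> arrs B" and j: "\<And>t. t \<in> topspace C \<Longrightarrow> j \<in> G (h (f t))" for C f j
  proof -
    have f': "(C, f) \<in> arrs (Bj j)"
      unfolding Bj_def by (rule arrs_corestrict[OF f]) (use j arrs_in[OF f] in auto)
    show ?thesis
      using supp_Res[OF U Bj Bj_sec f'] unfolding const_Res[OF f'] incl_cmp[OF f'] Q_def .
  qed
  have "tv_ex B (pb h I) U = {(D, g) \<in> arrs B. g ` topspace D \<subseteq> (\<Union>j. Q j)}"
    unfolding tv_ex_def
  proof (rule Collect_cong, clarify, intro conj_cong refl iffI)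
    fix D g assume g: "(D, g) \<in> arrs B"
      and cov: "on_cover D (\<lambda>E k. \<exists>y\<in>Sec (pb h I) E (cmp E g k). U E (cmp E g k) y = arrs E)"
    show "g ` topspace D \<subseteq> (\<Union>j. Q j)"
    proof (rule image_subsetI)
      fix t assume t: "t \<in> topspace D"
      obtain V where V: "openin D V" "t \<in> V"
        and ex: "\<exists>y\<in>Sec (pb h I) (subtopology D V) (cmp (subtopology D V) g (incl (subtopology D V))).
          U (subtopology D V) (cmp (subtopology D V) g (incl (subtopology D V))) y = arrs (subtopology D V)"
        using cov t by (rule on_coverE)
      define E where "E = subtopology D V"
      define f where "f = cmp E g (incl E)"
      obtain y where y: "y \<in> Sec (pb h I) E f" "U E f y = arrs E"
        using ex unfolding E_def f_def by blast
      have f: "(E, f) \<in> arrs B"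
        unfolding E_def f_def by (rule arrs_cmp[OF g arrs_incl[OF arrs_is_T[OF g]]])
      have tE: "t \<in> topspace E" using V t by (simp add: E_def)
      obtain u where u: "y = Inr u" "u \<in> cmaps E (discrete_topology UNIV)"
        "\<forall>t\<in>topspace E. u t \<in> G (cmp E h f t)"
        using y(1) by (auto simp: Sec_pb I_def fiber_psh_def)
      define E' where "E' = subtopology E {t' \<in> topspace E. u t' = u t}"
      have k: "(E', incl E') \<in> arrs E" unfolding E'_def by (rule arrs_incl[OF arrs_is_T[OF f]])
      have tE': "t \<in> topspace E'" using tE by (simp add: E'_def)
      have "Res (pb h I) E f E' (incl E') y = const_sec E' (u t)"
        unfolding u(1) Res_pb I_def Res_fiber const_sec_def
        by (rule arg_cong[of _ _ Inr], rule extensionalityI[OF cmp_ext, of _ E'])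
           (auto simp: cmp_apply incl_apply, simp add: E'_def)
      then have "supp (U E' (cmp E' f (incl E')) (const_sec E' (u t))) =
          {t' \<in> topspace E'. incl E' t' \<in> supp (U E f y)}"
        using supp_Res[OF U f y(1) k] by simp
      moreover have "supp (U E f y) = topspace E"
        using supp_full_iff[OF arrs_is_T[OF f] open_subset_Sigma[OF U f y(1)]] y(2) by simp
      moreover have "supp (U E' (cmp E' f (incl E')) (const_sec E' (u t))) =
          {t' \<in> topspace E'. cmp E' f (incl E') t' \<in> Q (u t)}"
      proof (rule supp_const[OF arrs_cmp[OF f k]])
        fix t' assume t': "t' \<in> topspace E'"
        then have "t' \<in> topspace E" "u t' = u t" by (auto simp: E'_def)
        then show "u t \<in> G (h (cmp E' f (incl E') t'))"
          using u(3)[THEN bspec, of t'] t' by (simp add: cmp_apply incl_apply)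
      qed
      ultimately have "t \<in> {t' \<in> topspace E'. cmp E' f (incl E') t' \<in> Q (u t)}"
        using tE' tE by (auto simp: incl_apply)
      then show "g t \<in> (\<Union>j. Q j)"
        using tE' tE by (auto simp: cmp_apply incl_apply f_def)
    qed
  next
    fix D g assume g: "(D, g) \<in> arrs B" and sub: "g ` topspace D \<subseteq> (\<Union>j. Q j)"
    show "on_cover D (\<lambda>E k. \<exists>y\<in>Sec (pb h I) E (cmp E g k). U E (cmp E g k) y = arrs E)"
    proof (rule on_coverI[OF arrs_is_T[OF g]])
      fix t assume t: "t \<in> topspace D"
      then obtain j where j: "g t \<in> Q j" using sub by auto
      define V where "V = {t' \<in> topspace D. g t' \<in> Q j}"
      define E where "E = subtopology D V"
      have V: "openin D V" unfolding V_def by (rule openin_continuous_map_preimage[OF arrs_cont[OF g] Q_open])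
      have k: "(E, incl E) \<in> arrs D" unfolding E_def by (rule arrs_incl[OF arrs_is_T[OF g]])
      have VE: "topspace E \<subseteq> V" by (simp add: E_def)
      have EQ: "cmp E g (incl E) t' \<in> Q j" if "t' \<in> topspace E" for t'
        using that VE by (auto simp: cmp_apply incl_apply V_def)
      note f = arrs_cmp[OF g k]
      have y: "const_sec E j \<in> Sec (pb h I) E (cmp E g (incl E))"
        by (rule const_in[OF f]) (use EQ Q_G in blast)
      have "supp (U E (cmp E g (incl E)) (const_sec E j)) = topspace E"
        using supp_const[OF f, of j] EQ Q_G by blast
      then have "U E (cmp E g (incl E)) (const_sec E j) = arrs E"
        using supp_full_iff[OF arrs_is_T[OF f] open_subset_Sigma[OF U f y]] by simp
      then show "\<exists>V. openin D V \<and> t \<in> V \<and> (\<exists>y\<in>Sec (pb h I) (subtopology D V) (cmp (subtopology D V) g (incl (subtopology D V))).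
          U (subtopology D V) (cmp (subtopology D V) g (incl (subtopology D V))) y = arrs (subtopology D V))"
        using y V t j unfolding E_def by (intro exI[of _ V] conjI bexI) (auto simp: V_def)
    qed
  qed
  then show ?thesis unfolding Sigma_tv_def using Q_open by blast
qed

lemma overt_map_fiber_discrete:
  fixes G :: "pt \<Rightarrow> pt set" and c :: "space \<Rightarrow> (pt \<Rightarrow> pt) \<Rightarrow> 'a univ \<Rightarrow> 'y"
  assumes G: "\<And>j. openin A {b \<in> topspace A. j \<in> G b}"
    and c: "nat_map A (fiber_psh (discrete_topology UNIV) G) Y c"
  shows "overt_map A (fiber_psh (discrete_topology UNIV) G) Y c"
  unfolding overt_map_def
proof (intro conjI c ballI, clarify)
  fix B h U assume h: "(B, h) \<in> arrs A" and U: "open_subset B (pb h Y) U"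
  show "tv_ex B (pb h (fiber_psh (discrete_topology UNIV) G)) (\<lambda>C g i. U C g (pbm h c C g i)) \<in> Sigma_tv B"
    by (rule tv_ex_fiber_discrete[OF G h open_subset_vimage[OF nat_map_pb[OF h c] U]])
qed

section \<open>Open subsets of the completion\<close>

context sep_complete
begin

lemma sdom_subset: "sdom n \<subseteq> topspace A"
  by (rule openin_subset[OF sdom_clopen(1)])

text \<open>
  Since codes are exactly the continuous maps with values in the fibres, the projection from the
  space \<open>E\<close> of all pairs \<open>(b, c)\<close> with \<open>c \<in> fib b\<close> to its second coordinate is the code of a section \<open>\<xi>\<close>,
  and every section of \<open>X\<close> is a restriction of \<open>\<xi>\<close>. An open subset is therefore determined by its
  value at \<open>\<xi>\<close>, an open subset of \<open>E\<close>. The points of \<open>E\<close> are not of the type of points of the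
  site, so \<open>E\<close> is replaced by a homeomorphic space \<open>Z\<close>.
\<close>

lemma open_subset_code:
  assumes U: "open_subset A X U"
  obtains G where "openin (prod_topology A euclidean) G"
    and "\<And>C f x. (C, f) \<in> arrs A \<Longrightarrow> x \<in> Sec X C f \<Longrightarrow>
      supp (U C f x) = {t \<in> topspace C. (f t, code C f x t) \<in> G}"
proof -
  define E where "E = subtopology (prod_topology A (euclidean :: pt topology)) {(b, c). c \<in> fib b}"
  have tE: "topspace E = {(b, c). b \<in> topspace A \<and> c \<in> fib b}" by (auto simp: E_def)
  have "metrizable_space E" unfolding E_def
    by (rule metrizable_space_subtopology)
       (use base in \<open>simp add: metrizable_space_prod_topology metrizable_space_euclidean is_T_def\<close>)
  moreover have "separable_space E" unfolding E_def
    by (intro second_countable_imp_separable_space second_countable_subtopology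
        second_countable_prod_topology second_countable_euclidean) (use base in \<open>simp add: is_T_iff\<close>)
  ultimately obtain Z where Z: "is_T Z" and "E homeomorphic_space Z"
    using is_T_representative by blast
  then obtain e i where ei: "homeomorphic_maps E Z e i" unfolding homeomorphic_space_def by blast
  have e: "continuous_map E Z e" and i: "continuous_map Z E i"
    using ei unfolding homeomorphic_maps_def by auto
  have ie: "i (e z) = z" if "z \<in> topspace E" for z
    using ei that unfolding homeomorphic_maps_def by auto
  have i_cont: "continuous_map Z (prod_topology A euclidean) i"
    using i unfolding E_def continuous_map_in_subtopology by blast
  have i_in: "i t \<in> topspace E" if "t \<in> topspace Z" for t
    using continuous_map_image_subset_topspace[OF i] that by blast
  define p where "p = (\<lambda>t\<in>topspace Z. fst (i t))"
  define u where "u = (\<lambda>t\<in>topspace Z. snd (i t))"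
  have p: "(Z, p) \<in> arrs A"
    unfolding arrs_iff using Z continuous_map_compose[OF i_cont continuous_map_fst]
    by (auto simp: p_def intro: continuous_map_eq)
  have u: "u \<in> cmaps Z euclidean"
    using continuous_map_compose[OF i_cont continuous_map_snd]
    by (auto simp: cmaps_def u_def intro: continuous_map_eq)
  have u_fib: "u t \<in> fib (p t)" if "t \<in> topspace Z" for t
    using i_in[OF that] that by (auto simp: p_def u_def tE)
  obtain \<xi> where \<xi>: "\<xi> \<in> Sec X Z p" "code Z p \<xi> = u" using code_surj[OF p u u_fib] by blast
  define Q where "Q = supp (U Z p \<xi>)"
  have "openin Z Q" unfolding Q_def by (rule supp_open[OF Z open_subset_Sigma[OF U p \<xi>(1)]])
  then have "openin E {z \<in> topspace E. e z \<in> Q}" by (rule openin_continuous_map_preimage[OF e])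
  then obtain G where G: "openin (prod_topology A euclidean) G"
    and GE: "{z \<in> topspace E. e z \<in> Q} = G \<inter> {(b, c). c \<in> fib b}"
    unfolding E_def openin_subtopology by blast
  show ?thesis
  proof (rule that[OF G])
    fix C f x assume f: "(C, f) \<in> arrs A" and x: "x \<in> Sec X C f"
    define w where "w t = (f t, code C f x t)" for t
    have w_in: "w t \<in> topspace E" if "t \<in> topspace C" for t
      using arrs_in[OF f that] code_fib[OF f x that] by (simp add: w_def tE)
    have w: "continuous_map C E w"
      unfolding E_def continuous_map_in_subtopology
    proof
      show "continuous_map C (prod_topology A euclidean) w"
        unfolding w_def using arrs_cont[OF f] code_cmaps[OF f x]
        by (intro continuous_map_pairedI) (auto simp: cmaps_def)
      show "w \<in> topspace C \<rightarrow> {(b, c). c \<in> fib b}"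
        using w_in by (auto simp: tE w_def)
    qed
    \<comment> \<open>The arrow classifying \<open>x\<close>: restricting \<open>\<xi>\<close> along it gives back \<open>x\<close>.\<close>
    define g where "g = (\<lambda>t\<in>topspace C. e (w t))"
    have g: "(C, g) \<in> arrs Z"
      unfolding arrs_iff using arrs_is_T[OF f] continuous_map_compose[OF w e]
      by (auto simp: g_def intro: continuous_map_eq)
    have ig: "i (g t) = w t" if "t \<in> topspace C" for t using ie[OF w_in[OF that]] that by (simp add: g_def)
    have pg: "cmp C p g = f"
      by (rule extensionalityI[OF cmp_ext arrs_ext[OF f]])
         (simp add: cmp_apply p_def arrs_in[OF g] ig w_def)
    have ug: "cmp C u g = code C f x"
    proof (rule extensionalityI[OF cmp_ext])
      show "code C f x \<in> extensional (topspace C)" by (simp add: code_def)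
    qed (simp add: cmp_apply u_def arrs_in[OF g] ig w_def)
    have "Res X Z p C g \<xi> = x"
      using code_inj[OF f _ x, of "Res X Z p C g \<xi>"] Res_in[OF presheaf p \<xi>(1) g]
        code_Res[OF p \<xi>(1) g] by (simp add: pg \<xi>(2) ug)
    then have "supp (U C f x) = {t \<in> topspace C. g t \<in> Q}"
      using supp_Res[OF U p \<xi>(1) g] by (simp add: pg Q_def)
    moreover have "g t \<in> Q \<longleftrightarrow> w t \<in> G" if "t \<in> topspace C" for t
    proof -
      have "g t \<in> Q \<longleftrightarrow> w t \<in> {z \<in> topspace E. e z \<in> Q}" using that w_in[OF that] by (simp add: g_def)
      also have "\<dots> \<longleftrightarrow> w t \<in> G" unfolding GE using w_in[OF that] by (auto simp: tE)
      finally show ?thesis .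
    qed
    ultimately show "supp (U C f x) = {t \<in> topspace C. (f t, code C f x t) \<in> G}"
      by (auto simp: w_def)
  qed
qed

definition ball_in :: "(pt \<times> pt) set \<Rightarrow> nat \<Rightarrow> real \<Rightarrow> pt set \<Rightarrow> bool" where
  "ball_in G n r V \<longleftrightarrow> openin A V \<and> V \<subseteq> sdom n \<and> (\<forall>b\<in>V. \<forall>c\<in>fib b. c n < r \<longrightarrow> (b, c) \<in> G)"

text \<open>
  The \<open>n\<close>-th term is continuous as a map from \<open>sdom n\<close> to \<open>\<real>\<^sup>\<nat>\<close>. So if \<open>c0 n\<close> is small, then for \<open>b\<close> near
  \<open>b0\<close> every \<open>c\<close> with \<open>c n\<close> small is close first to the \<open>n\<close>-th term at \<open>b\<close>, then to the same term at
  \<open>b0\<close>, and then to \<open>c0\<close>.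
\<close>

lemma ex_ball_in:
  assumes G: "openin (prod_topology A euclidean) G" and bc: "(b0, c0) \<in> G" "c0 \<in> fib b0"
  obtains n r V where "ball_in G n r V" "b0 \<in> V" "c0 n < r"
proof -
  obtain V0 C0 where V0: "openin A V0" "b0 \<in> V0" and C0: "open C0" "c0 \<in> C0" and sub: "V0 \<times> C0 \<subseteq> G"
    using G[unfolded openin_prod_topology_alt, rule_format, OF bc(1)] by auto
  obtain \<epsilon> where \<epsilon>: "\<epsilon> > 0" "ball c0 \<epsilon> \<subseteq> C0" using C0 open_contains_ball by blast
  obtain n where n: "b0 \<in> sdom n" "c0 n < \<epsilon> / 4" using fib_dense[OF bc(2), of "\<epsilon> / 4"] \<epsilon>(1) by auto
  have near: "dist c (sdist n b) \<le> 2 * c n" if "b \<in> sdom n" "c \<in> fib b" for b c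
  proof (rule dist_pt_le)
    fix m show "\<bar>c m - sdist n b m\<bar> \<le> c n"
    proof (cases "b \<in> sdom m")
      case True then show ?thesis using fib_triangle[OF that(2,1)] by blast
    next
      case False
      then show ?thesis
        using fib_undefined[OF that(2) False] sdist_undefined[OF that(1) False] fib_triangle[OF that(2,1,1)] by simp
    qed
  qed
  define V where "V = V0 \<inter> {b \<in> topspace (subtopology A (sdom n)). sdist n b \<in> ball c0 (\<epsilon> / 2)}"
  have "openin (subtopology A (sdom n)) {b \<in> topspace (subtopology A (sdom n)). sdist n b \<in> ball c0 (\<epsilon> / 2)}"
    using sdist_cmaps[of n] by (intro openin_continuous_map_preimage) (auto simp: cmaps_def)
  then have "openin A V" unfolding V_def
    using openin_trans_full[OF _ sdom_clopen(1)] V0(1) by (intro openin_Int) auto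
  moreover have "(b, c) \<in> G" if "b \<in> V" "c \<in> fib b" "c n < \<epsilon> / 4" for b c
  proof -
    have "dist c c0 \<le> dist c (sdist n b) + dist c0 (sdist n b)" by (rule dist_triangle2)
    also have "\<dots> < \<epsilon>" using near[of b c] that by (auto simp: V_def)
    finally have "c \<in> C0" using \<epsilon>(2) by (auto simp: dist_commute)
    then show ?thesis using sub that(1) by (auto simp: V_def)
  qed
  moreover have "b0 \<in> V"
    using V0(2) n near[OF n(1) bc(2)] sdom_subset by (auto simp: V_def)
  ultimately have "ball_in G n (\<epsilon> / 4) V" by (auto simp: ball_in_def V_def)
  then show ?thesis using that \<open>b0 \<in> V\<close> n(2) by blast
qed


section \<open>Open subsets are overt unions of balls\<close>

text \<open>
  Indices of balls have to be points of the site in order to index a sheaf of locally constant maps;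
  the first two coordinates of a point encode the number of the term and the radius.
\<close>

definition centre_no :: "pt \<Rightarrow> nat" where "centre_no j = nat \<lfloor>j 0\<rfloor>"
definition radius :: "pt \<Rightarrow> real" where "radius j = j 1"

lemma ex_centre_radius: "\<exists>j. centre_no j = n \<and> radius j = r"
  by (rule exI[of _ "\<lambda>k. if k = 0 then real n else r"]) (simp add: centre_no_def radius_def)

definition balls_in :: "(pt \<times> pt) set \<Rightarrow> pt \<Rightarrow> pt set" where
  "balls_in G b = {j. \<exists>V. ball_in G (centre_no j) (radius j) V \<and> b \<in> V}"

definition ball_of :: "space \<Rightarrow> (pt \<Rightarrow> pt) \<Rightarrow> 'a univ \<Rightarrow> 'a univ \<times> (pt \<Rightarrow> real)" where
  "ball_of C f y = (snd (s C f (\<lambda>t\<in>topspace C. centre_no (projr y t))), \<lambda>t\<in>topspace C. radius (projr y t))"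

lemma discrete_compose:
  assumes "u \<in> cmaps C (discrete_topology UNIV)" "v ` UNIV \<subseteq> topspace Y"
  shows "(\<lambda>t\<in>topspace C. v (u t)) \<in> cmaps C Y"
proof -
  have "continuous_map C Y (v \<circ> u)"
    by (rule continuous_map_compose[of _ "discrete_topology UNIV"]) (use assms in \<open>auto simp: cmaps_def\<close>)
  then have "continuous_map C Y (\<lambda>t\<in>topspace C. v (u t))" by (rule continuous_map_eq) simp
  then show ?thesis by (simp add: cmaps_def)
qed

text \<open>
  A locally constant choice of balls in \<open>G\<close> selects only terms that are defined, so its centres
  are a section of \<open>X\<close>.
\<close>

lemma ball_of_section:
  assumes f: "(C, f) \<in> arrs A" and u: "u \<in> cmaps C (discrete_topology UNIV)"
    and G: "\<forall>t\<in>topspace C. u t \<in> balls_in G (f t)"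
  defines "\<nu> \<equiv> (\<lambda>t\<in>topspace C. centre_no (u t))"
  obtains y where "\<nu> \<in> Sec Nat_obj C f" "s C f \<nu> = (topspace C, y)"
    "ball_of C f (Inr u) = (y, \<lambda>t\<in>topspace C. radius (u t))"
proof -
  have \<nu>: "\<nu> \<in> Sec Nat_obj C f"
    unfolding \<nu>_def Nat_obj_def cont_psh_def using discrete_compose[OF u, of centre_no "discrete_topology UNIV"] by simp
  have sdom: "f t \<in> sdom (\<nu> t)" if "t \<in> topspace C" for t
    using G that by (auto simp: balls_in_def ball_in_def \<nu>_def)
  obtain y where y: "s C f \<nu> = (topspace C, y)" using s_defined[OF f \<nu> sdom] .
  show ?thesis by (rule that[OF \<nu> y]) (simp add: ball_of_def \<nu>_def[symmetric] y)
qed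

lemma ball_of_nat_map:
  "nat_map A (fiber_psh (discrete_topology UNIV) (balls_in G)) (prod_psh X Real_obj) ball_of"
  unfolding nat_map_def
proof (clarify, goal_cases)
  case (1 C f j)
  obtain u where u: "j = Inr u" "u \<in> cmaps C (discrete_topology UNIV)" "\<forall>t\<in>topspace C. u t \<in> balls_in G (f t)"
    using 1(2) by (auto simp: fiber_psh_def)
  define \<nu> where "\<nu> = (\<lambda>t\<in>topspace C. centre_no (u t))"
  obtain y where \<nu>: "\<nu> \<in> Sec Nat_obj C f" and y: "s C f \<nu> = (topspace C, y)"
    and b: "ball_of C f (Inr u) = (y, \<lambda>t\<in>topspace C. radius (u t))"
    using ball_of_section[OF 1(1) u(2,3)] unfolding \<nu>_def by blast
  have "ball_of C f j \<in> Sec (prod_psh X Real_obj) C f"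
    using s_value_in[OF 1(1) \<nu> y] discrete_compose[OF u(2), of radius euclideanreal]
    by (simp add: u(1) b prod_psh_def Real_obj_def cont_psh_def)
  moreover have "ball_of D (cmp D f g) (Res (fiber_psh (discrete_topology UNIV) (balls_in G)) C f D g j) =
      Res (prod_psh X Real_obj) C f D g (ball_of C f j)" if g: "(D, g) \<in> arrs C" for D g
  proof -
    have "(\<lambda>t\<in>topspace D. centre_no (cmp D u g t)) = cmp D \<nu> g"
      by (auto simp: \<nu>_def fun_eq_iff cmp_def compose_def restrict_def arrs_in[OF g])
    moreover have "(\<lambda>t\<in>topspace D. radius (cmp D u g t)) = cmp D (\<lambda>t\<in>topspace C. radius (u t)) g"
      by (auto simp: fun_eq_iff cmp_def compose_def restrict_def arrs_in[OF g])
    ultimately show ?thesis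
      using s_Res[OF 1(1) \<nu> g y]
      by (simp add: u(1) b Res_fiber prod_psh_def Real_obj_def cont_psh_def ball_of_def[of D]
          vimage_topspace[OF g] amap_restr_topspace[OF g] amap_restr_topspace[OF 1(1)])
  qed
  ultimately show ?case by auto
qed

lemma tv_less_full: "tv_less C u v = arrs C \<longleftrightarrow> (\<forall>t\<in>topspace C. u t < v t)" if "is_T C"
proof
  assume "tv_less C u v = arrs C"
  then have "(C, incl C) \<in> tv_less C u v" using arrs_id[OF that] by simp
  then show "\<forall>t\<in>topspace C. u t < v t" by (simp add: tv_less_def incl_apply)
qed (auto simp: tv_less_def dest: arrs_in)

text \<open>
  The index object consists of all balls that lie in \<open>G\<close> over a neighbourhood. They lie in \<open>U\<close> by
  construction and cover \<open>U\<close> by \<open>ex_ball_in\<close>.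
\<close>

theorem overt_union:
  assumes U: "open_subset A X U"
  shows "overt_union_of_balls A X d U"
proof -
  obtain G where G: "openin (prod_topology A euclidean) G"
    and supp: "\<And>C f x. (C, f) \<in> arrs A \<Longrightarrow> x \<in> Sec X C f \<Longrightarrow>
      supp (U C f x) = {t \<in> topspace C. (f t, code C f x t) \<in> G}"
    using open_subset_code[OF U] by blast
  define I :: "'a univ psh" where "I = fiber_psh (discrete_topology UNIV) (balls_in G)"
  have "openin A {b \<in> topspace A. j \<in> balls_in G b}" for j
  proof -
    have "{b \<in> topspace A. j \<in> balls_in G b} = \<Union>{V. ball_in G (centre_no j) (radius j) V}"
      by (auto simp: balls_in_def ball_in_def dest: openin_subset)
    then show ?thesis by (auto simp: ball_in_def)
  qed
  then have overt: "overt_map A I (prod_psh X Real_obj) ball_of"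
    unfolding I_def by (rule overt_map_fiber_discrete) (rule ball_of_nat_map)
  have "U C f z = tv_ex C (pb f I)
      (\<lambda>D g i. in_ball d D (cmp D f g) (ball_of D (cmp D f g) i) (Res X C f D g z))"
    if f: "(C, f) \<in> arrs A" and z: "z \<in> Sec X C f" for C f z
  proof -
    have U_eq: "U C f z = {(D, g) \<in> arrs C. \<forall>t\<in>topspace D. (f (g t), code C f z (g t)) \<in> G}"
    proof -
      have "U C f z = {(D, g) \<in> arrs C. g ` topspace D \<subseteq> supp (U C f z)}"
        by (rule Sigma_tv_eq[OF arrs_is_T[OF f] open_subset_Sigma[OF U f z]])
      then show ?thesis unfolding supp[OF f z] using arrs_in by fastforce
    qed
    have inb: "in_ball d E fE (ball_of E fE (Inr u)) (Res X C f E k z) = arrs E \<longleftrightarrow>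
       (\<forall>t\<in>topspace E. code C f z (k t) (centre_no (u t)) < radius (u t))"
      if k: "(E, k) \<in> arrs C" and fE: "fE = cmp E f k" and u: "u \<in> cmaps E (discrete_topology UNIV)"
        "\<forall>t\<in>topspace E. u t \<in> balls_in G (fE t)" for E k fE u
    proof -
      have f': "(E, fE) \<in> arrs A" unfolding fE by (rule arrs_cmp[OF f k])
      define \<nu> where "\<nu> = (\<lambda>t\<in>topspace E. centre_no (u t))"
      obtain y where \<nu>: "\<nu> \<in> Sec Nat_obj E fE" and y: "s E fE \<nu> = (topspace E, y)"
        and b: "ball_of E fE (Inr u) = (y, \<lambda>t\<in>topspace E. radius (u t))"
        using ball_of_section[OF f' u] unfolding \<nu>_def by blast
      have zE: "Res X C f E k z \<in> Sec X E fE" unfolding fE by (rule Res_in[OF presheaf f z k])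
      have "d E fE (y, Res X C f E k z) t = code C f z (k t) (centre_no (u t))" if t: "t \<in> topspace E" for t
        using dist_sym[OF f' s_value_in[OF f' \<nu> y] zE t] s_value_dist[OF f' \<nu> y t zE]
          code_Res[OF f z k, folded fE] t by (simp add: cmp_apply \<nu>_def)
      then show ?thesis by (simp add: in_ball_def b tv_less_full[OF arrs_is_T[OF k]])
    qed
    show ?thesis unfolding U_eq tv_ex_def
    proof (rule Collect_cong, clarify, intro conj_cong refl iffI)
      fix D g assume g: "(D, g) \<in> arrs C" and in_G: "\<forall>t\<in>topspace D. (f (g t), code C f z (g t)) \<in> G"
      show "on_cover D (\<lambda>E k. \<exists>y\<in>Sec (pb f I) E (cmp E g k).
        in_ball d E (cmp E f (cmp E g k)) (ball_of E (cmp E f (cmp E g k)) y) (Res X C f E (cmp E g k) z) = arrs E)"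
      proof (rule on_coverI[OF arrs_is_T[OF g]])
        fix t assume t: "t \<in> topspace D"
        note gt = arrs_in[OF g t]
        obtain n r V where V: "ball_in G n r V" "f (g t) \<in> V" "code C f z (g t) n < r"
          using ex_ball_in[OF G in_G[THEN bspec, OF t] code_fib[OF f z gt]] by blast
        obtain j where j: "centre_no j = n" "radius j = r" using ex_centre_radius by blast
        define W where "W = {t' \<in> topspace D. cmp D f g t' \<in> V} \<inter> {t' \<in> topspace D. cmp D (code C f z) g t' n < r}"
        define E where "E = subtopology D W"
        have W: "openin D W" unfolding W_def
        proof (intro openin_Int open_less coordinate_continuous cmp_cmaps[OF code_cmaps[OF f z] g])
          show "openin D {t' \<in> topspace D. cmp D f g t' \<in> V}"
            using V(1) by (intro openin_continuous_map_preimage[OF arrs_cont[OF arrs_cmp[OF f g]]]) (simp add: ball_in_def)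
        qed
        have tW: "t \<in> W" using t V by (simp add: W_def cmp_apply)
        have k: "(E, incl E) \<in> arrs D" unfolding E_def by (rule arrs_incl[OF arrs_is_T[OF g]])
        note gk = arrs_cmp[OF g k]
        have tE: "f (g t') \<in> V" "code C f z (g t') n < r" if "t' \<in> topspace E" for t'
          using that by (auto simp: E_def W_def cmp_apply)
        define u where "u = (\<lambda>t\<in>topspace E. j)"
        have u: "u \<in> cmaps E (discrete_topology UNIV)"
          using continuous_map_eq[of E _ "\<lambda>_. j" u] by (simp add: cmaps_def u_def)
        have uG: "\<forall>t'\<in>topspace E. u t' \<in> balls_in G (cmp E f (cmp E g (incl E)) t')"
          using tE(1) V(1) j by (auto simp: u_def balls_in_def cmp_apply incl_apply)
        have "Inr u \<in> Sec (pb f I) E (cmp E g (incl E))"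
          using u uG by (simp add: Sec_pb I_def Sec_fiber)
        moreover have "in_ball d E (cmp E f (cmp E g (incl E))) (ball_of E (cmp E f (cmp E g (incl E))) (Inr u))
            (Res X C f E (cmp E g (incl E)) z) = arrs E"
          unfolding inb[OF gk refl u uG] using tE(2) j by (simp add: u_def cmp_apply incl_apply)
        ultimately show "\<exists>W. openin D W \<and> t \<in> W \<and> (\<exists>y\<in>Sec (pb f I) (subtopology D W) (cmp (subtopology D W) g (incl (subtopology D W))).
           in_ball d (subtopology D W) (cmp (subtopology D W) f (cmp (subtopology D W) g (incl (subtopology D W))))
            (ball_of (subtopology D W) (cmp (subtopology D W) f (cmp (subtopology D W) g (incl (subtopology D W)))) y)
            (Res X C f (subtopology D W) (cmp (subtopology D W) g (incl (subtopology D W))) z) = arrs (subtopology D W))"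
          using W tW unfolding E_def by blast
      qed
    next
      fix D g assume g: "(D, g) \<in> arrs C" and cov: "on_cover D (\<lambda>E k. \<exists>y\<in>Sec (pb f I) E (cmp E g k).
        in_ball d E (cmp E f (cmp E g k)) (ball_of E (cmp E f (cmp E g k)) y) (Res X C f E (cmp E g k) z) = arrs E)"
      show "\<forall>t\<in>topspace D. (f (g t), code C f z (g t)) \<in> G"
      proof
        fix t assume t: "t \<in> topspace D"
        define E where "E W = subtopology D W" for W
        obtain W where W: "openin D W" "t \<in> W" and "\<exists>y\<in>Sec (pb f I) (E W) (cmp (E W) g (incl (E W))).
           in_ball d (E W) (cmp (E W) f (cmp (E W) g (incl (E W)))) (ball_of (E W) (cmp (E W) f (cmp (E W) g (incl (E W)))) y)
             (Res X C f (E W) (cmp (E W) g (incl (E W))) z) = arrs (E W)"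
          using cov t unfolding E_def by (rule on_coverE)
        then obtain y where y: "y \<in> Sec (pb f I) (E W) (cmp (E W) g (incl (E W)))"
          and inby: "in_ball d (E W) (cmp (E W) f (cmp (E W) g (incl (E W)))) (ball_of (E W) (cmp (E W) f (cmp (E W) g (incl (E W)))) y)
             (Res X C f (E W) (cmp (E W) g (incl (E W))) z) = arrs (E W)"
          by blast
        have k: "(E W, incl (E W)) \<in> arrs D" unfolding E_def by (rule arrs_incl[OF arrs_is_T[OF g]])
        obtain u where u: "y = Inr u" "u \<in> cmaps (E W) (discrete_topology UNIV)"
          "\<forall>t\<in>topspace (E W). u t \<in> balls_in G (cmp (E W) f (cmp (E W) g (incl (E W))) t)"
          using y by (auto simp: Sec_pb I_def fiber_psh_def)
        have tE: "t \<in> topspace (E W)" using W t by (simp add: E_def)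
        have "code C f z (g t) (centre_no (u t)) < radius (u t)"
          using inby[unfolded u(1) inb[OF arrs_cmp[OF g k] refl u(2,3)]] tE by (auto simp: cmp_apply incl_apply)
        moreover obtain V where "ball_in G (centre_no (u t)) (radius (u t)) V" "f (g t) \<in> V"
          using u(3)[THEN bspec, OF tE] tE by (auto simp: balls_in_def cmp_apply incl_apply)
        ultimately show "(f (g t), code C f z (g t)) \<in> G"
          using code_fib[OF f z arrs_in[OF g t]] by (auto simp: ball_in_def)
      qed
    qed
  qed
  moreover have "sheaf_over A I" unfolding I_def by (rule sheaf_fiber)
  ultimately show ?thesis
    unfolding overt_union_of_balls_def
    using overt by (intro exI[of _ I] exI[of _ ball_of]) auto
qed

end

section \<open>Universal quantification over a totally bounded object\<close>

definition all_points :: "space \<Rightarrow> 'x psh \<Rightarrow> (space \<Rightarrow> (pt \<Rightarrow> pt) \<Rightarrow> 'x \<Rightarrow> sieve) \<Rightarrow> pt set" where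
  "all_points B F U = {b \<in> topspace B. \<forall>(D, g)\<in>arrs B. \<forall>y\<in>Sec F D g. \<forall>t\<in>topspace D.
     g t = b \<longrightarrow> t \<in> supp (U D g y)}"

lemma all_pointsD:
  "b \<in> all_points B F U \<Longrightarrow> (D, g) \<in> arrs B \<Longrightarrow> y \<in> Sec F D g \<Longrightarrow> t \<in> topspace D \<Longrightarrow> g t = b
    \<Longrightarrow> t \<in> supp (U D g y)"
  unfolding all_points_def by blast

lemma all_pointsI:
  assumes "b \<in> topspace B" "\<And>D g y t. (D, g) \<in> arrs B \<Longrightarrow> y \<in> Sec F D g \<Longrightarrow> t \<in> topspace D \<Longrightarrow> g t = b
    \<Longrightarrow> t \<in> supp (U D g y)"
  shows "b \<in> all_points B F U"
  using assms unfolding all_points_def by blast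

text \<open>
  Sections at one point suffice: an element over \<open>g' t' = g t\<close> restricts to the one-point space
  at \<open>t'\<close>, which can also be mapped to \<open>D\<close> at \<open>t\<close>, where the quantified statement applies.
\<close>

lemma tv_all_eq:
  assumes F: "presheaf_over B F" and U: "open_subset B F U"
  shows "tv_all B F U = {(D, g) \<in> arrs B. g ` topspace D \<subseteq> all_points B F U}"
  unfolding tv_all_def
proof (rule Collect_cong, clarify, intro conj_cong refl iffI)
  fix D g assume g: "(D, g) \<in> arrs B"
    and all: "\<forall>(E, k)\<in>arrs D. \<forall>y\<in>Sec F E (cmp E g k). U E (cmp E g k) y = arrs E"
  show "g ` topspace D \<subseteq> all_points B F U"
  proof (rule image_subsetI, rule all_pointsI)
    fix t assume t: "t \<in> topspace D"
    then show "g t \<in> topspace B" by (rule arrs_in[OF g])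
    fix D' g' y t' assume g': "(D', g') \<in> arrs B" and y: "y \<in> Sec F D' g'" and t': "t' \<in> topspace D'"
      and eq: "g' t' = g t"
    define E where "E = subtopology D' {t'}"
    have tE: "topspace E = {t'}" using t' by (auto simp: E_def)
    have k': "(E, incl E) \<in> arrs D'" unfolding E_def by (rule arrs_incl[OF arrs_is_T[OF g']])
    have "continuous_map E D (\<lambda>_\<in>topspace E. t)"
      by (rule continuous_map_eq[of _ _ "\<lambda>_. t"]) (use t in auto)
    then have k: "(E, \<lambda>_\<in>topspace E. t) \<in> arrs D" using arrs_is_T[OF k'] by (simp add: arrs_iff)
    have gk: "cmp E g (\<lambda>_\<in>topspace E. t) = cmp E g' (incl E)"
      by (rule extensionalityI[OF cmp_ext cmp_ext]) (simp add: cmp_apply incl_apply tE eq)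
    have y': "Res F D' g' E (incl E) y \<in> Sec F E (cmp E g' (incl E))" by (rule Res_in[OF F g' y k'])
    have "U E (cmp E g' (incl E)) (Res F D' g' E (incl E) y) = arrs E"
      using all[THEN bspec, OF k, unfolded prod.case gk, THEN bspec, OF y'] .
    then have "supp (U E (cmp E g' (incl E)) (Res F D' g' E (incl E) y)) = topspace E"
      using supp_full_iff[OF arrs_is_T[OF k'] open_subset_Sigma[OF U arrs_cmp[OF g' k'] y']] by simp
    then have "t' \<in> {t \<in> topspace E. incl E t \<in> supp (U D' g' y)}"
      unfolding supp_Res[OF U g' y k'] tE by simp
    then show "t' \<in> supp (U D' g' y)" using incl_apply[of t' E] tE by simp
  qed
next
  fix D g assume g: "(D, g) \<in> arrs B" and sub: "g ` topspace D \<subseteq> all_points B F U"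
  show "\<forall>(E, k)\<in>arrs D. \<forall>y\<in>Sec F E (cmp E g k). U E (cmp E g k) y = arrs E"
  proof clarify
    fix E k y assume k: "(E, k) \<in> arrs D" and y: "y \<in> Sec F E (cmp E g k)"
    note gk = arrs_cmp[OF g k]
    have "topspace E \<subseteq> supp (U E (cmp E g k) y)"
    proof
      fix t assume t: "t \<in> topspace E"
      then have "cmp E g k t \<in> all_points B F U" using sub arrs_in[OF k t] by (auto simp: cmp_apply)
      then show "t \<in> supp (U E (cmp E g k) y)" using gk y t by (rule all_pointsD) simp
    qed
    moreover have "supp (U E (cmp E g k) y) \<subseteq> topspace E"
      by (rule openin_subset[OF supp_open[OF arrs_is_T[OF k] open_subset_Sigma[OF U gk y]]])
    ultimately show "U E (cmp E g k) y = arrs E"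
      using supp_full_iff[OF arrs_is_T[OF k] open_subset_Sigma[OF U gk y]] by blast
  qed
qed

lemma open_subset_pb:
  assumes h: "(B, h) \<in> arrs A" and U: "open_subset A F U"
  shows "open_subset B (pb h F) (pbm h U)"
proof -
  have "pb h Omega = Omega" by (simp add: pb_def Omega_def)
  then have "nat_map B (pb h F) Omega (pbm h U)"
    using nat_map_pb[OF h U[unfolded open_subset_def, THEN conjunct1]] by simp
  then show ?thesis
    using open_subset_Sigma[OF U arrs_cmp[OF h]] unfolding open_subset_def Sec_pb pbm_def by blast
qed

text \<open>
  The set of points where the quantified statement holds is computed locally, which reduces its
  openness to stages at which a sequence is given.
\<close>

lemma all_points_restrict:
  fixes V :: "pt set"
  assumes F: "presheaf_over B F" and U: "open_subset B F U" and B: "is_T B"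
  defines "W \<equiv> subtopology B V"
  shows "all_points W (pb (incl W) F) (pbm (incl W) U) = all_points B F U \<inter> V"
proof (intro equalityI subsetI IntI)
  have j: "(W, incl W) \<in> arrs B" unfolding W_def by (rule arrs_incl[OF B])
  fix b assume b: "b \<in> all_points W (pb (incl W) F) (pbm (incl W) U)"
  then have bW: "b \<in> topspace W" by (simp add: all_points_def)
  then show "b \<in> V" by (simp add: W_def)
  show "b \<in> all_points B F U"
  proof (rule all_pointsI)
    show "b \<in> topspace B" using bW by (simp add: W_def)
    fix D g y t assume g: "(D, g) \<in> arrs B" and y: "y \<in> Sec F D g" and t: "t \<in> topspace D" and gt: "g t = b"
    define E where "E = subtopology D {t}"
    have k: "(E, incl E) \<in> arrs D" unfolding E_def by (rule arrs_incl[OF arrs_is_T[OF g]])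
    have tE: "topspace E = {t}" using t by (auto simp: E_def)
    have gk: "(E, cmp E g (incl E)) \<in> arrs W"
      unfolding W_def by (rule arrs_corestrict[OF arrs_cmp[OF g k]])
        (use tE gt \<open>b \<in> V\<close> in \<open>simp add: cmp_apply incl_apply\<close>)
    have "t \<in> supp (pbm (incl W) U E (cmp E g (incl E)) (Res F D g E (incl E) y))"
      by (rule all_pointsD[OF b gk])
        (use Res_in[OF F g y k] tE gt in \<open>simp_all add: Sec_pb incl_cmp[OF gk] cmp_apply incl_apply\<close>)
    then show "t \<in> supp (U D g y)"
      unfolding pbm_def incl_cmp[OF gk] supp_Res[OF U g y k] by (simp add: tE incl_apply)
  qed
next
  have j: "(W, incl W) \<in> arrs B" unfolding W_def by (rule arrs_incl[OF B])
  fix b assume b: "b \<in> all_points B F U \<inter> V"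
  then have bW: "b \<in> topspace W" by (auto simp: W_def all_points_def)
  then show "b \<in> all_points W (pb (incl W) F) (pbm (incl W) U)"
  proof (rule all_pointsI)
    fix D g y t assume g: "(D, g) \<in> arrs W" and y: "y \<in> Sec (pb (incl W) F) D g"
      and t: "t \<in> topspace D" and gt: "g t = b"
    show "t \<in> supp (pbm (incl W) U D g y)"
      unfolding pbm_def
      by (rule all_pointsD[OF _ arrs_cmp[OF j g], of b])
         (use b y t gt bW in \<open>simp_all add: Sec_pb cmp_apply incl_apply\<close>)
  qed
qed

context sep_complete
begin

lemma section_at_point:
  assumes b: "b \<in> topspace A" and c: "c \<in> fib b"
  obtains C f x where "(C, f) \<in> arrs A" "x \<in> Sec X C f" "b \<in> topspace C" "f b = b" "code C f x b = c"
proof -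
  define C where "C = subtopology A {b}"
  have tC: "topspace C = {b}" using b by (auto simp: C_def)
  have f: "(C, incl C) \<in> arrs A" unfolding C_def by (rule arrs_incl[OF base])
  have "continuous_map C euclidean (\<lambda>_\<in>topspace C. c)"
    by (rule continuous_map_eq[of _ _ "\<lambda>_. c"]) auto
  then have "(\<lambda>_\<in>topspace C. c) \<in> cmaps C euclidean" by (simp add: cmaps_def)
  then obtain x where "x \<in> Sec X C (incl C)" "code C (incl C) x = (\<lambda>_\<in>topspace C. c)"
    by (rule code_surj[OF f]) (use c in \<open>simp_all add: tC incl_apply\<close>)
  then show ?thesis using that[OF f] by (simp add: tC incl_apply)
qed

lemma fib_totally_bounded:
  assumes tb: "\<And>C f x t. (C, f) \<in> arrs A \<Longrightarrow> x \<in> Sec X C f \<Longrightarrow> t \<in> topspace C \<Longrightarrow>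
      near_term X d s C f x t r (\<lambda>k. k < N (f t))"
    and b: "b \<in> topspace A" and c: "c \<in> fib b"
  shows "\<exists>k<N b. b \<in> sdom k \<and> c k < r"
proof -
  obtain C f x where f: "(C, f) \<in> arrs A" and x: "x \<in> Sec X C f" and bC: "b \<in> topspace C"
    and eq: "f b = b" "code C f x b = c"
    using section_at_point[OF b c] by blast
  obtain D g t' \<nu> y where g: "(D, g) \<in> arrs C" and t': "t' \<in> topspace D" "g t' = b"
    and \<nu>: "\<nu> \<in> Sec Nat_obj D (cmp D f g)" and y: "s D (cmp D f g) \<nu> = (topspace D, y)"
    and "d D (cmp D f g) (Res X C f D g x, y) t' < r" "\<nu> t' < N (f b)"
    using tb[OF f x bC] unfolding near_term_def by blast
  then show ?thesis using s_value_code[OF f x g t'(1) \<nu> y] eq by auto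
qed

text \<open>
  Total boundedness replaces the infimum condition in the definition of the fibre by finite disjunctions
  of weak inequalities, so the fibre is closed. It also bounds every coordinate, so the fibre lies in
  a compact product of intervals.
\<close>

lemma compact_fib:
  assumes b: "b \<in> topspace A"
    and tb: "\<And>m c. c \<in> fib b \<Longrightarrow> \<exists>k<N m. b \<in> sdom k \<and> c k < (1/2::real) ^ m"
  shows "compact (fib b)"
proof -
  define Z where "Z = {c::pt. (\<forall>n. b \<notin> sdom n \<longrightarrow> c n = 0) \<and>
     (\<forall>n m. b \<in> sdom n \<longrightarrow> b \<in> sdom m \<longrightarrow> \<bar>c m - sdist n b m\<bar> \<le> c n) \<and>
     (\<forall>m. \<exists>k\<in>{k. k < N m \<and> b \<in> sdom k}. c k \<le> (1/2) ^ m)}"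
  have "closed {c::pt. \<exists>k\<in>{k. k < N m \<and> b \<in> sdom k}. c k \<le> (1/2) ^ m}" for m
  proof -
    have "{c::pt. \<exists>k\<in>{k. k < N m \<and> b \<in> sdom k}. c k \<le> (1/2) ^ m} =
      (\<Union>k\<in>{k. k < N m \<and> b \<in> sdom k}. {c. c k \<le> (1/2) ^ m})" by auto
    also have "closed \<dots>" by (intro closed_UN ballI closed_Collect_le continuous_intros) auto
    finally show ?thesis .
  qed
  then have "closed Z" unfolding Z_def
    by (intro closed_Collect_conj closed_Collect_all closed_Collect_imp closed_Collect_eq closed_Collect_le
        open_Collect_const continuous_intros) auto
  moreover have "fib b = Z"
  proof (intro equalityI subsetI)
    fix c assume c: "c \<in> fib b"
    have "\<exists>k\<in>{k. k < N m \<and> b \<in> sdom k}. c k \<le> (1/2) ^ m" for m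
    proof -
      obtain k where "k < N m" "b \<in> sdom k" "c k < (1/2) ^ m" using tb[OF c, of m] by auto
      then show ?thesis by (intro bexI[of _ k]) auto
    qed
    then show "c \<in> Z" using fib_undefined[OF c] fib_triangle[OF c] by (simp add: Z_def)
  next
    fix c assume c: "c \<in> Z"
    have "\<exists>n. b \<in> sdom n \<and> c n < \<epsilon>" if "\<epsilon> > 0" for \<epsilon> :: real
    proof -
      obtain m where m: "(1/2::real) ^ m < \<epsilon>" using real_arch_pow_inv[OF \<open>\<epsilon> > 0\<close>, of "1/2"] by auto
      have "\<exists>k\<in>{k. k < N m \<and> b \<in> sdom k}. c k \<le> (1/2) ^ m" using c by (simp add: Z_def)
      then obtain k where "b \<in> sdom k" "c k \<le> (1/2) ^ m" by auto
      then show ?thesis using m by (intro exI[of _ k]) simp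
    qed
    then show "c \<in> fib b" using c by (simp add: Z_def fib_def)
  qed
  moreover define M where "M n = 1 + (\<Sum>k<N 0. \<bar>sdist k b n\<bar>)" for n
  have "fib b \<subseteq> PiE UNIV (\<lambda>n. {- M n..M n})"
  proof (rule subsetI, rule PiE_I)
    fix c n assume c: "c \<in> fib b"
    obtain k where k: "k < N 0" "b \<in> sdom k" "c k < 1" using tb[OF c, of 0] by auto
    have M: "1 + \<bar>sdist k b n\<bar> \<le> M n"
      unfolding M_def using k(1) member_le_sum[of k "{..<N 0}" "\<lambda>k. \<bar>sdist k b n\<bar>"] by simp
    show "c n \<in> {- M n..M n}"
    proof (cases "b \<in> sdom n")
      case True
      then show ?thesis using fib_triangle[OF c k(2), of n] k(3) M unfolding atLeastAtMost_iff by linarith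
    next
      case False
      then show ?thesis using fib_undefined[OF c False] M by simp
    qed
  qed simp
  moreover have "compact (PiE UNIV (\<lambda>n. {- M n..M n}))"
    using compactin_PiE[of "\<lambda>_. euclideanreal" UNIV "\<lambda>n. {- M n..M n}"]
    by (simp add: euclidean_product_topology)
  ultimately show ?thesis
    using compact_Int_closed[of "PiE UNIV (\<lambda>n. {- M n..M n})" Z] by (simp add: Int_absorb1)
qed

text \<open>
  Finitely many balls \<open>(n, r, V)\<close> with slightly smaller radii \<open>r'\<close> cover the compact fibre over \<open>b0\<close>,
  and \<open>\<eta>\<close> bounds the loss of radius. Each of the finitely many terms \<open>k < N m b0\<close> defined at \<open>b0\<close> lies in
  one of the smaller balls and stays in it for \<open>b\<close> near \<open>b0\<close>, so everything within \<open>\<eta>\<close> of such a term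
  lies in the corresponding ball of radius \<open>r\<close>. Over \<open>b\<close> near \<open>b0\<close> every point is within \<open>(1/2) ^ m < \<eta>\<close>
  of such a term.
\<close>

lemma open_all_fib:
  assumes G: "openin (prod_topology A euclidean) G"
    and N: "\<And>m b. b \<in> topspace A \<Longrightarrow> openin A {b' \<in> topspace A. N m b' = N m b}"
    and tb: "\<And>m b c. b \<in> topspace A \<Longrightarrow> c \<in> fib b \<Longrightarrow> \<exists>k<N m b. b \<in> sdom k \<and> c k < (1/2::real) ^ m"
  shows "openin A {b \<in> topspace A. \<forall>c\<in>fib b. (b, c) \<in> G}"
proof (subst openin_subopen, intro ballI)
  fix b0 assume "b0 \<in> {b \<in> topspace A. \<forall>c\<in>fib b. (b, c) \<in> G}"
  then have b0: "b0 \<in> topspace A" and all: "\<And>c. c \<in> fib b0 \<Longrightarrow> (b0, c) \<in> G" by auto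
  define P where "P = {(n, r', r, V). r' < r \<and> ball_in G n r V \<and> b0 \<in> V}"
  define near where "near = (\<lambda>(n, r', r::real, V::pt set). {c::pt. c n < r'})"
  have cover: "fib b0 \<subseteq> (\<Union>p\<in>P. near p)"
  proof
    fix c assume c: "c \<in> fib b0"
    obtain n r V where "ball_in G n r V" "b0 \<in> V" "c n < r" using ex_ball_in[OF G all[OF c] c] .
    moreover obtain r' where "c n < r'" "r' < r" using Orderings.dense[OF \<open>c n < r\<close>] by blast
    ultimately have "(n, r', r, V) \<in> P" "c \<in> near (n, r', r, V)" by (auto simp: P_def near_def)
    then show "c \<in> (\<Union>p\<in>P. near p)" by blast
  qed
  have op: "open (near p)" if "p \<in> P" for p
    unfolding near_def by (auto split: prod.splits intro!: open_Collect_less continuous_intros)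
  obtain P' where P': "P' \<subseteq> P" "finite P'" "fib b0 \<subseteq> (\<Union>p\<in>P'. near p)"
    by (rule compactE_image[OF compact_fib[OF b0 tb[OF b0]] op cover])
  \<comment> \<open>The element \<open>1\<close> is there for the case that \<open>P'\<close> is empty.\<close>
  define \<eta> where "\<eta> = Min (insert 1 ((\<lambda>(n, r', r, V). r - r') ` P'))"
  have "\<eta> > 0" unfolding \<eta>_def using P'(1,2) by (subst Min_gr_iff) (auto simp: P_def)
  have \<eta>: "r' + \<eta> \<le> r" if "(n, r', r, V) \<in> P'" for n r' r V
  proof -
    have "\<eta> \<le> r - r'" unfolding \<eta>_def using P'(2) that by (intro Min_le) force+
    then show ?thesis by simp
  qed
  obtain m where m: "(1/2::real) ^ m < \<eta>" using real_arch_pow_inv[OF \<open>\<eta> > 0\<close>, of "1/2"] by auto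
  have "\<exists>W. openin A W \<and> b0 \<in> W \<and>
      (\<forall>b\<in>W. \<forall>c\<in>fib b. b \<in> sdom k \<longrightarrow> c k < (1/2) ^ m \<longrightarrow> (b, c) \<in> G)" for k
  proof (cases "b0 \<in> sdom k")
    case False
    then show ?thesis
      using b0 sdom_clopen(2)[of k] by (intro exI[of _ "topspace A - sdom k"]) auto
  next
    case True
    obtain p where "p \<in> P'" "sdist k b0 \<in> near p" using P'(3) sdist_fib[OF True] by blast
    moreover obtain n r' r V where p: "p = (n, r', r, V)" by (cases p)
    ultimately have pP: "(n, r', r, V) \<in> P'" and less: "sdist k b0 n < r'" by (auto simp: near_def)
    then have V: "ball_in G n r V" "b0 \<in> V" using P'(1) by (auto simp: P_def)
    define W where "W = V \<inter> {b \<in> topspace (subtopology A (sdom k)). sdist k b n < r'}"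
    have "openin A W" unfolding W_def
      using V(1) openin_trans_full[OF open_less[OF coordinate_continuous[OF sdist_cmaps]] sdom_clopen(1)]
      by (intro openin_Int) (auto simp: ball_in_def)
    moreover have "b0 \<in> W" using V(2) True b0 less by (simp add: W_def)
    moreover have "(b, c) \<in> G" if b: "b \<in> W" and c: "c \<in> fib b" and k: "b \<in> sdom k" "c k < (1/2) ^ m" for b c
    proof -
      have "b \<in> V" "sdist k b n < r'" using b by (auto simp: W_def)
      moreover have "b \<in> sdom n" using V(1) \<open>b \<in> V\<close> by (auto simp: ball_in_def)
      ultimately have "c n < r" using fib_triangle[OF c k(1), of n] k(2) m \<eta>[OF pP] by simp
      then show ?thesis using V(1) \<open>b \<in> V\<close> c by (simp add: ball_in_def)
    qed
    ultimately show ?thesis by blast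
  qed
  then obtain W where W: "\<And>k. openin A (W k)" "\<And>k. b0 \<in> W k"
    "\<And>k b c. b \<in> W k \<Longrightarrow> c \<in> fib b \<Longrightarrow> b \<in> sdom k \<Longrightarrow> c k < (1/2) ^ m \<Longrightarrow> (b, c) \<in> G"
    by metis
  define Y where "Y = {b \<in> topspace A. N m b = N m b0} \<inter> ((\<Inter>k<N m b0. W k) \<inter> topspace A)"
  have "openin A Y" unfolding Y_def
    by (intro openin_Int N[OF b0] openin_INT W(1)) simp
  moreover have "b0 \<in> Y" using W(2) b0 by (simp add: Y_def)
  moreover have "Y \<subseteq> {b \<in> topspace A. \<forall>c\<in>fib b. (b, c) \<in> G}"
  proof (intro subsetI CollectI conjI ballI)
    fix b assume b: "b \<in> Y"
    then show bA: "b \<in> topspace A" by (simp add: Y_def)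
    fix c assume c: "c \<in> fib b"
    obtain k where "k < N m b" "b \<in> sdom k" "c k < (1/2) ^ m" using tb[OF bA c] by blast
    then show "(b, c) \<in> G" using W(3)[of b k c] b c by (auto simp: Y_def)
  qed
  ultimately show "\<exists>T. openin A T \<and> b0 \<in> T \<and> T \<subseteq> {b \<in> topspace A. \<forall>c\<in>fib b. (b, c) \<in> G}"
    by blast
qed

theorem all_points_open:
  assumes U: "open_subset A X U"
    and N: "\<And>m b. b \<in> topspace A \<Longrightarrow> openin A {b' \<in> topspace A. N m b' = N m b}"
    and tb: "\<And>m b c. b \<in> topspace A \<Longrightarrow> c \<in> fib b \<Longrightarrow> \<exists>k<N m b. b \<in> sdom k \<and> c k < (1/2::real) ^ m"
  shows "openin A (all_points A X U)"
proof -
  obtain G where G: "openin (prod_topology A euclidean) G"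
    and supp: "\<And>C f x. (C, f) \<in> arrs A \<Longrightarrow> x \<in> Sec X C f \<Longrightarrow>
      supp (U C f x) = {t \<in> topspace C. (f t, code C f x t) \<in> G}"
    using open_subset_code[OF U] by blast
  have "all_points A X U = {b \<in> topspace A. \<forall>c\<in>fib b. (b, c) \<in> G}"
  proof (intro equalityI subsetI CollectI conjI ballI)
    fix b assume b: "b \<in> all_points A X U"
    then show bA: "b \<in> topspace A" by (simp add: all_points_def)
    fix c assume c: "c \<in> fib b"
    obtain C f x where f: "(C, f) \<in> arrs A" "x \<in> Sec X C f" "b \<in> topspace C" "f b = b" "code C f x b = c"
      using section_at_point[OF bA c] .
    show "(b, c) \<in> G" using all_pointsD[OF b f(1-4)] supp[OF f(1,2)] f(4,5) by simp
  next
    fix b assume b: "b \<in> {b \<in> topspace A. \<forall>c\<in>fib b. (b, c) \<in> G}"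
    show "b \<in> all_points A X U"
    proof (rule all_pointsI)
      fix D g y t assume g: "(D, g) \<in> arrs A" "y \<in> Sec X D g" "t \<in> topspace D" "g t = b"
      then show "t \<in> supp (U D g y)" using b code_fib[OF g(1-3)] by (simp add: supp)
    qed (use b in simp)
  qed
  then show ?thesis by (simp only: open_all_fib[OF G N tb])
qed

end

section \<open>Localization of the witnessing sequences\<close>

text \<open>
  The cover of \<open>B\<close> consists of the preimages \<open>W\<close> of the members \<open>B'\<close> of the cover of \<open>A\<close>. Such a \<open>W\<close>
  lies over \<open>A\<close> in two ways, through \<open>B\<close> and through \<open>B'\<close>.
\<close>

lemma on_cover_pb:
  assumes P: "on_cover A P" and h: "(B, h) \<in> arrs A"
    and Q: "\<And>B' h' W j l. (B', h') \<in> arrs A \<Longrightarrow> (W, j) \<in> arrs B \<Longrightarrow> (W, l) \<in> arrs B' \<Longrightarrow>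
      cmp W h' l = cmp W h j \<Longrightarrow> P B' h' \<Longrightarrow> Q W j"
    and A: "is_T A"
  shows "on_cover B Q"
proof (rule on_coverI[OF arrs_is_T[OF h]])
  fix b assume b: "b \<in> topspace B"
  obtain V where V: "openin A V" "h b \<in> V" "P (subtopology A V) (incl (subtopology A V))"
    using P arrs_in[OF h b] by (rule on_coverE)
  define V' where "V' = {b \<in> topspace B. h b \<in> V}"
  define W where "W = subtopology B V'"
  have j: "(W, incl W) \<in> arrs B" unfolding W_def by (rule arrs_incl[OF arrs_is_T[OF h]])
  have l: "(W, cmp W h (incl W)) \<in> arrs (subtopology A V)"
    by (rule arrs_corestrict[OF arrs_cmp[OF h j]]) (auto simp: cmp_apply incl_apply W_def V'_def)
  have "Q W (incl W)" by (rule Q[OF arrs_incl[OF A] j l incl_cmp[OF l] V(3)])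
  moreover have "openin B V'" unfolding V'_def by (rule openin_continuous_map_preimage[OF arrs_cont[OF h] V(1)])
  ultimately show "\<exists>U. openin B U \<and> b \<in> U \<and> Q (subtopology B U) (incl (subtopology B U))"
    using V(2) b unfolding W_def by (intro exI[of _ V']) (simp add: V'_def)
qed

lemma nat_map_cong:
  assumes "nat_map A F G \<eta>"
    and "\<And>C f. (C, f) \<in> arrs A \<Longrightarrow> Sec G C f = Sec G' C f"
    and "\<And>C f. (C, f) \<in> arrs A \<Longrightarrow> Res G C f = Res G' C f"
  shows "nat_map A F G' \<eta>"
  unfolding nat_map_def
  by (rule iffD1[OF ball_arrs_cong assms(1)[unfolded nat_map_def]]) (simp add: assms(2,3))

lemma near_term_mono:
  assumes "near_term X d s C f x t \<epsilon> P" "\<epsilon> \<le> \<epsilon>'" "\<And>k. P k \<Longrightarrow> P' k"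
  shows "near_term X d s C f x t \<epsilon>' P'"
proof -
  obtain D g t' \<nu> y where *: "(D, g) \<in> arrs C" "t' \<in> topspace D" "g t' = t"
    "\<nu> \<in> Sec Nat_obj D (cmp D f g)" "s D (cmp D f g) \<nu> = (topspace D, y)"
    "d D (cmp D f g) (Res X C f D g x, y) t' < \<epsilon>" "P (\<nu> t')"
    using assms(1) unfolding near_term_def by blast
  have "d D (cmp D f g) (Res X C f D g x, y) t' < \<epsilon>'" using *(6) assms(2) by simp
  with * assms(3) show ?thesis unfolding near_term_def by blast
qed

lemma near_term_of_cover:
  assumes "on_cover C (\<lambda>D g. \<exists>\<nu>\<in>Sec Nat_obj D (cmp D f g). \<exists>y\<in>Y D g. Q D g \<nu> \<and>
      s D (cmp D f g) \<nu> = (topspace D, y) \<and> (\<forall>t\<in>topspace D. d D (cmp D f g) (Res X C f D g x, y) t < r (g t)))"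
    and C: "is_T C" and t: "t \<in> topspace C"
    and P: "\<And>D g \<nu> t'. (D, g) \<in> arrs C \<Longrightarrow> t' \<in> topspace D \<Longrightarrow> g t' = t \<Longrightarrow> Q D g \<nu> \<Longrightarrow> P (\<nu> t')"
  shows "near_term X d s C f x t (r t) P"
proof -
  define D where "D V = subtopology C V" for V
  obtain V where V: "openin C V" "t \<in> V" and ex: "\<exists>\<nu>\<in>Sec Nat_obj (D V) (cmp (D V) f (incl (D V))). \<exists>y\<in>Y (D V) (incl (D V)). Q (D V) (incl (D V)) \<nu> \<and>
      s (D V) (cmp (D V) f (incl (D V))) \<nu> = (topspace (D V), y) \<and>
      (\<forall>t\<in>topspace (D V). d (D V) (cmp (D V) f (incl (D V))) (Res X C f (D V) (incl (D V)) x, y) t < r (incl (D V) t))"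
    using assms(1) t unfolding D_def by (rule on_coverE)
  have g: "(D V, incl (D V)) \<in> arrs C" unfolding D_def by (rule arrs_incl[OF C])
  have tD: "t \<in> topspace (D V)" using V t by (simp add: D_def)
  obtain \<nu> y where "\<nu> \<in> Sec Nat_obj (D V) (cmp (D V) f (incl (D V)))" "Q (D V) (incl (D V)) \<nu>"
    "s (D V) (cmp (D V) f (incl (D V))) \<nu> = (topspace (D V), y)"
    "\<forall>t\<in>topspace (D V). d (D V) (cmp (D V) f (incl (D V))) (Res X C f (D V) (incl (D V)) x, y) t < r (incl (D V) t)"
    using ex by blast
  then show ?thesis
    unfolding near_term_def using g tD P[OF g tD incl_apply[OF tD]] incl_apply[OF tD]
    by (intro exI[of _ "D V"] exI[of _ "incl (D V)"] exI[of _ t] exI[of _ \<nu>] exI[of _ y]) auto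
qed

text \<open>
  A commutative square: data given over \<open>B'\<close> are used for the object obtained by changing the stage
  first to \<open>B\<close> and then to \<open>W\<close>. Iterated and composite changes of stage agree only at arrows of the site,
  so each notion is transferred separately.
\<close>

locale change_of_stage =
  fixes A B B' W :: space and h h' j l :: "pt \<Rightarrow> pt"
  assumes h: "(B, h) \<in> arrs A" and h': "(B', h') \<in> arrs A"
    and j: "(W, j) \<in> arrs B" and l: "(W, l) \<in> arrs B'"
    and eq: "cmp W h' l = cmp W h j"
begin

lemma square: "(D, g) \<in> arrs W \<Longrightarrow> cmp D h' (cmp D l g) = cmp D h (cmp D j g)"
  using eq by (metis cmp_assoc)

lemma sequence_pb:
  assumes s: "nat_map B' Nat_obj (one_plus (pb h' X)) s"
  shows "nat_map W Nat_obj (one_plus (pb j (pb h X))) (pbm l s)"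
proof (rule nat_map_cong)
  have "pb l Nat_obj = Nat_obj" by (simp add: pb_def Nat_obj_def cont_psh_def)
  then show "nat_map W Nat_obj (pb l (one_plus (pb h' X))) (pbm l s)" using nat_map_pb[OF l s] by simp
  fix C f assume f: "(C, f) \<in> arrs W"
  have *: "cmp (subtopology C V) h' (amap_restr C (cmp C l f) V) =
      cmp (subtopology C V) h (cmp (subtopology C V) j (amap_restr C f V))" for V
    unfolding cmp_amap_restr[OF f arrs_is_T[OF l], symmetric] by (rule square[OF arrs_amap_restr[OF f]])
  show "Sec (pb l (one_plus (pb h' X))) C f = Sec (one_plus (pb j (pb h X))) C f"
    by (simp add: one_plus_def Sec_pb *)
  show "Res (pb l (one_plus (pb h' X))) C f = Res (one_plus (pb j (pb h X))) C f"
    by (simp add: one_plus_def Res_pb *)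
qed

lemma near_term_pb:
  assumes f: "(C, f) \<in> arrs W"
    and n: "near_term (pb h' X) (pbm h' d) s C (cmp C l f) x t \<epsilon> P"
  shows "near_term (pb j (pb h X)) (pbm j (pbm h d)) (pbm l s) C f x t \<epsilon> P"
proof -
  obtain D g t' \<nu> y where g: "(D, g) \<in> arrs C" and *: "t' \<in> topspace D" "g t' = t"
    "\<nu> \<in> Sec Nat_obj D (cmp D (cmp C l f) g)" "s D (cmp D (cmp C l f) g) \<nu> = (topspace D, y)"
    "pbm h' d D (cmp D (cmp C l f) g) (Res (pb h' X) C (cmp C l f) D g x, y) t' < \<epsilon>" "P (\<nu> t')"
    using n unfolding near_term_def by blast
  have "\<nu> \<in> Sec Nat_obj D (cmp D f g)" using *(3) by (simp add: Nat_obj_def cont_psh_def)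
  moreover have "pbm l s D (cmp D f g) \<nu> = (topspace D, y)"
    using *(4) by (simp add: pbm_def cmp_assoc[OF g])
  moreover have "pbm j (pbm h d) D (cmp D f g) (Res (pb j (pb h X)) C f D g x, y) t' < \<epsilon>"
    using *(5) by (simp add: pbm_def Res_pb square[OF f] cmp_assoc[OF g] square[OF arrs_cmp[OF f g]])
  ultimately show ?thesis unfolding near_term_def using g *(1,2,6) by blast
qed

lemma sep_complete_pb:
  assumes X: "metric_obj A X (d :: 'a univ dist)" "complete_obj A X d"
    and s: "nat_map B' Nat_obj (one_plus (pb h' X)) s"
    and n: "\<And>C f x t \<epsilon>. (C, f) \<in> arrs B' \<Longrightarrow> x \<in> Sec (pb h' X) C f \<Longrightarrow> t \<in> topspace C \<Longrightarrow> 0 < \<epsilon> \<Longrightarrow>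
      near_term (pb h' X) (pbm h' d) s C f x t \<epsilon> (\<lambda>_. True)"
  shows "sep_complete W (pb j (pb h X)) (pbm j (pbm h d)) (pbm l s)"
proof
  show "is_T W" by (rule arrs_is_T[OF j])
  show "metric_obj W (pb j (pb h X)) (pbm j (pbm h d))" by (rule metric_pb[OF j metric_pb[OF h X(1)]])
  show "complete_at W (pb j (pb h X)) (pbm j (pbm h d))" by (rule complete_at_pb_pb[OF X(2) h j])
  show "nat_map W Nat_obj (one_plus (pb j (pb h X))) (pbm l s)" by (rule sequence_pb[OF s])
  fix C f x t and \<epsilon> :: real
  assume f: "(C, f) \<in> arrs W" and x: "x \<in> Sec (pb j (pb h X)) C f" and t: "t \<in> topspace C" and "0 < \<epsilon>"
  have "x \<in> Sec (pb h' X) C (cmp C l f)" using x by (simp add: Sec_pb square[OF f])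
  then show "near_term (pb j (pb h X)) (pbm j (pbm h d)) (pbm l s) C f x t \<epsilon> (\<lambda>_. True)"
    by (intro near_term_pb[OF f] n arrs_cmp[OF l f] t \<open>0 < \<epsilon>\<close>)
qed

end

lemma const_real: "(\<lambda>t\<in>topspace C. r) \<in> Sec Real_obj C f"
proof -
  have "continuous_map C euclideanreal (\<lambda>t\<in>topspace C. r)" by (rule continuous_map_eq[of _ _ "\<lambda>_. r"]) auto
  then show ?thesis by (simp add: Real_obj_def cont_psh_def cmaps_def)
qed

lemma separable_pieces:
  assumes A: "is_T A" and X: "metric_obj A X (d :: 'a univ dist)" "complete_obj A X d"
    and sep: "metrically_separable_obj A X d" and h: "(B, h) \<in> arrs A"
  shows "on_cover B (\<lambda>W j. \<exists>s. sep_complete W (pb j (pb h X)) (pbm j (pbm h d)) s)"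
proof (rule on_cover_pb[OF sep[unfolded metrically_separable_obj_def] h _ A], elim exE conjE)
  fix B' h' W j l s
  assume "(B', h') \<in> arrs A" "(W, j) \<in> arrs B" "(W, l) \<in> arrs B'" "cmp W h' l = cmp W h j"
  with h interpret change_of_stage A B B' W h h' j l by unfold_locales
  assume s: "nat_map B' Nat_obj (one_plus (pb h' X)) s"
    and dense: "\<forall>(C, f)\<in>arrs B'. \<forall>x\<in>Sec (pb h' X) C f. \<forall>r\<in>Sec Real_obj C f. (\<forall>t\<in>topspace C. 0 < r t) \<longrightarrow>
        on_cover C (\<lambda>D g. \<exists>n\<in>Sec Nat_obj D (cmp D f g). \<exists>y\<in>Sec (pb h' X) D (cmp D f g).
          s D (cmp D f g) n = (topspace D, y) \<and>
          (\<forall>t\<in>topspace D. pbm h' d D (cmp D f g) (Res (pb h' X) C f D g x, y) t < r (g t)))"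
  have "near_term (pb h' X) (pbm h' d) s C f x t \<epsilon> (\<lambda>_. True)"
    if f: "(C, f) \<in> arrs B'" and x: "x \<in> Sec (pb h' X) C f" and t: "t \<in> topspace C" and "0 < \<epsilon>" for C f x t \<epsilon>
  proof -
    have "near_term (pb h' X) (pbm h' d) s C f x t ((\<lambda>t\<in>topspace C. \<epsilon>) t) (\<lambda>_. True)"
      using dense[THEN bspec, OF f, unfolded prod.case, THEN bspec, OF x, THEN bspec, OF const_real[where r = \<epsilon>]] \<open>0 < \<epsilon>\<close>
      by (intro near_term_of_cover[where Q = "\<lambda>_ _ _. True" and Y = "\<lambda>D g. Sec (pb h' X) D (cmp D f g)"] arrs_is_T[OF f] t) simp_all
    then show ?thesis using t by simp
  qed
  then show "\<exists>s. sep_complete W (pb j (pb h X)) (pbm j (pbm h d)) s"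
    using sep_complete_pb[OF X s] by blast
qed

text \<open>
  The bounds \<open>a m\<close> for constant precision \<open>m\<close> are locally constant functions \<open>N m\<close> on the stage. They provide
  both the density of the sequence and the uniform bounds needed for compactness.
\<close>

lemma totally_bounded_pieces:
  assumes A: "is_T A" and X: "metric_obj A X (d :: 'a univ dist)" "complete_obj A X d"
    and tb: "totally_bounded_obj A X d" and h: "(B, h) \<in> arrs A"
  shows "on_cover B (\<lambda>W j. (\<exists>s. sep_complete W (pb j (pb h X)) (pbm j (pbm h d)) s) \<and>
    (\<forall>U. open_subset W (pb j (pb h X)) U \<longrightarrow> openin W (all_points W (pb j (pb h X)) U)))"
proof (rule on_cover_pb[OF tb[unfolded totally_bounded_obj_def] h _ A], elim exE conjE)
  fix B' h' W j l s a
  assume "(B', h') \<in> arrs A" "(W, j) \<in> arrs B" "(W, l) \<in> arrs B'" "cmp W h' l = cmp W h j"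
  with h interpret change_of_stage A B B' W h h' j l by unfold_locales
  assume s: "nat_map B' Nat_obj (one_plus (pb h' X)) s" and a: "nat_map B' Nat_obj Nat_obj a"
    and dense: "\<forall>(C, f)\<in>arrs B'. \<forall>n\<in>Sec Nat_obj C f. \<forall>x\<in>Sec (pb h' X) C f.
        on_cover C (\<lambda>D g. \<exists>k\<in>Sec Nat_obj D (cmp D f g). \<exists>y\<in>Sec (pb h' X) D (cmp D f g).
          (\<forall>t\<in>topspace D. k t < a C f n (g t)) \<and> s D (cmp D f g) k = (topspace D, y) \<and>
          (\<forall>t\<in>topspace D. pbm h' d D (cmp D f g) (Res (pb h' X) C f D g x, y) t < (1/2) ^ n (g t)))"
  define N where "N m b = a B' (incl B') (const_nat B' m) b" for m b
  note B' = arrs_id[OF arrs_is_T[OF h']]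
  have a_eq: "a C f (const_nat C m) t = N m (f t)" if f: "(C, f) \<in> arrs B'" and t: "t \<in> topspace C" for C f m t
    using nat_map_Res[OF a B' const_nat_in f, of m] t
    by (simp add: Nat_obj_def cont_psh_def cmp_const_nat[OF f] incl_cmp[OF f] cmp_apply N_def)
  have near: "near_term (pb h' X) (pbm h' d) s C f x t ((1/2) ^ m) (\<lambda>k. k < N m (f t))"
    if f: "(C, f) \<in> arrs B'" and x: "x \<in> Sec (pb h' X) C f" and t: "t \<in> topspace C" for C f x t m
  proof -
    have P: "\<nu> t' < N m (f t)"
      if "t' \<in> topspace D" "g t' = t" "\<forall>t\<in>topspace D. \<nu> t < a C f (const_nat C m) (g t)" for D g \<nu> t'
      using that a_eq[OF f t] by auto
    have "near_term (pb h' X) (pbm h' d) s C f x t ((1/2) ^ const_nat C m t) (\<lambda>k. k < N m (f t))"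
      using dense[THEN bspec, OF f, unfolded prod.case, THEN bspec, OF const_nat_in[of C m], THEN bspec, OF x]
      by (rule near_term_of_cover[where Q = "\<lambda>D g k. \<forall>t\<in>topspace D. k t < a C f (const_nat C m) (g t)"
            and r = "\<lambda>t. (1/2) ^ const_nat C m t" and Y = "\<lambda>D g. Sec (pb h' X) D (cmp D f g)"])
         (simp_all add: arrs_is_T[OF f] t P)
    then show ?thesis using t by (simp add: const_nat_def)
  qed
  have "near_term (pb h' X) (pbm h' d) s C f x t \<epsilon> (\<lambda>_. True)"
    if f: "(C, f) \<in> arrs B'" and x: "x \<in> Sec (pb h' X) C f" and t: "t \<in> topspace C" and "0 < \<epsilon>" for C f x t \<epsilon>
  proof -
    obtain m where m: "(1/2::real) ^ m < \<epsilon>" using real_arch_pow_inv[OF \<open>0 < \<epsilon>\<close>, of "1/2"] by auto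
    show ?thesis
      by (rule near_term_mono[OF near[OF f x t, of m]]) (use m in auto)
  qed
  then interpret sep_complete W "pb j (pb h X)" "pbm j (pbm h d)" "pbm l s"
    using sep_complete_pb[OF X s] by blast
  have "openin W {b' \<in> topspace W. N m (l b') = N m (l b)}" for m b
  proof -
    have "a B' (incl B') (const_nat B' m) \<in> Sec Nat_obj B' (incl B')" by (rule nat_map_in[OF a B' const_nat_in])
    then have "continuous_map B' (discrete_topology UNIV) (N m)"
      by (simp add: N_def[abs_def] Nat_obj_def cont_psh_def cmaps_def)
    then have "continuous_map W (discrete_topology UNIV) (N m \<circ> l)"
      using arrs_cont[OF l] continuous_map_compose by blast
    from openin_continuous_map_preimage[OF this, of "{N m (l b)}"] show ?thesis by simp
  qed
  moreover have "\<exists>k<N m (l b). b \<in> sdom k \<and> c k < (1/2) ^ m" if b: "b \<in> topspace W" "c \<in> fib b" for m b c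
  proof (rule fib_totally_bounded[OF _ b])
    fix C f x t
    assume f: "(C, f) \<in> arrs W" and x: "x \<in> Sec (pb j (pb h X)) C f" and t: "t \<in> topspace C"
    have "x \<in> Sec (pb h' X) C (cmp C l f)" using x by (simp add: Sec_pb square[OF f])
    then have "near_term (pb h' X) (pbm h' d) s C (cmp C l f) x t ((1/2) ^ m) (\<lambda>k. k < N m (l (f t)))"
      using near[OF arrs_cmp[OF l f] _ t, of x m] t by (simp add: cmp_apply)
    then show "near_term (pb j (pb h X)) (pbm j (pbm h d)) (pbm l s) C f x t ((1/2) ^ m) (\<lambda>k. k < N m (l (f t)))"
      by (rule near_term_pb[OF f])
  qed
  ultimately have "openin W (all_points W (pb j (pb h X)) U)" if "open_subset W (pb j (pb h X)) U" for U
    by (rule all_points_open[OF that, of "\<lambda>m b. N m (l b)"])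
  then show "(\<exists>s. sep_complete W (pb j (pb h X)) (pbm j (pbm h d)) s) \<and>
    (\<forall>U. open_subset W (pb j (pb h X)) U \<longrightarrow> openin W (all_points W (pb j (pb h X)) U))"
    using sep_complete_axioms by blast
qed

section \<open>Metrization and compactness\<close>

lemma metrized_if_pieces:
  assumes "\<And>B h. (B, h) \<in> arrs A \<Longrightarrow>
    on_cover B (\<lambda>W j. \<exists>s. sep_complete W (pb j (pb h X)) (pbm j (pbm h d)) s)"
  shows "metrized_obj A X d"
  unfolding metrized_obj_def
proof clarify
  fix B h U assume h: "(B, h) \<in> arrs A" and U: "open_subset B (pb h X) U"
  show "on_cover B (\<lambda>W j. overt_union_of_balls W (pb j (pb h X)) (pbm j (pbm h d)) (pbm j U))"
    by (rule on_cover_mono[OF assms[OF h] arrs_is_T[OF h]])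
       (blast intro: sep_complete.overt_union open_subset_pb[OF _ U])
qed

lemma compact_if_pieces:
  assumes X: "presheaf_over A X"
    and pieces: "\<And>B h. (B, h) \<in> arrs A \<Longrightarrow> on_cover B (\<lambda>W j. \<forall>U. open_subset W (pb j (pb h X)) U \<longrightarrow>
      openin W (all_points W (pb j (pb h X)) U))"
  shows "compact_obj A X"
  unfolding compact_obj_def
proof clarify
  fix B h U assume h: "(B, h) \<in> arrs A" and U: "open_subset B (pb h X) U"
  note F = presheaf_pb[OF h X] and B = arrs_is_T[OF h]
  have "openin B (all_points B (pb h X) U)"
  proof (subst openin_subopen, intro ballI)
    fix b assume b: "b \<in> all_points B (pb h X) U"
    then have "b \<in> topspace B" by (simp add: all_points_def)
    obtain V where V: "openin B V" "b \<in> V" and "\<forall>U. open_subset (subtopology B V) (pb (incl (subtopology B V)) (pb h X)) U \<longrightarrow>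
        openin (subtopology B V) (all_points (subtopology B V) (pb (incl (subtopology B V)) (pb h X)) U)"
      using pieces[OF h] \<open>b \<in> topspace B\<close> by (rule on_coverE)
    then have "openin (subtopology B V) (all_points B (pb h X) U \<inter> V)"
      using open_subset_pb[OF arrs_incl[OF B] U, of V] all_points_restrict[OF F U B, of V] by metis
    then have "openin B (all_points B (pb h X) U \<inter> V)" using V(1) by (rule openin_trans_full)
    then show "\<exists>T. openin B T \<and> b \<in> T \<and> T \<subseteq> all_points B (pb h X) U" using b V(2) by blast
  qed
  then show "tv_all B (pb h X) U \<in> Sigma_tv B" unfolding tv_all_eq[OF F U] Sigma_tv_def by blast
qed

theorem theorem5p14:
  fixes A :: space and X :: "'a univ psh" and d :: "'a univ dist"
  assumes "is_T A" and "metric_obj A X d" and "complete_obj A X d"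
  shows "(metrically_separable_obj A X d \<longrightarrow> metrized_obj A X d) \<and>
         (totally_bounded_obj A X d \<longrightarrow> metrized_obj A X d \<and> compact_obj A X)"
proof (intro conjI impI)
  assume "metrically_separable_obj A X d"
  then show "metrized_obj A X d" by (intro metrized_if_pieces separable_pieces[OF assms])
next
  assume tb: "totally_bounded_obj A X d"
  note pieces = totally_bounded_pieces[OF assms tb]
  show "metrized_obj A X d"
    by (intro metrized_if_pieces on_cover_mono[OF pieces]) (auto dest: arrs_is_T)
  show "compact_obj A X"
    by (intro compact_if_pieces metric_presheaf[OF assms(2)] on_cover_mono[OF pieces]) (auto dest: arrs_is_T)
qed

end
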